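(* The following decision problem $DP_{a,b}$ is $\mathbf{PSPACE}$-complete: given a bimodal formula $\phi$, determine whether $\phi$ is valid in the class of all weakly dense frames.
   Context: Bimodal formulas are built from atoms, $\bot$, $\neg$, $\wedge$ and two box operators $\square_a,\square_b$. A frame is a triple $(W,R_a,R_b)$ with $W$ nonempty and $R_a,R_b\subseteq W\times W$, with standard Kripke semantics ($s\models\square_x\phi$ iff $t\models\phi$ for all $t$ with $sR_xt$). A frame is weakly dense if for all $s,t$ with $sR_at$ there is $u$ with $sR_au$ and $uR_bt$. Validity in a class of frames means truth at all worlds of all models based on frames of the class. (The set of such valid formulas is the least normal bimodal logic containing $\square_a\square_b p\rightarrow\square_a p$.) *)

theory Defs
  imports "HOL-Computational_Algebra.Polynomial" "HOL-Library.Countable_Set"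
begin

section \<open>Bimodal formulas and weakly dense frames\<close>

datatype fm = Atom nat | Bot | Neg fm | And fm fm | BoxA fm | BoxB fm

definition frame :: "'w set \<Rightarrow> ('w \<times> 'w) set \<Rightarrow> ('w \<times> 'w) set \<Rightarrow> bool" where
  "frame W Ra Rb \<longleftrightarrow> W \<noteq> {} \<and> Ra \<subseteq> W \<times> W \<and> Rb \<subseteq> W \<times> W"

definition weakly_dense :: "('w \<times> 'w) set \<Rightarrow> ('w \<times> 'w) set \<Rightarrow> bool" where
  "weakly_dense Ra Rb \<longleftrightarrow> (\<forall>s t. (s, t) \<in> Ra \<longrightarrow> (\<exists>u. (s, u) \<in> Ra \<and> (u, t) \<in> Rb))"

fun sat :: "('w \<times> 'w) set \<Rightarrow> ('w \<times> 'w) set \<Rightarrow> (nat \<Rightarrow> 'w set) \<Rightarrow> 'w \<Rightarrow> fm \<Rightarrow> bool" where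
  "sat Ra Rb V s (Atom n) \<longleftrightarrow> s \<in> V n"
| "sat Ra Rb V s Bot \<longleftrightarrow> False"
| "sat Ra Rb V s (Neg \<phi>) \<longleftrightarrow> \<not> sat Ra Rb V s \<phi>"
| "sat Ra Rb V s (And \<phi> \<psi>) \<longleftrightarrow> sat Ra Rb V s \<phi> \<and> sat Ra Rb V s \<psi>"
| "sat Ra Rb V s (BoxA \<phi>) \<longleftrightarrow> (\<forall>t. (s, t) \<in> Ra \<longrightarrow> sat Ra Rb V t \<phi>)"
| "sat Ra Rb V s (BoxB \<phi>) \<longleftrightarrow> (\<forall>t. (s, t) \<in> Rb \<longrightarrow> sat Ra Rb V t \<phi>)"

text \<open>
  HOL cannot quantify over the types from which worlds are drawn, so the type is a parameter:
  \<open>W\<close> ranges over all subsets of \<open>'w\<close>.  For infinite \<open>'w\<close> the parameter is immaterial,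
  see \<open>wd_valid_all_types\<close> below.
\<close>

definition wd_valid :: "'w itself \<Rightarrow> fm \<Rightarrow> bool" where
  "wd_valid (_ :: 'w itself) \<phi> \<longleftrightarrow>
     (\<forall>(W :: 'w set) Ra Rb V. frame W Ra Rb \<longrightarrow> weakly_dense Ra Rb \<longrightarrow>
        (\<forall>s \<in> W. sat Ra Rb V s \<phi>))"

lemma sat_transport:
  assumes inj: "inj_on f C" and clo: "\<And>w x. w \<in> C \<Longrightarrow> g w x \<in> C"
    and wA: "\<And>w \<psi>. (\<exists>t. (w, t) \<in> Ra \<and> \<not> sat Ra Rb V t \<psi>) \<Longrightarrow>
      \<exists>x. (w, g w x) \<in> Ra \<and> \<not> sat Ra Rb V (g w x) \<psi>"
    and wB: "\<And>w \<psi>. (\<exists>t. (w, t) \<in> Rb \<and> \<not> sat Ra Rb V t \<psi>) \<Longrightarrow>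
      \<exists>x. (w, g w x) \<in> Rb \<and> \<not> sat Ra Rb V (g w x) \<psi>"
    and w: "w \<in> C"
  shows "sat (map_prod f f ` (Ra \<inter> C \<times> C)) (map_prod f f ` (Rb \<inter> C \<times> C))
           (\<lambda>n. f ` (V n \<inter> C)) (f w) \<phi> \<longleftrightarrow> sat Ra Rb V w \<phi>"
  using w
proof (induction \<phi> arbitrary: w)
  case (Atom n)
  then show ?case using inj by (auto simp: inj_on_def)
next
  case (BoxA \<phi>)
  have e: "(f w, y) \<in> map_prod f f ` (Ra \<inter> C \<times> C) \<longleftrightarrow> (\<exists>t\<in>C. y = f t \<and> (w, t) \<in> Ra)" for y
    using inj BoxA.prems by (force simp: inj_on_def)
  show ?case
    using BoxA.IH clo[OF BoxA.prems] wA[of w \<phi>] by (simp add: e) blast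
next
  case (BoxB \<phi>)
  have e: "(f w, y) \<in> map_prod f f ` (Rb \<inter> C \<times> C) \<longleftrightarrow> (\<exists>t\<in>C. y = f t \<and> (w, t) \<in> Rb)" for y
    using inj BoxB.prems by (force simp: inj_on_def)
  show ?case
    using BoxB.IH clo[OF BoxB.prems] wB[of w \<phi>] by (simp add: e) blast
qed auto

instance fm :: countable
  by countable_datatype

lemma wd_valid_all_types:
  assumes "infinite (UNIV :: 'w set)" and val: "wd_valid TYPE('w) \<phi>"
  shows "wd_valid TYPE('v) \<phi>"
  unfolding wd_valid_def
proof (intro allI impI ballI)
  fix W :: "'v set" and Ra Rb V s
  assume fr: "frame W Ra Rb" and wd: "weakly_dense Ra Rb" and s: "s \<in> W"
  define stepA where "stepA = (\<lambda>w \<psi>. SOME t. (w, t) \<in> Ra \<and> \<not> sat Ra Rb V t \<psi>)"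
  define stepB where "stepB = (\<lambda>w \<psi>. SOME t. (w, t) \<in> Rb \<and> \<not> sat Ra Rb V t \<psi>)"
  define mid where "mid = (\<lambda>w t. SOME u. (w, u) \<in> Ra \<and> (u, t) \<in> Rb)"
  define g where "g = (\<lambda>w x. case x of Inl \<psi> \<Rightarrow> stepA w \<psi> | Inr \<psi> \<Rightarrow> stepB w \<psi>)"
  define F where "F = (\<lambda>X. X \<union> (\<lambda>(w, x). g w x) ` (X \<times> UNIV) \<union> (\<lambda>(w, t). mid w t) ` (X \<times> X))"
  define C where "C = (\<Union>n. (F ^^ n) {s})"
  have cF: "countable (F X)" if "countable X" for X
    unfolding F_def using that by (intro countable_Un countable_image countable_SIGMA) auto
  have "countable ((F ^^ n) {s})" for n
    by (induction n) (simp_all add: cF)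
  then have cC: "countable C" unfolding C_def by auto
  have sC: "s \<in> C" unfolding C_def by (rule UN_I[of 0]) auto
  have mono: "(F ^^ m) {s} \<subseteq> (F ^^ n) {s}" if "m \<le> n" for m n
    using that by (induction rule: dec_induct) (auto simp: F_def)
  have FC: "F ((F ^^ n) {s}) \<subseteq> C" for n
    unfolding C_def by (rule order_trans[OF _ UN_upper[of "Suc n"]]) simp_all
  have gC: "g w x \<in> C" if "w \<in> C" for w x
  proof -
    from that obtain n where "w \<in> (F ^^ n) {s}" unfolding C_def by auto
    then have "g w x \<in> F ((F ^^ n) {s})"
      unfolding F_def by (intro UnI1 UnI2 image_eqI[of _ _ "(w, x)"]) auto
    then show ?thesis using FC by blast
  qed
  have mC: "mid w t \<in> C" if "w \<in> C" "t \<in> C" for w t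
  proof -
    from that obtain m n where "w \<in> (F ^^ m) {s}" "t \<in> (F ^^ n) {s}" unfolding C_def by auto
    then have "w \<in> (F ^^ (max m n)) {s}" "t \<in> (F ^^ (max m n)) {s}"
      using mono[of m "max m n"] mono[of n "max m n"] by auto
    then have "mid w t \<in> F ((F ^^ (max m n)) {s})"
      unfolding F_def by (intro UnI2 image_eqI[of _ _ "(w, t)"]) auto
    then show ?thesis using FC by blast
  qed
  have wA: "\<exists>x. (w, g w x) \<in> Ra \<and> \<not> sat Ra Rb V (g w x) \<psi>"
    if "\<exists>t. (w, t) \<in> Ra \<and> \<not> sat Ra Rb V t \<psi>" for w \<psi>
    unfolding g_def stepA_def by (rule exI[of _ "Inl \<psi>"], unfold sum.case, rule someI_ex[OF that])
  have wB: "\<exists>x. (w, g w x) \<in> Rb \<and> \<not> sat Ra Rb V (g w x) \<psi>"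
    if "\<exists>t. (w, t) \<in> Rb \<and> \<not> sat Ra Rb V t \<psi>" for w \<psi>
    unfolding g_def stepB_def by (rule exI[of _ "Inr \<psi>"], unfold sum.case, rule someI_ex[OF that])
  have mid: "(w, mid w t) \<in> Ra \<and> (mid w t, t) \<in> Rb" if "(w, t) \<in> Ra" for w t
    unfolding mid_def
    by (rule someI_ex, rule wd[unfolded weakly_dense_def, rule_format, OF that])
  obtain e :: "nat \<Rightarrow> 'w" where e: "inj e"
    using assms(1) infinite_countable_subset by blast
  define f where "f = e \<circ> to_nat_on C"
  have inj: "inj_on f C"
    unfolding f_def
    by (rule comp_inj_on[OF inj_on_to_nat_on[OF cC] inj_on_subset[OF e subset_UNIV]])
  let ?Ra = "map_prod f f ` (Ra \<inter> C \<times> C)" and ?Rb = "map_prod f f ` (Rb \<inter> C \<times> C)"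
  have "frame (f ` C) ?Ra ?Rb"
    unfolding frame_def using sC by auto
  moreover have "weakly_dense ?Ra ?Rb"
    unfolding weakly_dense_def
  proof (intro allI impI)
    fix y z assume "(y, z) \<in> ?Ra"
    then obtain x where x: "x \<in> Ra \<inter> C \<times> C" "(y, z) = map_prod f f x" by (rule imageE)
    define w where "w = fst x"
    define t where "t = snd x"
    have wt: "(w, t) \<in> Ra" "w \<in> C" "t \<in> C" and yz: "y = f w" "z = f t"
      using x by (cases x, simp add: w_def t_def)+
    have "(w, mid w t) \<in> Ra \<inter> C \<times> C" "(mid w t, t) \<in> Rb \<inter> C \<times> C"
      using mid[OF wt(1)] mC[OF wt(2,3)] wt(2,3) by (simp_all only: Int_iff mem_Sigma_iff simp_thms)
    then have "(y, f (mid w t)) \<in> ?Ra" "(f (mid w t), z) \<in> ?Rb"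
      unfolding yz by (metis (no_types) map_prod_simp imageI)+
    then show "\<exists>u. (y, u) \<in> ?Ra \<and> (u, z) \<in> ?Rb" by (intro exI conjI)
  qed
  ultimately have "sat ?Ra ?Rb (\<lambda>n. f ` (V n \<inter> C)) (f s) \<phi>"
    by (rule val[unfolded wd_valid_def, rule_format, OF _ _ imageI[OF sC]])
  then show "sat Ra Rb V s \<phi>"
    using sat_transport[where f = f and C = C and g = g and Ra = Ra and Rb = Rb and V = V,
        OF inj gC wA wB sC] by (rule iffD1[rotated])
qed


section \<open>Formulas as binary strings\<close>

text \<open>
  Formulas are written in prefix notation over eight tokens of three bits each, and the atom with
  index \<open>n\<close> as the atom token followed by the binary digits of \<open>n\<close>, each digit \<open>d\<close> being
  the token \<open>[False, True, d]\<close>.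
\<close>

fun bin :: "nat \<Rightarrow> bool list" where
  "bin n = (if n = 0 then [] else bin (n div 2) @ [odd n])"

declare bin.simps [simp del]

fun enc :: "fm \<Rightarrow> bool list" where
  "enc Bot = [False, False, False]"
| "enc (Atom n) = [False, False, True] @ concat (map (\<lambda>d. [False, True, d]) (bin n))"
| "enc (Neg \<phi>) = [True, False, False] @ enc \<phi>"
| "enc (And \<phi> \<psi>) = [True, False, True] @ enc \<phi> @ enc \<psi>"
| "enc (BoxA \<phi>) = [True, True, False] @ enc \<phi>"
| "enc (BoxB \<phi>) = [True, True, True] @ enc \<phi>"

lemma bin_0: "bin 0 = []"
  by (subst bin.simps) simp

lemma bin_pos: "n \<noteq> 0 \<Longrightarrow> bin n = bin (n div 2) @ [odd n]"
  by (subst bin.simps) simp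

lemma bin_inj: "bin m = bin n \<Longrightarrow> m = n"
proof (induction m arbitrary: n rule: less_induct)
  case (less m)
  show ?case
  proof (cases "m = 0 \<or> n = 0")
    case True
    have nz: "bin k \<noteq> []" if "k \<noteq> 0" for k
      by (subst bin_pos[OF that]) simp
    have "bin m = [] \<or> bin n = []" using True bin_0 by blast
    then have "bin m = []" "bin n = []" using less.prems by simp_all
    then have "m = 0" "n = 0" using nz by blast+
    then show ?thesis by simp
  next
    case False
    then have m: "m \<noteq> 0" and n: "n \<noteq> 0" by simp_all
    have eq: "bin (m div 2) @ [odd m] = bin (n div 2) @ [odd n]"
      by (rule trans[OF bin_pos[OF m, symmetric] trans[OF less.prems bin_pos[OF n]]])
    have "bin (m div 2) = bin (n div 2)"
      by (rule conjunct1[OF iffD1[OF append1_eq_conv eq]])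
    moreover have "m div 2 < m" using m by simp
    ultimately have half: "m div 2 = n div 2" by (rule less.IH[rotated])
    have par: "odd m = odd n" by (rule conjunct2[OF iffD1[OF append1_eq_conv eq]])
    have "m mod 2 = n mod 2" unfolding mod2_eq_if using par by argo
    then show ?thesis using half div_mult_mod_eq[of m 2] div_mult_mod_eq[of n 2] by linarith
  qed
qed

lemma digits_unique:
  assumes "concat (map (\<lambda>d. [False, True, d]) xs) @ r = concat (map (\<lambda>d. [False, True, d]) ys) @ r'"
    and "\<nexists>d u. r = [False, True, d] @ u" and "\<nexists>d u. r' = [False, True, d] @ u"
  shows "xs = ys \<and> r = r'"
  using assms
proof (induction xs arbitrary: ys)
  case Nil
  then show ?case by (cases ys) auto
next
  case (Cons x xs)
  then show ?case by (cases ys) auto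
qed

lemma enc_unique:
  assumes "enc \<phi> @ r = enc \<psi> @ r'"
    and "\<nexists>d u. r = [False, True, d] @ u" and "\<nexists>d u. r' = [False, True, d] @ u"
  shows "\<phi> = \<psi> \<and> r = r'"
proof -
  have no: "\<nexists>d u. enc \<xi> @ v = [False, True, d] @ u" for \<xi> v
    by (cases \<xi>) auto
  show ?thesis
    using assms
  proof (induction \<phi> arbitrary: \<psi> r r')
    case (Atom n)
    from Atom.prems(1) obtain k where \<psi>: "\<psi> = Atom k" by (cases \<psi>) simp_all
    have "concat (map (\<lambda>d. [False, True, d]) (bin n)) @ r
        = concat (map (\<lambda>d. [False, True, d]) (bin k)) @ r'"
      using Atom.prems(1) \<psi> by simp
    from digits_unique[OF this Atom.prems(2,3)] show ?case
      using \<psi> bin_inj[of n k] by simp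
  next
    case (And \<phi>1 \<phi>2)
    from And.prems(1) obtain \<psi>1 \<psi>2 where \<psi>: "\<psi> = And \<psi>1 \<psi>2" by (cases \<psi>) simp_all
    then have "enc \<phi>1 @ (enc \<phi>2 @ r) = enc \<psi>1 @ (enc \<psi>2 @ r')" using And.prems(1) by simp
    note 1 = And.IH(1)[OF this no no]
    from And.IH(2)[OF conjunct2[OF 1] And.prems(2,3)] show ?case
      using 1 unfolding \<psi> by simp
  next
    case Bot
    from Bot.prems(1) show ?case by (cases \<psi>) simp_all
  next
    case (Neg \<phi>)
    from Neg.prems(1) obtain \<xi> where \<psi>: "\<psi> = Neg \<xi>" by (cases \<psi>) simp_all
    then have "enc \<phi> @ r = enc \<xi> @ r'" using Neg.prems(1) by simp
    from Neg.IH[OF this Neg.prems(2,3)] show ?case unfolding \<psi> by simp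
  next
    case (BoxA \<phi>)
    from BoxA.prems(1) obtain \<xi> where \<psi>: "\<psi> = BoxA \<xi>" by (cases \<psi>) simp_all
    then have "enc \<phi> @ r = enc \<xi> @ r'" using BoxA.prems(1) by simp
    from BoxA.IH[OF this BoxA.prems(2,3)] show ?case unfolding \<psi> by simp
  next
    case (BoxB \<phi>)
    from BoxB.prems(1) obtain \<xi> where \<psi>: "\<psi> = BoxB \<xi>" by (cases \<psi>) simp_all
    then have "enc \<phi> @ r = enc \<xi> @ r'" using BoxB.prems(1) by simp
    from BoxB.IH[OF this BoxB.prems(2,3)] show ?case unfolding \<psi> by simp
  qed
qed

lemma inj_enc: "inj enc"
proof (rule injI)
  fix \<phi> \<psi> assume "enc \<phi> = enc \<psi>"
  then show "\<phi> = \<psi>" using enc_unique[of \<phi> "[]" \<psi> "[]"] by simp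
qed

definition DP_ab :: "'w itself \<Rightarrow> bool list set" where
  "DP_ab T = {enc \<phi> | \<phi>. wd_valid T \<phi>}"


section \<open>Deterministic multi-tape Turing machines\<close>

datatype move = Left | Stay | Right

text \<open>
  States are the numbers below \<open>states\<close>, tape symbols those below \<open>symbols\<close>; symbol 0 is the
  blank, 1 and 2 stand for the bits.  Tapes are infinite in both directions.  The input is on the
  first tape, the output on the last one.
\<close>

record tm =
  tapes :: nat
  states :: nat
  symbols :: nat
  start :: nat
  accept :: nat
  reject :: nat
  delta :: "nat \<Rightarrow> nat list \<Rightarrow> nat \<times> (nat \<times> move) list"

definition wf_tm :: "tm \<Rightarrow> bool" where
  "wf_tm M \<longleftrightarrow> tapes M \<ge> 1 \<and> symbols M \<ge> 3 \<and>
     start M < states M \<and> accept M < states M \<and> reject M < states M \<and> accept M \<noteq> reject M \<and>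
     (\<forall>q < states M. \<forall>xs. length xs = tapes M \<longrightarrow> set xs \<subseteq> {..<symbols M} \<longrightarrow>
        (case delta M q xs of (q', acts) \<Rightarrow>
           q' < states M \<and> length acts = tapes M \<and> (\<forall>(y, m) \<in> set acts. y < symbols M)))"

type_synonym tape = "int \<times> (int \<Rightarrow> nat)"  \<comment> \<open>head position and cell contents\<close>
type_synonym config = "nat \<times> tape list"

definition contents :: "bool list \<Rightarrow> int \<Rightarrow> nat" where
  "contents w z = (if 0 \<le> z \<and> z < int (length w) then if w ! nat z then 2 else 1 else 0)"

definition init :: "tm \<Rightarrow> bool list \<Rightarrow> config" where
  "init M w = (start M, (0, contents w) # replicate (tapes M - 1) (0, \<lambda>_. 0))"

definition halted :: "tm \<Rightarrow> config \<Rightarrow> bool" where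
  "halted M c \<longleftrightarrow> fst c = accept M \<or> fst c = reject M"

fun act :: "nat \<times> move \<Rightarrow> tape \<Rightarrow> tape" where
  "act (y, m) (h, c) = (case m of Left \<Rightarrow> h - 1 | Stay \<Rightarrow> h | Right \<Rightarrow> h + 1, c(h := y))"

definition step :: "tm \<Rightarrow> config \<Rightarrow> config" where
  "step M c = (if halted M c then c else
     case c of (q, ts) \<Rightarrow>
       case delta M q (map (\<lambda>(h, c). c h) ts) of (q', acts) \<Rightarrow> (q', map2 act acts ts))"

definition run :: "tm \<Rightarrow> bool list \<Rightarrow> nat \<Rightarrow> config" where
  "run M w n = (step M ^^ n) (init M w)"

definition visited :: "tm \<Rightarrow> bool list \<Rightarrow> (nat \<times> int) set" where
  "visited M w = {(i, fst (snd (run M w n) ! i)) | i n. i < tapes M}"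


section \<open>Polynomial space, polynomial time, completeness\<close>

definition PSPACE :: "bool list set set" where
  "PSPACE = {L. \<exists>M (p :: nat poly). wf_tm M \<and> (\<forall>w.
     (\<exists>n. halted M (run M w n)) \<and>
     (w \<in> L \<longleftrightarrow> (\<exists>n. fst (run M w n) = accept M)) \<and>
     finite (visited M w) \<and> card (visited M w) \<le> poly p (length w))}"

text \<open>Halted configurations are repeated forever, so being halted at time \<open>t\<close> means having
  halted within \<open>t\<close> steps.\<close>

definition poly_time :: "(bool list \<Rightarrow> bool list) \<Rightarrow> bool" where
  "poly_time f \<longleftrightarrow> (\<exists>M (p :: nat poly). wf_tm M \<and> (\<forall>w.
     let c = run M w (poly p (length w))
     in halted M c \<and> snd (last (snd c)) = contents (f w)))"

definition poly_reducible :: "bool list set \<Rightarrow> bool list set \<Rightarrow> bool" where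
  "poly_reducible K L \<longleftrightarrow> (\<exists>f. poly_time f \<and> (\<forall>w. w \<in> K \<longleftrightarrow> f w \<in> L))"

definition PSPACE_complete :: "bool list set \<Rightarrow> bool" where
  "PSPACE_complete L \<longleftrightarrow> L \<in> PSPACE \<and> (\<forall>K \<in> PSPACE. poly_reducible K L)"

end

theory Submission
  imports Defs "HOL-Library.Extended_Nat" "HOL-Library.Cardinality"
begin

text \<open>
  Machines are obtained from programs of a small structured language over stacks, whose control
  states are the finitely many remainders of the program during its execution.

  Hardness needs no quantified Boolean formulas: by weak density, every \<open>R\<^sub>a\<close>-successor of a world
  starts an infinite chain of \<open>R\<^sub>a\<close>-successors in which each one is an \<open>R\<^sub>b\<close>-successor of the next one.
  The chain can be forced to encode the run of a space-bounded machine, because a formula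
  \<open>h \<or> \<box>\<^sub>b \<not> b\<close> transfers information from a world of the chain to the next one.

  For membership, types are vectors of truth values of the subformula occurrences.  A type is
  realizable up to modal depth \<open>k + 1\<close> iff it is consistent and all its demands are met by types
  realizable up to depth \<open>k\<close>; a \<open>\<box>\<^sub>a\<close>-demand needs an infinite chain of types as above, and a chain
  longer than the number of types suffices, since it contains a loop.  The existence of such a
  chain is the outcome of a game in which the defender names middle points and the challenger
  chooses halves, as in Savitch's theorem.  The resulting alternation of polynomially many Boolean
  quantifiers is evaluated by depth-first search.
\<close>

section \<open>A structured language for multi-stack programs\<close>

text \<open>The obstacle in the hardness proof is locality: a clause relates only two adjacent
  worlds, and its instances must be printable from a fixed template. Tape cells are therefore
  addressed relative to the head. The scanned symbols then always have index 0, and a step shifts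
  the index of any other cell by at most one or moves a neighbour of the head to the other side, so
  that finitely many rule shapes, instantiated at every index \<open>k\<close>, describe the
  machine. Indices are unary runs inside the binary names of atoms, since the printing program works
  with unary counters.

  In the membership proof a type raises many demands at once, and following all of them would make a
  play branch at every modal level. The challenger therefore selects a single demand by marking a
  position, and halving selects a single type of the claimed chain. With \<open>N\<close> tokens a
  play consists of \<open>N\<close> levels of \<open>2 * N + (N + 1)^2\<close> bits each, so the
  quantifier prefix has cubic length and fixed shape. Stacks of that height are all the space the
  search needs; its running time does not matter.\<close>

datatype 'a com = Skip | Push nat 'a | Wr nat 'a | Pop nat | Emit nat 'a
  | Seq "'a com" "'a com" (infixr \<open>;;\<close> 60)
  | Case nat "'a option \<Rightarrow> 'a com"
  | While nat "'a com"

fun tos :: "'a list \<Rightarrow> 'a option" where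
  "tos [] = None"
| "tos (x # xs) = Some x"

lemma top_eq_None [simp]: "tos xs = None \<longleftrightarrow> xs = []"
  by (cases xs) auto

text \<open>
  \<open>t\<close> counts the steps of the compiled machine: a push takes two of them, because a cell is written
  before the head moves.  \<open>B\<close> bounds the height of the stacks.
\<close>

inductive exec :: "enat \<Rightarrow> 'a com \<Rightarrow> (nat \<Rightarrow> 'a list) \<Rightarrow> nat \<Rightarrow> (nat \<Rightarrow> 'a list) \<Rightarrow> bool"
  for B where
  Skip: "exec B Skip \<sigma> 0 \<sigma>"
| Push: "enat (length (\<sigma> i)) < B \<Longrightarrow> exec B (Push i a) \<sigma> 2 (\<sigma>(i := a # \<sigma> i))"
| Pop: "exec B (Pop i) \<sigma> 1 (\<sigma>(i := tl (\<sigma> i)))"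
| Emit: "enat (length (\<sigma> i)) < B \<Longrightarrow> exec B (Emit i a) \<sigma> 1 (\<sigma>(i := \<sigma> i @ [a]))"
| Seq: "exec B c \<sigma> t \<sigma>1 \<Longrightarrow> exec B d \<sigma>1 t' \<sigma>2 \<Longrightarrow> exec B (c ;; d) \<sigma> (t + t' + 1) \<sigma>2"
| Case: "exec B (f (tos (\<sigma> i))) \<sigma> t \<sigma>' \<Longrightarrow> exec B (Case i f) \<sigma> (t + 1) \<sigma>'"
| WhileF: "\<sigma> i = [] \<Longrightarrow> exec B (While i c) \<sigma> 1 \<sigma>"
| WhileT: "\<sigma> i \<noteq> [] \<Longrightarrow> exec B c \<sigma> t \<sigma>1 \<Longrightarrow> exec B (While i c) \<sigma>1 t' \<sigma>2
    \<Longrightarrow> exec B (While i c) \<sigma> (t + t' + 2) \<sigma>2"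

text \<open>\<open>Wr\<close> is excluded since it occurs only halfway through a push. Stack
  \<open>k\<close> is reserved for the output: its tape grows to the right from cell 0, so it can be
  appended to but is never read.\<close>

primrec wfc :: "nat \<Rightarrow> 'a com \<Rightarrow> bool" where
  "wfc k Skip \<longleftrightarrow> True"
| "wfc k (Push i a) \<longleftrightarrow> i < k"
| "wfc k (Wr i a) \<longleftrightarrow> False"
| "wfc k (Pop i) \<longleftrightarrow> i < k"
| "wfc k (Emit i a) \<longleftrightarrow> i = k"
| "wfc k (c ;; d) \<longleftrightarrow> wfc k c \<and> wfc k d"
| "wfc k (Case i f) \<longleftrightarrow> i < k \<and> (\<forall>x. wfc k (f x))"
| "wfc k (While i c) \<longleftrightarrow> i < k \<and> wfc k c"

section \<open>Compilation to Turing machines\<close>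

text \<open>
  The control state of the compiled machine is the command that remains to be executed.  Only
  finitely many commands arise in this way (cf. the derivatives of a regular expression).
  \<open>Wr\<close> is the second half of a push.
\<close>

primrec derivs :: "'a com \<Rightarrow> 'a com set" where
  "derivs Skip = {Skip}"
| "derivs (Push i a) = {Push i a, Wr i a, Skip}"
| "derivs (Wr i a) = {Wr i a, Skip}"
| "derivs (Pop i) = {Pop i, Skip}"
| "derivs (Emit i a) = {Emit i a, Skip}"
| "derivs (c ;; d) = (\<lambda>c'. c' ;; d) ` derivs c \<union> derivs d"
| "derivs (Case i f) = insert (Case i f) (\<Union>x. derivs (f x))"
| "derivs (While i c) = {While i c, Skip} \<union> (\<lambda>c'. c' ;; While i c) ` derivs c"

text \<open>The only tape touched by the next step; \<open>0\<close> is an arbitrary choice where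
  nothing but a finished \<open>Skip\<close> is to be handled.\<close>

fun actv :: "'a com \<Rightarrow> nat" where
  "actv Skip = 0"
| "actv (Push i a) = i"
| "actv (Wr i a) = i"
| "actv (Pop i) = i"
| "actv (Emit i a) = i"
| "actv (c ;; d) = (if c = Skip then 0 else actv c)"
| "actv (Case i f) = i"
| "actv (While i c) = i"

text \<open>The head rests on the top symbol of its stack, or on the blank cell at the base if the
  stack is empty. Hence a pop moves right only if it has read a symbol, and a push first moves left,
  restoring what it read.\<close>

fun nx :: "'a com \<Rightarrow> 'a option \<Rightarrow> 'a com \<times> 'a option \<times> move" where
  "nx Skip x = (Skip, x, Stay)"
| "nx (Push i a) x = (Wr i a, x, Left)"
| "nx (Wr i a) x = (Skip, Some a, Stay)"
| "nx (Pop i) x = (Skip, None, if x = None then Stay else Right)"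
| "nx (Emit i a) x = (Skip, Some a, Right)"
| "nx (c ;; d) x = (if c = Skip then (d, x, Stay) else (fst (nx c x) ;; d, snd (nx c x)))"
| "nx (Case i f) x = (f x, x, Stay)"
| "nx (While i c) x = (if x = None then Skip else c ;; While i c, x, Stay)"

lemma derivs_self: "c \<in> derivs c"
  by (induction c) auto

text \<open>The union over the branches of \<open>Case\<close> is finite because the alphabet is,
  and a loop contributes the derivatives of its body only once, each followed by the same
  loop.\<close>

lemma finite_derivs: "finite (derivs (c :: 'a :: finite com))"
  by (induction c) auto

lemma derivs_nx: "d \<in> derivs c \<Longrightarrow> fst (nx d x) \<in> derivs c"
proof (induction c arbitrary: d)
  case (Seq c1 c2)
  then show ?case by (auto simp: derivs_self split: if_splits)
next
  case (Case i f)
  show ?case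
  proof (cases "d = Case i f")
    case True
    then show ?thesis using derivs_self[of "f x"] by auto
  next
    case False
    then obtain y where "d \<in> derivs (f y)" using Case.prems by auto
    then have "fst (nx d x) \<in> derivs (f y)" by (rule Case.IH[rotated]) simp
    then show ?thesis by auto
  qed
next
  case (While i c)
  then show ?case by (auto simp: derivs_self split: if_splits)
qed auto

lemma derivs_actv: "wfc k c \<Longrightarrow> d \<in> derivs c \<Longrightarrow> actv d \<le> k"
proof (induction c arbitrary: d)
  case (Case i f)
  then show ?case by (auto simp: less_imp_le)
qed (auto simp: less_imp_le)

text \<open>The commands pending after \<open>c\<close>, nested to the left, because
  \<open>nx\<close> descends into the first component of a sequence.\<close>

fun ctx :: "'a com \<Rightarrow> 'a com list \<Rightarrow> 'a com" where
  "ctx c [] = c"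
| "ctx c (d # ds) = ctx (c ;; d) ds"

lemma ctx_not_Skip: "c \<noteq> Skip \<Longrightarrow> ctx c ds \<noteq> Skip"
  by (induction ds arbitrary: c) auto

lemma actv_ctx: "c \<noteq> Skip \<Longrightarrow> actv (ctx c ds) = actv c"
  by (induction ds arbitrary: c) auto

lemma nx_ctx: "c \<noteq> Skip \<Longrightarrow> nx (ctx c ds) x = (ctx (fst (nx c x)) ds, snd (nx c x))"
  by (induction ds arbitrary: c) auto

text \<open>\<open>\<iota>\<close> takes positive values only, which leaves code 0 to the blank. At
  least two stacks are required, since stack 1 carries the verdict.\<close>

locale compiled =
  fixes c0 :: "'a :: finite com" and k :: nat and \<iota> :: "'a \<Rightarrow> nat" and code :: "'a com \<Rightarrow> nat"
  assumes wfc0: "wfc k c0" and k2: "k \<ge> 2"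
    and iota: "bij_betw \<iota> UNIV {1..CARD('a)}" and card2: "CARD('a) \<ge> 2"
    and code: "bij_betw code (derivs c0) {..<card (derivs c0)}"
begin

definition eo :: "'a option \<Rightarrow> nat" where
  "eo x = (case x of None \<Rightarrow> 0 | Some a \<Rightarrow> \<iota> a)"

definition de :: "nat \<Rightarrow> 'a option" where
  "de s = (if s \<in> range \<iota> then Some (the_inv \<iota> s) else None)"

definition D :: nat where "D = card (derivs c0)"

definition decode :: "nat \<Rightarrow> 'a com" where
  "decode = the_inv_into (derivs c0) code"

definition nop :: "nat list \<Rightarrow> (nat \<times> move) list" where
  "nop xs = map (\<lambda>x. (x, Stay)) xs"

text \<open>States below \<open>D\<close> are codes of derivatives; \<open>D\<close> and
  \<open>D + 1\<close> are the halting states. A finished program accepts iff it has left something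
  on stack 1.\<close>

definition dlt :: "nat \<Rightarrow> nat list \<Rightarrow> nat \<times> (nat \<times> move) list" where
  "dlt q xs = (if q \<ge> D then (q, nop xs)
     else if decode q = Skip then (if xs ! 1 \<noteq> 0 then D else D + 1, nop xs)
     else let i = actv (decode q); (c, y, m) = nx (decode q) (de (xs ! i))
       in (code c, (nop xs)[i := (eo y, m)]))"

definition mach :: tm where
  "mach = \<lparr>tapes = k + 1, states = D + 2, symbols = CARD('a) + 1, start = code c0,
     accept = D, reject = D + 1, delta = dlt\<rparr>"

lemma mach_simps [simp]: "tapes mach = k + 1" "states mach = D + 2" "symbols mach = CARD('a) + 1"
  "start mach = code c0" "accept mach = D" "reject mach = D + 1" "delta mach = dlt"
  by (simp_all add: mach_def)

lemma inj_iota: "inj \<iota>" using iota by (simp add: bij_betw_def)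

lemma iota_range: "range \<iota> = {1..CARD('a)}" using iota by (simp add: bij_betw_def)

lemma eo_less: "eo x < CARD('a) + 1"
proof (cases x)
  case (Some a)
  then show ?thesis using rangeI[of \<iota> a] iota_range by (auto simp: eo_def)
qed (simp add: eo_def)

lemma de_eo [simp]: "de (eo x) = x"
proof (cases x)
  case None
  have "0 \<notin> range \<iota>" using iota_range by auto
  then show ?thesis using None by (simp add: eo_def de_def)
next
  case (Some a)
  then show ?thesis by (simp add: eo_def de_def the_inv_f_f[OF inj_iota])
qed

lemma eo_eq_0 [simp]: "eo x = 0 \<longleftrightarrow> x = None"
  by (metis de_eo eo_def option.simps(4))

lemma code_less: "c \<in> derivs c0 \<Longrightarrow> code c < D"
  using code by (auto simp: bij_betw_def D_def)

lemma decode_code [simp]: "c \<in> derivs c0 \<Longrightarrow> decode (code c) = c"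
  using code unfolding decode_def by (intro the_inv_into_f_f) (auto simp: bij_betw_def)

lemma decode_mem: "q < D \<Longrightarrow> decode q \<in> derivs c0"
  using code unfolding decode_def D_def bij_betw_def
  by (metis lessThan_iff order_refl the_inv_into_into)

lemma nop_sub: "set xs \<subseteq> {..<n} \<Longrightarrow> (y, m) \<in> set (nop xs) \<Longrightarrow> y < n"
  by (auto simp: nop_def)

lemma wf_mach: "wf_tm mach"
proof -
  have *: "case dlt q xs of (q', acts) \<Rightarrow>
           q' < D + 2 \<and> length acts = k + 1 \<and> (\<forall>(y, m) \<in> set acts. y < CARD('a) + 1)"
    if "length xs = k + 1" "set xs \<subseteq> {..<CARD('a) + 1}" "q < D + 2" for q xs
  proof -
    have 1: "\<forall>(y, m) \<in> set (nop xs). y < CARD('a) + 1" "length (nop xs) = k + 1"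
      using nop_sub[OF that(2)] that(1) by (auto simp: nop_def)
    show ?thesis
    proof (cases "q \<ge> D \<or> decode q = Skip")
      case True
      then show ?thesis using 1 that(3) by (auto simp: dlt_def Let_def)
    next
      case False
      let ?i = "actv (decode q)"
      obtain c y m where n: "nx (decode q) (de (xs ! ?i)) = (c, y, m)" by (cases rule: prod_cases3)
      have "c \<in> derivs c0" using derivs_nx[OF decode_mem, of q "de (xs ! ?i)"] False n by simp
      then have "code c < D" by (rule code_less)
      then show ?thesis using 1 False eo_less[of y]
        by (auto simp: dlt_def Let_def n dest!: set_mp[OF set_update_subset_insert])
    qed
  qed
  show ?thesis
    unfolding wf_tm_def using k2 card2 code_less[OF derivs_self] *
    by (auto intro: less_SucI less_trans[OF _ lessI])
qed

text \<open>Stacks grow to the left from their base \<open>b\<close>. An input of length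
  \<open>l\<close>, written on the cells from 0 on with the head on cell 0, thus already is a stack
  with base \<open>l\<close> and its first bit on top.\<close>

definition stk :: "int \<Rightarrow> 'a list \<Rightarrow> tape" where
  "stk b xs = (b - int (length xs), \<lambda>z. if b - int (length xs) \<le> z \<and> z < b
     then \<iota> (xs ! nat (z - (b - int (length xs)))) else 0)"

definition outt :: "'a list \<Rightarrow> tape" where
  "outt xs = (int (length xs), \<lambda>z. if 0 \<le> z \<and> z < int (length xs) then \<iota> (xs ! nat z) else 0)"

definition tp :: "nat \<Rightarrow> (nat \<Rightarrow> 'a list) \<Rightarrow> nat \<Rightarrow> tape" where
  "tp l \<sigma> i = (if i < k then stk (if i = 0 then int l else 0) (\<sigma> i) else outt (\<sigma> i))"

definition tps :: "nat \<Rightarrow> (nat \<Rightarrow> 'a list) \<Rightarrow> tape list" where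
  "tps l \<sigma> = map (tp l \<sigma>) [0..<k + 1]"

abbreviation rd :: "tape \<Rightarrow> nat" where "rd \<equiv> \<lambda>(h, c). c h"

lemma rd_stk: "rd (stk b xs) = eo (tos xs)"
  by (cases xs) (auto simp: stk_def eo_def)

lemma rd_outt: "rd (outt xs) = eo None"
  by (auto simp: outt_def eo_def)

lemma act_id: "act (rd T, Stay) T = T"
  by (cases T) auto

lemma act_pop: "act (0, Right) (stk b (x # xs)) = stk b xs"
  by (auto simp: stk_def fun_eq_iff nth_Cons' nat_diff_distrib intro!: arg_cong[where f = \<iota>] arg_cong[where f = "nth xs"])

lemma act_pop0: "act (0, Stay) (stk b []) = stk b []"
  by (auto simp: stk_def)

lemma act_push: "act (\<iota> a, Stay) (act (eo (tos xs), Left) (stk b xs)) = stk b (a # xs)"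
proof -
  have "act (eo (tos xs), Left) (stk b xs) = (b - int (length xs) - 1, snd (stk b xs))"
    using rd_stk[of b xs] by (auto simp: stk_def split: if_splits)
  then show ?thesis
    by (auto simp: stk_def fun_eq_iff nth_Cons' intro!: arg_cong[where f = \<iota>] arg_cong[where f = "nth xs"])
qed

lemma act_emit: "act (\<iota> a, Right) (outt xs) = outt (xs @ [a])"
  by (auto simp: outt_def fun_eq_iff nth_append)

text \<open>The summand \<open>l\<close> accounts for the first tape, whose base is cell
  \<open>l\<close> instead of 0.\<close>

definition good :: "enat \<Rightarrow> nat \<Rightarrow> tape list \<Rightarrow> bool" where
  "good B l ts \<longleftrightarrow> (\<forall>i\<le>k. enat (nat \<bar>fst (ts ! i)\<bar>) \<le> B + enat l)"

definition path :: "enat \<Rightarrow> nat \<Rightarrow> nat \<Rightarrow> config \<Rightarrow> config \<Rightarrow> bool" where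
  "path B l n x y \<longleftrightarrow> (step mach ^^ n) x = y \<and> (\<forall>m\<le>n. good B l (snd ((step mach ^^ m) x)))"

lemma path_trans: "path B l m x y \<Longrightarrow> path B l n y z \<Longrightarrow> path B l (m + n) x z"
  unfolding path_def
proof (intro conjI allI impI)
  assume a: "(step mach ^^ m) x = y \<and> (\<forall>j\<le>m. good B l (snd ((step mach ^^ j) x)))"
    and b: "(step mach ^^ n) y = z \<and> (\<forall>j\<le>n. good B l (snd ((step mach ^^ j) y)))"
  have *: "(step mach ^^ (m + j)) x = (step mach ^^ j) y" for j
    using a by (simp add: funpow_add add.commute[of m])
  show "(step mach ^^ (m + n)) x = z" using * b by simp
  fix i assume "i \<le> m + n"
  then show "good B l (snd ((step mach ^^ i) x))"
    using a b *[of "i - m"] by (cases "i \<le> m") auto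
qed

lemma path1: "step mach x = y \<Longrightarrow> good B l (snd x) \<Longrightarrow> good B l (snd y) \<Longrightarrow> path B l 1 x y"
  unfolding path_def by (auto simp: le_Suc_eq)

lemma path0: "good B l (snd x) \<Longrightarrow> path B l 0 x x"
  unfolding path_def by auto

definition low :: "enat \<Rightarrow> (nat \<Rightarrow> 'a list) \<Rightarrow> bool" where
  "low B \<sigma> \<longleftrightarrow> (\<forall>i\<le>k. enat (length (\<sigma> i)) \<le> B)"

lemma good_tps: "low B \<sigma> \<Longrightarrow> good B l (tps l \<sigma>)"
  unfolding good_def
proof (intro allI impI)
  fix i assume lo: "low B \<sigma>" and i: "i \<le> k"
  have "nth (tps l \<sigma>) i = tp l \<sigma> i" unfolding tps_def using i by (simp del: upt_Suc)
  then have "nat \<bar>fst (tps l \<sigma> ! i)\<bar> \<le> length (\<sigma> i) + l"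
    by (auto simp: tp_def stk_def outt_def)
  then have "enat (nat \<bar>fst (tps l \<sigma> ! i)\<bar>) \<le> enat (length (\<sigma> i)) + enat l"
    by simp
  also have "\<dots> \<le> B + enat l"
    using lo i unfolding low_def by (intro add_right_mono) auto
  finally show "enat (nat \<bar>fst (tps l \<sigma> ! i)\<bar>) \<le> B + enat l" .
qed

lemma length_tps [simp]: "length (tps l \<sigma>) = k + 1"
  by (simp add: tps_def)

lemma nth_tps: "i \<le> k \<Longrightarrow> tps l \<sigma> ! i = tp l \<sigma> i"
  unfolding tps_def by (simp del: upt_Suc)

lemma tps_upd: "i \<le> k \<Longrightarrow> tps l (\<sigma>(i := xs)) = (tps l \<sigma>)[i := tp l (\<sigma>(i := xs)) i]"
  by (rule nth_equalityI) (auto simp: nth_tps nth_list_update tp_def)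

lemma map2_nop: "map2 act (nop (map rd ts)) ts = ts"
  unfolding nop_def
proof (induction ts)
  case (Cons T ts)
  then show ?case using act_id[of T] by (simp del: act.simps)
qed simp

lemma map2_upd: "length as = length ts \<Longrightarrow> i < length ts \<Longrightarrow>
   map2 act (as[i := a]) ts = (map2 act as ts)[i := act a (ts ! i)]"
  by (rule nth_equalityI) (auto simp: nth_list_update)

lemma step_mach:
  assumes c: "c \<in> derivs c0" and ns: "c \<noteq> Skip" and len: "length ts = k + 1"
    and n: "nx c (de (rd (ts ! actv c))) = (c', y, m)"
  shows "step mach (code c, ts) = (code c', ts[actv c := act (eo y, m) (ts ! actv c)])"
proof -
  have lt: "code c < D" by (rule code_less[OF c])
  have ia: "actv c < length ts" using derivs_actv[OF wfc0 c] len by simp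
  have "dlt (code c) (map rd ts) = (code c', (nop (map rd ts))[actv c := (eo y, m)])"
    using lt ia n by (simp add: dlt_def decode_code[OF c] ns Let_def)
  moreover have "map2 act ((nop (map rd ts))[actv c := (eo y, m)]) ts = ts[actv c := act (eo y, m) (ts ! actv c)]"
  proof -
    have "length (nop (map rd ts)) = length ts" by (simp add: nop_def)
    then show ?thesis using ia by (simp only: map2_upd map2_nop)
  qed
  ultimately show ?thesis
    using lt by (simp add: step_def halted_def del: act.simps)
qed

lemma step_tps:
  assumes c: "ctx c ds \<in> derivs c0" and ns: "c \<noteq> Skip" and i: "actv c \<le> k"
    and n: "nx c (if actv c < k then tos (\<sigma> (actv c)) else None) = (c', y, m)"
  shows "ctx c' ds \<in> derivs c0"
    "step mach (code (ctx c ds), tps l \<sigma>)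
      = (code (ctx c' ds), (tps l \<sigma>)[actv c := act (eo y, m) (tp l \<sigma> (actv c))])"
proof -
  let ?x = "if actv c < k then tos (\<sigma> (actv c)) else None"
  have r: "de (rd (tp l \<sigma> (actv c))) = ?x"
    unfolding tp_def by (auto simp: rd_stk rd_outt)
  show "ctx c' ds \<in> derivs c0" using derivs_nx[OF c, of ?x] by (simp add: nx_ctx[OF ns] n)
  show "step mach (code (ctx c ds), tps l \<sigma>)
      = (code (ctx c' ds), (tps l \<sigma>)[actv c := act (eo y, m) (tp l \<sigma> (actv c))])"
    using step_mach[OF c ctx_not_Skip[OF ns] length_tps, of l \<sigma> "ctx c' ds" y m]
    by (simp add: actv_ctx[OF ns] r nx_ctx[OF ns] n nth_tps[OF i])
qed

lemma tps_same: "i \<le> k \<Longrightarrow> act (eo (if i < k then tos (\<sigma> i) else None), Stay) (tp l \<sigma> i) = tp l \<sigma> i"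
  using act_id[of "tp l \<sigma> i"] by (auto simp: tp_def rd_stk rd_outt)

lemma step_stay:
  assumes c: "ctx c ds \<in> derivs c0" and ns: "c \<noteq> Skip" and i: "actv c < k"
    and n: "nx c (tos (\<sigma> (actv c))) = (c', tos (\<sigma> (actv c)), Stay)" and lo: "low B \<sigma>"
  shows "ctx c' ds \<in> derivs c0" "path B l 1 (code (ctx c ds), tps l \<sigma>) (code (ctx c' ds), tps l \<sigma>)"
proof -
  have i': "actv c \<le> k" using i by simp
  have e: "(tps l \<sigma>)[actv c := act (eo (tos (\<sigma> (actv c))), Stay) (tp l \<sigma> (actv c))] = tps l \<sigma>"
    using tps_same[OF i', of \<sigma> l] i nth_tps[OF i', of l \<sigma>] list_update_id[of "tps l \<sigma>" "actv c"]
    by (simp del: act.simps)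
  show "ctx c' ds \<in> derivs c0" by (rule step_tps(1)[OF c ns i', of \<sigma>]) (use n i in simp)
  have "step mach (code (ctx c ds), tps l \<sigma>) = (code (ctx c' ds), tps l \<sigma>)"
    using step_tps(2)[OF c ns i', of \<sigma> c' "tos (\<sigma> (actv c))" Stay l] n i e by (simp del: act.simps)
  then show "path B l 1 (code (ctx c ds), tps l \<sigma>) (code (ctx c' ds), tps l \<sigma>)"
    by (intro path1) (auto intro: good_tps lo)
qed

text \<open>The context \<open>ds\<close> is arbitrary because the parts of a sequence or loop run
  with the rest of the program pending. The head bound is carried along for all intermediate
  configurations, which is what \<open>path\<close> records.\<close>

lemma exec_path:
  assumes "exec B c \<sigma> t \<sigma>'" "wfc k c" "low B \<sigma>" "ctx c ds \<in> derivs c0"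
  shows "low B \<sigma>' \<and> ctx Skip ds \<in> derivs c0
    \<and> path B l t (code (ctx c ds), tps l \<sigma>) (code (ctx Skip ds), tps l \<sigma>')"
  using assms
proof (induction arbitrary: ds rule: exec.induct)
  case (Skip \<sigma>)
  then show ?case by (auto intro!: path0 good_tps)
next
  case (Push \<sigma> i a)
  then have i: "i < k" by simp
  let ?s = "\<sigma>(i := a # \<sigma> i)"
  have lo: "low B ?s" using Push by (auto simp: low_def Suc_ile_eq simp flip: less_eq_enat_def)
  let ?T = "(tps l \<sigma>)[i := act (eo (tos (\<sigma> i)), Left) (tp l \<sigma> i)]"
  have 1: "ctx (Wr i a) ds \<in> derivs c0"
    "step mach (code (ctx (Push i a) ds), tps l \<sigma>) = (code (ctx (Wr i a) ds), ?T)"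
    using step_tps[OF Push.prems(3), of \<sigma> "Wr i a" "tos (\<sigma> i)" Left] i by (simp_all del: act.simps)
  have 2: "ctx Skip ds \<in> derivs c0" using derivs_nx[OF 1(1), of None] by (simp add: nx_ctx)
  have n: "nx (ctx (Wr i a) ds) x = (ctx Skip ds, Some a, Stay)" for x by (simp add: nx_ctx)
  have "step mach (code (ctx (Wr i a) ds), ?T)
     = (code (ctx Skip ds), ?T[i := act (eo (Some a), Stay) (?T ! i)])"
    using step_mach[OF 1(1) ctx_not_Skip, of ?T, OF _ _ ] i by (simp add: actv_ctx n del: act.simps)
  also have "?T[i := act (eo (Some a), Stay) (?T ! i)] = tps l ?s"
    using i act_push[of a "\<sigma> i" "if i = 0 then int l else 0"]
    by (simp add: tps_upd nth_tps tp_def eo_def del: act.simps)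
  finally have 3: "step mach (code (ctx (Wr i a) ds), ?T) = (code (ctx Skip ds), tps l ?s)" .
  \<comment> \<open>Halfway through a push the head is already where the longer stack has it, so the
    bound for the resulting stacks covers this configuration as well.\<close>
  have hd: "fst (act (y, Left) (stk b xs)) = fst (stk b (a # xs))" for y b xs
    by (simp add: stk_def)
  have g: "good B l ?T"
    unfolding good_def
  proof (intro allI impI)
    fix j assume j: "j \<le> k"
    have "fst (?T ! j) = fst (tps l ?s ! j)"
      using i j hd by (auto simp: nth_tps tp_def nth_list_update simp del: act.simps)
    then show "enat (nat \<bar>fst (?T ! j)\<bar>) \<le> B + enat l"
      using good_tps[OF lo, of l] j unfolding good_def by simp
  qed
  have "path B l (1 + 1) (code (ctx (Push i a) ds), tps l \<sigma>) (code (ctx Skip ds), tps l ?s)"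
    using path_trans[OF path1[OF 1(2)] path1[OF 3]] g good_tps[OF lo] good_tps[OF Push.prems(2)]
    by simp
  then show ?case using 2 lo by (simp add: numeral_2_eq_2 fun_upd_def)
next
  case (Pop i \<sigma>)
  then have i: "i < k" by simp
  let ?s = "\<sigma>(i := tl (\<sigma> i))" and ?m = "if tos (\<sigma> i) = None then Stay else Right"
  have "enat (length (tl (\<sigma> i))) \<le> enat (length (\<sigma> i))" by simp
  then have lo: "low B ?s" using Pop(2) i unfolding low_def
    by (metis (no_types) fun_upd_apply le_trans less_imp_le order_trans)
  have 1: "ctx Skip ds \<in> derivs c0"
    "step mach (code (ctx (Pop i) ds), tps l \<sigma>) = (code (ctx Skip ds), (tps l \<sigma>)[i := act (eo None, ?m) (tp l \<sigma> i)])"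
    using step_tps[OF Pop.prems(3), of \<sigma> Skip None ?m] i by (simp_all del: act.simps)
  have "act (eo None, ?m) (tp l \<sigma> i) = tp l ?s i"
    using i by (cases "\<sigma> i") (auto simp: tp_def act_pop act_pop0 eo_def simp del: act.simps)
  then have "(tps l \<sigma>)[i := act (eo None, ?m) (tp l \<sigma> i)] = tps l ?s"
    using i by (simp add: tps_upd del: act.simps)
  then show ?case using 1 lo path1[OF 1(2)] by (simp add: good_tps Pop.prems(2) fun_upd_def)
next
  case (Emit \<sigma> i a)
  then have i: "i = k" by simp
  let ?s = "\<sigma>(i := \<sigma> i @ [a])"
  have lo: "low B ?s" using Emit by (auto simp: low_def Suc_ile_eq simp flip: less_eq_enat_def)
  have 1: "ctx Skip ds \<in> derivs c0"
    "step mach (code (ctx (Emit i a) ds), tps l \<sigma>)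
      = (code (ctx Skip ds), (tps l \<sigma>)[i := act (eo (Some a), Right) (tp l \<sigma> i)])"
    using step_tps[OF Emit.prems(3), of \<sigma> Skip "Some a" Right] i by (simp_all del: act.simps)
  have "act (eo (Some a), Right) (tp l \<sigma> i) = tp l ?s i"
    using i by (simp add: tp_def act_emit eo_def del: act.simps)
  then have "(tps l \<sigma>)[i := act (eo (Some a), Right) (tp l \<sigma> i)] = tps l ?s"
    using i by (simp add: tps_upd del: act.simps)
  then show ?case using 1 lo path1[OF 1(2)] by (simp add: good_tps Emit.prems(2) fun_upd_def)
next
  case (Seq c \<sigma> t \<sigma>1 d t' \<sigma>2)
  have a: "low B \<sigma>1 \<and> ctx Skip (d # ds) \<in> derivs c0 \<and>
    path B l t (code (ctx c (d # ds)), tps l \<sigma>) (code (ctx Skip (d # ds)), tps l \<sigma>1)"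
    by (rule Seq.IH(1)) (use Seq.prems in simp_all)
  \<comment> \<open>The extra step counted by \<open>exec.Seq\<close>: the finished
    \<open>Skip\<close> is dropped while tape 0 is rewritten unchanged.\<close>
  have b: "step mach (code (ctx (Skip ;; d) ds), tps l \<sigma>1) = (code (ctx d ds), tps l \<sigma>1)" and m: "ctx d ds \<in> derivs c0"
    using step_tps(1)[of "Skip ;; d" ds \<sigma>1 d "tos (\<sigma>1 0)" Stay]
      step_tps(2)[of "Skip ;; d" ds \<sigma>1 d "tos (\<sigma>1 0)" Stay l] a k2
      tps_same[of 0 \<sigma>1 l] nth_tps[of 0 l \<sigma>1] list_update_id[of "tps l \<sigma>1" 0]
    by (simp_all del: act.simps)
  have p: "path B l 1 (code (ctx (Skip ;; d) ds), tps l \<sigma>1) (code (ctx d ds), tps l \<sigma>1)"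
    by (rule path1[OF b]) (use a good_tps in auto)
  have e: "low B \<sigma>2 \<and> ctx Skip ds \<in> derivs c0 \<and>
    path B l t' (code (ctx d ds), tps l \<sigma>1) (code (ctx Skip ds), tps l \<sigma>2)"
    by (rule Seq.IH(2)) (use Seq.prems a m in simp_all)
  have "path B l t (code (ctx (c ;; d) ds), tps l \<sigma>) (code (ctx (Skip ;; d) ds), tps l \<sigma>1)"
    using a by simp
  from path_trans[OF path_trans[OF this p] conjunct2[OF conjunct2[OF e]]] e
  show ?case by (simp add: add.commute add.left_commute)
next
  case (Case f \<sigma> i t \<sigma>')
  have i: "i < k" using Case.prems by simp
  note a = step_stay[OF Case.prems(3), where \<sigma> = \<sigma> and c' = "f (tos (\<sigma> i))"]
  have e: "low B \<sigma>' \<and> ctx Skip ds \<in> derivs c0 \<and>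
    path B l t (code (ctx (f (tos (\<sigma> i))) ds), tps l \<sigma>) (code (ctx Skip ds), tps l \<sigma>')"
    by (rule Case.IH) (use Case.prems a i in simp_all)
  from path_trans[OF a(2) conjunct2[OF conjunct2[OF e]]] e i Case.prems show ?case by simp
next
  case (WhileF \<sigma> i c)
  have i: "i < k" using WhileF.prems by simp
  note a = step_stay[OF WhileF.prems(3), where \<sigma> = \<sigma> and c' = Skip]
  then show ?case using i WhileF by simp
next
  case (WhileT \<sigma> i c t \<sigma>1 t' \<sigma>2)
  have i: "i < k" using WhileT.prems by simp
  note a = step_stay[OF WhileT.prems(3), where \<sigma> = \<sigma> and c' = "c ;; While i c"]
  have b: "low B \<sigma>1 \<and> ctx Skip (While i c # ds) \<in> derivs c0 \<and>
    path B l t (code (ctx c (While i c # ds)), tps l \<sigma>) (code (ctx Skip (While i c # ds)), tps l \<sigma>1)"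
    by (rule WhileT.IH(1)) (use WhileT.prems WhileT.hyps a i in simp_all)
  have d: "step mach (code (ctx (Skip ;; While i c) ds), tps l \<sigma>1) = (code (ctx (While i c) ds), tps l \<sigma>1)"
    and m: "ctx (While i c) ds \<in> derivs c0"
    using step_tps(1)[of "Skip ;; While i c" ds \<sigma>1 "While i c" "tos (\<sigma>1 0)" Stay]
      step_tps(2)[of "Skip ;; While i c" ds \<sigma>1 "While i c" "tos (\<sigma>1 0)" Stay l] b k2
      tps_same[of 0 \<sigma>1 l] nth_tps[of 0 l \<sigma>1] list_update_id[of "tps l \<sigma>1" 0]
    by (simp_all del: act.simps)
  have p: "path B l 1 (code (ctx (Skip ;; While i c) ds), tps l \<sigma>1) (code (ctx (While i c) ds), tps l \<sigma>1)"
    by (rule path1[OF d]) (use b good_tps in auto)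
  have e: "low B \<sigma>2 \<and> ctx Skip ds \<in> derivs c0 \<and>
    path B l t' (code (ctx (While i c) ds), tps l \<sigma>1) (code (ctx Skip ds), tps l \<sigma>2)"
    by (rule WhileT.IH(2)) (use WhileT.prems b m in simp_all)
  have "path B l 1 (code (ctx (While i c) ds), tps l \<sigma>) (code (ctx (c ;; While i c) ds), tps l \<sigma>)"
    using a(2) i WhileT.prems WhileT.hyps by simp
  moreover have "path B l t (code (ctx (c ;; While i c) ds), tps l \<sigma>) (code (ctx (Skip ;; While i c) ds), tps l \<sigma>1)"
    using b by simp
  ultimately have "path B l (1 + t + 1 + t') (code (ctx (While i c) ds), tps l \<sigma>) (code (ctx Skip ds), tps l \<sigma>2)"
    using p e by (blast intro: path_trans)
  then show ?case using e by (simp add: add.commute add.left_commute)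
qed

definition start_stk :: "(bool \<Rightarrow> 'a) \<Rightarrow> bool list \<Rightarrow> nat \<Rightarrow> 'a list" where
  "start_stk emb w i = (if i = 0 then map emb w else [])"

lemma init_mach:
  assumes emb: "\<And>b. \<iota> (emb b) = (if b then 2 else 1)"
  shows "init mach w = (code c0, tps (length w) (start_stk emb w))"
proof -
  have 1: "tp (length w) (start_stk emb w) 0 = (0, contents w)"
    using k2 by (auto simp: tp_def start_stk_def stk_def contents_def fun_eq_iff emb)
  have 2: "tp (length w) (start_stk emb w) i = (0, \<lambda>_. 0)" if "i \<noteq> 0" for i
    using that by (auto simp: tp_def start_stk_def stk_def outt_def fun_eq_iff)
  have "tps (length w) (start_stk emb w) = (0, contents w) # replicate k (0, \<lambda>_. 0)"
    by (rule nth_equalityI) (auto simp: nth_tps nth_Cons' 1 2)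
  then show ?thesis by (simp add: init_def)
qed

lemma outt_contents:
  assumes emb: "\<And>b. \<iota> (emb b) = (if b then 2 else 1)"
  shows "snd (outt (map emb v)) = contents v"
  by (auto simp: outt_def contents_def fun_eq_iff emb)

lemma halted_fix: "halted M c \<Longrightarrow> (step M ^^ n) c = c"
  by (induction n) (auto simp: step_def)

text \<open>The step beyond \<open>t\<close> leads from the finished program to a halting state
  chosen by stack 1. Afterwards nothing changes, so the head bound along the execution holds at all
  times.\<close>

lemma mach_correct:
  assumes emb: "\<And>b. \<iota> (emb b) = (if b then 2 else 1)"
    and ex: "exec B c0 (start_stk emb w) t \<sigma>'" and B: "enat (length w) \<le> B"
  shows "halted mach (run mach w (t + 1))"
    "fst (run mach w (t + 1)) = (if \<sigma>' 1 \<noteq> [] then accept mach else reject mach)"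
    "snd (run mach w (t + 1)) = tps (length w) \<sigma>'"
    "good B (length w) (snd (run mach w n))"
proof -
  let ?l = "length w"
  have lo: "low B (start_stk emb w)" using B by (auto simp: low_def start_stk_def zero_enat_def[symmetric])
  have e: "low B \<sigma>'" "ctx Skip [] \<in> derivs c0"
     and p: "path B ?l t (code (ctx c0 []), tps ?l (start_stk emb w)) (code (ctx Skip []), tps ?l \<sigma>')"
    using exec_path[OF ex wfc0 lo, of "[]" ?l] derivs_self by auto
  have r: "run mach w t = (code Skip, tps ?l \<sigma>')"
    using p unfolding run_def init_mach[OF emb] path_def by simp
  have sk: "Skip \<in> derivs c0" using e(2) by simp
  have "map rd (tps ?l \<sigma>') ! 1 = eo (if 1 < k then tos (\<sigma>' 1) else None)"
    using k2 by (subst nth_map) (auto simp: nth_tps tp_def rd_stk rd_outt)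
  then have "map rd (tps ?l \<sigma>') ! 1 \<noteq> 0 \<longleftrightarrow> \<sigma>' 1 \<noteq> []" using k2 eo_less
    by (auto simp: eo_def[of None])
  then have s: "run mach w (t + 1) = (if \<sigma>' 1 \<noteq> [] then D else D + 1, tps ?l \<sigma>')"
    using code_less[OF sk] unfolding run_def
    by (simp add: r[unfolded run_def] step_def halted_def dlt_def sk map2_nop)
  show 1: "halted mach (run mach w (t + 1))"
    "fst (run mach w (t + 1)) = (if \<sigma>' 1 \<noteq> [] then accept mach else reject mach)"
    "snd (run mach w (t + 1)) = tps (length w) \<sigma>'"
    unfolding s by (auto simp: halted_def)
  show "good B ?l (snd (run mach w n))"
  proof (cases "n \<le> t")
    case True
    then show ?thesis using p unfolding run_def init_mach[OF emb] path_def by simp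
  next
    case False
    then have n: "n = (n - (t + 1)) + (t + 1)" by simp
    have "run mach w n = (step mach ^^ (n - (t + 1))) (run mach w (t + 1))"
      unfolding run_def by (subst n, subst funpow_add) simp
    then have "run mach w n = run mach w (t + 1)" using halted_fix[OF 1(1)] by simp
    then show ?thesis using 1(3) good_tps[OF e(1)] by simp
  qed
qed

end

text \<open>One construction for two uses: with \<open>B = \<infinity>\<close> the count
  \<open>t\<close> yields a time bound, with finite \<open>B\<close> the head positions yield a
  space bound.\<close>

lemma compile:
  fixes c :: "'a :: finite com" and emb :: "bool \<Rightarrow> 'a"
  assumes "inj emb" and "wfc k c" and "k \<ge> 2"
  obtains M where "wf_tm M" "tapes M = k + 1"
    "\<And>B w t \<sigma>. exec B c (\<lambda>i. if i = 0 then map emb w else []) t \<sigma> \<Longrightarrow> enat (length w) \<le> B \<Longrightarrow>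
      halted M (run M w (t + 1)) \<and>
      (fst (run M w (t + 1)) = accept M \<longleftrightarrow> \<sigma> 1 \<noteq> []) \<and>
      (\<forall>v. \<sigma> k = map emb v \<longrightarrow> snd (last (snd (run M w (t + 1)))) = contents v) \<and>
      (\<forall>n. \<forall>i\<le>k. enat (nat \<bar>fst (snd (run M w n) ! i)\<bar>) \<le> B + enat (length w))"
proof -
  have ne: "emb False \<noteq> emb True" using assms(1) by (auto dest: injD)
  have "card {emb False, emb True} \<le> CARD('a)" by (rule card_mono) auto
  then have c2: "CARD('a) \<ge> 2" using ne by simp
  \<comment> \<open>The bits must get the codes 1 and 2 prescribed for input and output; all other
    symbols are numbered from 3 on.\<close>
  have "card (UNIV - {emb False, emb True}) = CARD('a) - 2"
    using ne by (subst card_Diff_subset) auto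
  then have "card (UNIV - {emb False, emb True}) = card {3..CARD('a)}" by simp
  then obtain g where g: "bij_betw g (UNIV - {emb False, emb True}) {3..CARD('a)}"
    using finite_same_card_bij[of "UNIV - {emb False, emb True}" "{3..CARD('a)}"] by auto
  define \<iota> where "\<iota> a = (if a = emb False then 1 else if a = emb True then 2 else g a)" for a
  have i: "\<iota> (emb b) = (if b then 2 else 1)" for b
    using ne by (cases b) (auto simp: \<iota>_def)
  have b1: "bij_betw \<iota> (UNIV - {emb False, emb True}) {3..CARD('a)}"
    using g by (subst bij_betw_cong[of _ _ g]) (auto simp: \<iota>_def)
  have b2: "bij_betw \<iota> {emb False, emb True} {1, 2}"
    using ne by (auto simp: bij_betw_def \<iota>_def inj_on_def)
  have "bij_betw \<iota> ((UNIV - {emb False, emb True}) \<union> {emb False, emb True}) ({3..CARD('a)} \<union> {1, 2})"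
    by (rule bij_betw_combine[OF b1 b2]) auto
  moreover have "{3..CARD('a)} \<union> {1, 2} = {1..CARD('a)}" using c2 by auto
  ultimately have bi: "bij_betw \<iota> UNIV {1..CARD('a)}" by (simp add: Un_commute)
  obtain code where code: "bij_betw code (derivs c) {..<card (derivs c)}"
    using ex_bij_betw_finite_nat[OF finite_derivs[of c]] atLeast0LessThan by metis
  interpret compiled c k \<iota> code
    by unfold_locales (use assms bi c2 code in auto)
  have st: "(\<lambda>i. if i = 0 then map emb w else []) = start_stk emb w" for w
    by (auto simp: start_stk_def)
  show thesis
  proof (rule that[of mach])
    fix B w t \<sigma>
    assume ex: "exec B c (\<lambda>i. if i = 0 then map emb w else []) t \<sigma>" and B: "enat (length w) \<le> B"
    note m = mach_correct[OF i ex[unfolded st] B]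
    have "last (tps (length w) \<sigma>) = outt (\<sigma> k)"
      by (subst last_conv_nth) (auto simp: nth_tps tp_def simp flip: length_0_conv)
    then have "\<forall>v. \<sigma> k = map emb v \<longrightarrow> snd (last (snd (run mach w (t + 1)))) = contents v"
      using m(3) outt_contents[OF i] by simp
    then show "halted mach (run mach w (t + 1)) \<and>
      (fst (run mach w (t + 1)) = accept mach \<longleftrightarrow> \<sigma> 1 \<noteq> []) \<and>
      (\<forall>v. \<sigma> k = map emb v \<longrightarrow> snd (last (snd (run mach w (t + 1)))) = contents v) \<and>
      (\<forall>n. \<forall>i\<le>k. enat (nat \<bar>fst (snd (run mach w n) ! i)\<bar>) \<le> B + enat (length w))"
      using m(1,2) m(4)[unfolded good_def] by auto
  qed (use wf_mach in simp_all)
qed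

section \<open>From programs to polynomial time and polynomial space\<close>

lemma halted_stable:
  assumes "halted M (run M w m)" "m \<le> n"
  shows "run M w n = run M w m"
proof -
  have fix': "(step M ^^ j) c = c" if "halted M c" for j c
    using that by (induction j) (auto simp: step_def)
  have "run M w n = (step M ^^ (n - m)) (run M w m)"
    unfolding run_def using assms(2) funpow_add[of "n - m" m "step M"] by simp
  then show ?thesis using fix'[OF assms(1)] by simp
qed

lemma poly_timeI:
  fixes c :: "'a :: finite com" and emb :: "bool \<Rightarrow> 'a" and p :: "nat poly"
  assumes "inj emb" "wfc k c" "k \<ge> 2"
    and ex: "\<And>w. \<exists>t \<sigma>. t \<le> poly p (length w) \<and> \<sigma> k = map emb (f w) \<and>
      exec \<infinity> c (\<lambda>i. if i = 0 then map emb w else []) t \<sigma>"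
  shows "poly_time f"
proof -
  obtain M where M: "wf_tm M"
    "\<And>B w t \<sigma>. exec B c (\<lambda>i. if i = 0 then map emb w else []) t \<sigma> \<Longrightarrow> enat (length w) \<le> B \<Longrightarrow>
      halted M (run M w (t + 1)) \<and>
      (fst (run M w (t + 1)) = accept M \<longleftrightarrow> \<sigma> 1 \<noteq> []) \<and>
      (\<forall>v. \<sigma> k = map emb v \<longrightarrow> snd (last (snd (run M w (t + 1)))) = contents v) \<and>
      (\<forall>n. \<forall>i\<le>k. enat (nat \<bar>fst (snd (run M w n) ! i)\<bar>) \<le> B + enat (length w))"
    by (rule compile[OF assms(1-3)]) blast
  show ?thesis
    unfolding poly_time_def Let_def
  proof (intro exI[of _ M] exI[of _ "p + 1"] conjI allI)
    fix w
    obtain t \<sigma> where t: "t \<le> poly p (length w)" "\<sigma> k = map emb (f w)"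
      "exec \<infinity> c (\<lambda>i. if i = 0 then map emb w else []) t \<sigma>" using ex by blast
    have h: "halted M (run M w (t + 1))" "snd (last (snd (run M w (t + 1)))) = contents (f w)"
      using M(2)[OF t(3)] t(2) by simp_all
    have e: "run M w (poly (p + 1) (length w)) = run M w (t + 1)"
      by (rule halted_stable[OF h(1)]) (use t(1) in simp)
    show "halted M (run M w (poly (p + 1) (length w)))"
      "snd (last (snd (run M w (poly (p + 1) (length w))))) = contents (f w)"
      unfolding e by (rule h)+
  qed (rule M(1))
qed

text \<open>The count \<open>t\<close> is unrestricted: its existence witnesses termination, while
  the stack bound alone yields the space bound.\<close>

lemma PSPACE_I:
  fixes c :: "'a :: finite com" and emb :: "bool \<Rightarrow> 'a" and p :: "nat poly"
  assumes "inj emb" "wfc k c" "k \<ge> 2"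
    and ex: "\<And>w. \<exists>t \<sigma>. (\<sigma> 1 \<noteq> [] \<longleftrightarrow> w \<in> L) \<and> length w \<le> poly p (length w) \<and>
      exec (enat (poly p (length w))) c (\<lambda>i. if i = 0 then map emb w else []) t \<sigma>"
  shows "L \<in> PSPACE"
proof -
  obtain M where M: "wf_tm M" "tapes M = k + 1"
    "\<And>B w t \<sigma>. exec B c (\<lambda>i. if i = 0 then map emb w else []) t \<sigma> \<Longrightarrow> enat (length w) \<le> B \<Longrightarrow>
      halted M (run M w (t + 1)) \<and>
      (fst (run M w (t + 1)) = accept M \<longleftrightarrow> \<sigma> 1 \<noteq> []) \<and>
      (\<forall>v. \<sigma> k = map emb v \<longrightarrow> snd (last (snd (run M w (t + 1)))) = contents v) \<and>
      (\<forall>n. \<forall>i\<le>k. enat (nat \<bar>fst (snd (run M w n) ! i)\<bar>) \<le> B + enat (length w))"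
    by (rule compile[OF assms(1-3)]) blast
  \<comment> \<open>Each of the \<open>k + 1\<close> heads stays within distance
    \<open>p + n\<close> of cell 0, where \<open>n\<close> is the input length, and so visits at
    most \<open>2 * (p + n) + 1\<close> cells.\<close>
  define q where "q = [:k + 1:] * ([:2:] * (p + [:0, 1:]) + 1)"
  show ?thesis
    unfolding PSPACE_def
  proof (intro CollectI exI[of _ M] exI[of _ q] conjI allI)
    fix w
    obtain t \<sigma> where t: "\<sigma> 1 \<noteq> [] \<longleftrightarrow> w \<in> L" "length w \<le> poly p (length w)"
      "exec (enat (poly p (length w))) c (\<lambda>i. if i = 0 then map emb w else []) t \<sigma>" using ex by blast
    have h: "halted M (run M w (t + 1))" "fst (run M w (t + 1)) = accept M \<longleftrightarrow> \<sigma> 1 \<noteq> []"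
      "\<forall>n. \<forall>i\<le>k. enat (nat \<bar>fst (snd (run M w n) ! i)\<bar>) \<le> enat (poly p (length w)) + enat (length w)"
      using M(3)[OF t(3)] t(2) by simp_all
    show "\<exists>n. halted M (run M w n)" using h(1) by blast
    show "w \<in> L \<longleftrightarrow> (\<exists>n. fst (run M w n) = accept M)"
    proof
      assume "w \<in> L"
      then show "\<exists>n. fst (run M w n) = accept M" using h(2) t(1) by blast
    next
      assume "\<exists>n. fst (run M w n) = accept M"
      then obtain n where n: "fst (run M w n) = accept M" by blast
      then have "halted M (run M w n)" by (simp add: halted_def)
      then have "run M w n = run M w (t + 1)"
        using halted_stable[OF h(1), of n] halted_stable[of M w n "t + 1"] by (metis nle_le)
      then show "w \<in> L" using n h(2) t(1) by simp
    qed
    let ?b = "poly p (length w) + length w"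
    let ?V = "{..<k + 1} \<times> {- int ?b..int ?b}"
    have "fst (snd (run M w n) ! i) \<in> {- int ?b..int ?b}" if "i \<le> k" for n i
      using h(3)[rule_format, OF that, of n] by simp arith
    then have sub: "visited M w \<subseteq> ?V"
      unfolding visited_def M(2) by auto
    show "finite (visited M w)" by (rule finite_subset[OF sub]) simp
    have "card (visited M w) \<le> card ?V" by (rule card_mono[OF _ sub]) simp
    also have "\<dots> = (k + 1) * (2 * ?b + 1)"
    proof -
      have "nat (int b - (- int b) + 1) = 2 * b + 1" for b :: nat by arith
      then show ?thesis by (simp only: card_cartesian_product card_lessThan card_atLeastAtMost_int)
    qed
    also have "\<dots> \<le> poly q (length w)" unfolding q_def by simp
    finally show "card (visited M w) \<le> poly q (length w)" .
  qed (rule M(1))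
qed

section \<open>Runs of Turing machines as chains of worlds\<close>

definition val :: "bool list \<Rightarrow> nat" where
  "val bs = foldl (\<lambda>n b. 2 * n + of_bool b) 0 bs"

lemma bin_val: "bin (val (True # bs)) = True # bs"
proof (induction bs rule: rev_induct)
  case Nil
  show ?case by (simp add: val_def bin_pos bin_0)
next
  case (snoc b bs)
  have v: "val (True # bs @ [b]) = 2 * val (True # bs) + of_bool b" by (simp add: val_def)
  have "val (True # bs) \<noteq> 0" using snoc bin_0 by (metis list.distinct(1))
  then show ?case using snoc by (simp add: v bin_pos)
qed

text \<open>In binary: \<open>k + 1\<close> ones, a zero, and \<open>c\<close> ones, from which the
  pair can be read off. The index \<open>k\<close> thus shows up in the encoding as a run of equal
  digit tokens, printable by a program that holds \<open>k\<close> in unary. The additional first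
  one keeps the digits a canonical numeral for \<open>k = 0\<close>.\<close>

definition atm :: "nat \<Rightarrow> nat \<Rightarrow> nat" where
  "atm c k = val (replicate (Suc k) True @ False # replicate c True)"

lemma bin_atm: "bin (atm c k) = replicate (Suc k) True @ False # replicate c True"
  using bin_val[of "replicate k True @ False # replicate c True"] by (simp add: atm_def)

lemma atm_inj: "atm c k = atm c' k' \<longleftrightarrow> c = c' \<and> k = k'"
proof
  assume "atm c k = atm c' k'"
  then have eq: "replicate k True @ False # replicate c True = replicate k' True @ False # replicate c' True"
    using bin_atm[of c k] bin_atm[of c' k'] by simp
  have "takeWhile id (replicate k True @ False # replicate c True) = replicate k True" for k c
    by (subst takeWhile_append2) auto
  then have "replicate k True = replicate k' True" using eq by metis
  then have "k = k'" by (metis length_replicate)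
  moreover have "length (replicate k True @ False # replicate c True)
    = length (replicate k' True @ False # replicate c' True)" using eq by (rule arg_cong)
  ultimately show "c = c' \<and> k = k'" by simp
qed simp

text \<open>
  Facts about a configuration: \<open>(0, q, _)\<close> says that the state is \<open>q\<close>; \<open>(1, i, y)\<close> with index \<open>k\<close>
  says that the \<open>k\<close>-th cell to the right of the head of tape \<open>i\<close> (the scanned cell being the zeroth)
  contains \<open>y\<close>; \<open>(2, i, y)\<close> says the same about the cells to the left of the head.
\<close>

type_synonym fact = "nat \<times> nat \<times> nat"

definition hold :: "config \<Rightarrow> fact \<Rightarrow> nat \<Rightarrow> bool" where
  "hold cf c k = (case c of (g, i, y) \<Rightarrow>
     if g = 0 then fst cf = i
     else if g = 1 then snd (snd cf ! i) (fst (snd cf ! i) + int k) = y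
     else snd (snd cf ! i) (fst (snd cf ! i) - 1 - int k) = y)"

definition fa :: "fact \<Rightarrow> nat \<Rightarrow> fm" where
  "fa c k = Atom (atm (to_nat c) k)"

text \<open>A literal is a fact with an offset; the flag says whether the offset is relative to the index
  at which the rule is instantiated or absolute.\<close>

type_synonym lit = "bool \<times> nat \<times> fact"

definition idx :: "lit \<Rightarrow> nat \<Rightarrow> nat" where
  "idx l k = (if fst l then k else 0) + fst (snd l)"

definition lit :: "lit \<Rightarrow> nat \<Rightarrow> fm" where
  "lit l k = fa (snd (snd l)) (idx l k)"

definition lhold :: "config \<Rightarrow> lit \<Rightarrow> nat \<Rightarrow> bool" where
  "lhold cf l k = hold cf (snd (snd l)) (idx l k)"

definition conjs :: "fm list \<Rightarrow> fm" where
  "conjs \<phi>s = foldr And \<phi>s (Neg Bot)"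

lemma sat_conjs: "sat Ra Rb V s (conjs \<phi>s) \<longleftrightarrow> (\<forall>\<phi> \<in> set \<phi>s. sat Ra Rb V s \<phi>)"
  by (induction \<phi>s) (auto simp: conjs_def)

text \<open>Read \<open>(q, xs, e, h)\<close> as: if the state is \<open>q\<close>, the scanned
  symbols are \<open>xs\<close> and the literal \<open>e\<close> holds, then \<open>h\<close> holds
  one step later. One extra premise is enough, since a new cell content depends on the state, the
  scanned symbols and at most one further cell.\<close>

type_synonym rule = "nat \<times> nat list \<times> lit \<times> lit"

fun body :: "rule \<Rightarrow> nat \<Rightarrow> fm" where
  "body (q, xs, e, h) k =
     And (fa (0, q, 0) 0) (And (conjs (map (\<lambda>i. fa (1, i, xs ! i) 0) [0..<length xs])) (lit e k))"

definition clause :: "rule \<Rightarrow> nat \<Rightarrow> fm" where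
  "clause r k = Neg (And (Neg (lit (snd (snd (snd r))) k)) (Neg (BoxB (Neg (body r k)))))"

abbreviation head :: "tape \<Rightarrow> nat" where "head \<equiv> \<lambda>(h, c). c h"

definition sound_rule :: "tm \<Rightarrow> rule \<Rightarrow> bool" where
  "sound_rule M r = (case r of (q, xs, e, h) \<Rightarrow> \<forall>ts k. length ts = tapes M \<longrightarrow> map head ts = xs \<longrightarrow>
     q \<noteq> accept M \<longrightarrow> q \<noteq> reject M \<longrightarrow> lhold (q, ts) e k \<longrightarrow> lhold (step M (q, ts)) h k)"

text \<open>Offsets up to 2 suffice: a cell at distance \<open>k + 1\<close> to the right of the
  head is at distance at most \<open>k + 2\<close> after a move to the left.\<close>

definition lits :: "nat \<Rightarrow> lit set" where
  "lits S = UNIV \<times> {..2} \<times> {..2} \<times> {..S} \<times> {..S}"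

text \<open>Rules are collected by soundness instead of being read off the transition function. The
  set is finite and depends on the machine alone, so for the reduction it is a constant.\<close>

definition rules_of :: "tm \<Rightarrow> rule set" where
  "rules_of M = {r \<in> {..<states M} \<times> {xs. set xs \<subseteq> {..<symbols M} \<and> length xs = tapes M}
       \<times> lits (states M + tapes M + symbols M) \<times> lits (states M + tapes M + symbols M).
     sound_rule M r \<and> fst r \<noteq> accept M \<and> fst r \<noteq> reject M}"

lemma finite_rules_of: "finite (rules_of M)"
  unfolding rules_of_def lits_def
  by (rule finite_subset[OF Collect_subset]) (intro finite_SigmaI finite_lists_length_eq; simp)

definition rules :: "tm \<Rightarrow> rule list" where
  "rules M = (SOME l. set l = rules_of M)"

lemma set_rules: "set (rules M) = rules_of M"
  unfolding rules_def by (rule someI_ex) (rule finite_list[OF finite_rules_of])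

definition consF :: "tm \<Rightarrow> nat \<Rightarrow> fm" where
  "consF M k = And (Neg (fa (0, accept M, 0) 0)) (conjs (map (\<lambda>r. clause r k) (rules M)))"

definition initF :: "tm \<Rightarrow> nat \<Rightarrow> nat \<Rightarrow> fm" where
  "initF M x k = conjs ([fa (0, start M, 0) 0, fa (1, 0, x) k, fa (2, 0, 0) k]
     @ map (\<lambda>i. fa (1, i, 0) k) [1..<tapes M] @ map (\<lambda>i. fa (2, i, 0) k) [1..<tapes M])"

text \<open>The negation of the description of a run that does not accept: some
  \<open>Ra\<close>-successor is initial, and all of them obey the rules and are not accepting. The
  number \<open>W\<close> of instances has to cover the space used by the machine.\<close>

definition runF :: "tm \<Rightarrow> bool list \<Rightarrow> nat \<Rightarrow> fm" where
  "runF M w W = Neg (And (Neg (BoxA (Neg (conjs (map (\<lambda>k. initF M (contents w (int k)) k) [0..<W])))))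
     (BoxA (conjs (map (consF M) [0..<W]))))"

lemma run_0: "run M w 0 = init M w" by (simp add: run_def)
lemma run_Suc: "run M w (Suc n) = step M (run M w n)" by (simp add: run_def)

section \<open>Invariants of configurations and bounds on head positions\<close>

lemma length_init: "wf_tm M \<Longrightarrow> length (snd (init M w)) = tapes M"
  by (simp add: init_def wf_tm_def)

definition regular :: "tm \<Rightarrow> config \<Rightarrow> bool" where
  "regular M cf \<longleftrightarrow> fst cf < states M \<and> length (snd cf) = tapes M \<and>
     (\<forall>i<tapes M. \<forall>z. snd (snd cf ! i) z < symbols M)"

lemma heads_bounded: "regular M (q, ts) \<Longrightarrow> set (map head ts) \<subseteq> {..<symbols M}"
proof
  fix x assume reg: "regular M (q, ts)" and "x \<in> set (map head ts)"
  then obtain i where "i < length ts" "x = snd (ts ! i) (fst (ts ! i))"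
    by (auto simp: in_set_conv_nth case_prod_beta)
  then show "x \<in> {..<symbols M}" using reg by (simp add: regular_def)
qed

lemma delta_bounded:
  assumes "wf_tm M" "regular M (q, ts)" "delta M q (map head ts) = (q', acts)"
  shows "q' < states M" "length acts = tapes M" "(y, m) \<in> set acts \<Longrightarrow> y < symbols M"
proof -
  have "q < states M" "length (map head ts) = tapes M" "set (map head ts) \<subseteq> {..<symbols M}"
    using assms(2) heads_bounded[OF assms(2)] by (simp_all add: regular_def)
  then have "q' < states M \<and> length acts = tapes M \<and> (\<forall>(y, m) \<in> set acts. y < symbols M)"
    using assms(1,3) unfolding wf_tm_def by fastforce
  then show "q' < states M" "length acts = tapes M" "(y, m) \<in> set acts \<Longrightarrow> y < symbols M" by auto
qed

lemma step_eq: "\<not> halted M (q, ts) \<Longrightarrow> delta M q (map head ts) = (q', acts)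
    \<Longrightarrow> step M (q, ts) = (q', map2 act acts ts)"
  by (simp add: step_def)

lemma regular_step:
  assumes "wf_tm M" "regular M cf"
  shows "regular M (step M cf)"
proof (cases "halted M cf")
  case True
  then show ?thesis using assms by (simp add: step_def)
next
  case False
  obtain q ts where cf: "cf = (q, ts)" by fastforce
  obtain q' acts where d: "delta M q (map head ts) = (q', acts)" by fastforce
  note b = delta_bounded[OF assms(1) assms(2)[unfolded cf] d]
  have "snd (act (acts ! i) (ts ! i)) z < symbols M" if "i < tapes M" for i z
  proof -
    obtain y m where a: "acts ! i = (y, m)" by fastforce
    then have "y < symbols M" using b(3)[of y m] b(2) that nth_mem by metis
    moreover have "snd (ts ! i) z < symbols M" using assms(2) cf that by (simp add: regular_def)
    ultimately show ?thesis by (cases "ts ! i") (auto simp: a)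
  qed
  then show ?thesis using b assms(2) step_eq[OF False[unfolded cf] d]
    by (simp add: cf regular_def)
qed

lemma regular_run: "wf_tm M \<Longrightarrow> regular M (run M w n)"
proof (induction n)
  case 0
  then show ?case
    by (auto simp: run_0 regular_def length_init init_def wf_tm_def contents_def nth_Cons')
next
  case (Suc n)
  then show ?case by (simp add: run_Suc regular_step)
qed

lemma head_step:
  assumes "wf_tm M" "regular M cf" "i < tapes M"
  shows "\<bar>fst (snd (step M cf) ! i) - fst (snd cf ! i)\<bar> \<le> 1"
proof (cases "halted M cf")
  case True
  then show ?thesis by (simp add: step_def)
next
  case False
  obtain q ts where cf: "cf = (q, ts)" by fastforce
  obtain q' acts where d: "delta M q (map head ts) = (q', acts)" by fastforce
  note b = delta_bounded[OF assms(1) assms(2)[unfolded cf] d]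
  have "length ts = tapes M" using assms(2) cf by (simp add: regular_def)
  then show ?thesis using step_eq[OF False[unfolded cf] d] b assms(3)
    by (cases "acts ! i"; cases "ts ! i") (auto simp: cf split: move.split)
qed

text \<open>A head starts at 0 and moves by at most one cell per step, so it skips no cell. This
  turns a bound on the number of visited cells into a bound on positions.\<close>

lemma visited_between:
  assumes "wf_tm M" "i < tapes M"
    and "0 \<le> z \<and> z \<le> fst (snd (run M w n) ! i) \<or> fst (snd (run M w n) ! i) \<le> z \<and> z \<le> 0"
  shows "(i, z) \<in> visited M w"
  using assms(3)
proof (induction n)
  case 0
  have h0: "fst (snd (run M w 0) ! i) = 0"
    using assms(2) by (auto simp: run_0 init_def nth_Cons')
  then have "z = 0" using 0 by auto
  then show ?case unfolding visited_def using h0 assms(2) by force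
next
  case (Suc n)
  show ?case
  proof (cases "z = fst (snd (run M w (Suc n)) ! i)")
    case True
    then show ?thesis unfolding visited_def using assms(2) by blast
  next
    case False
    have "\<bar>fst (snd (run M w (Suc n)) ! i) - fst (snd (run M w n) ! i)\<bar> \<le> 1"
      unfolding run_Suc by (rule head_step[OF assms(1) regular_run[OF assms(1)] assms(2)])
    then show ?thesis using Suc False by (intro Suc.IH) linarith
  qed
qed

lemma head_bound:
  assumes "wf_tm M" "i < tapes M" "finite (visited M w)" "card (visited M w) \<le> p"
  shows "\<bar>fst (snd (run M w n) ! i)\<bar> < int p"
proof -
  let ?h = "fst (snd (run M w n) ! i)"
  let ?I = "{min 0 ?h..max 0 ?h}"
  have "Pair i ` ?I \<subseteq> visited M w"
    using visited_between[OF assms(1,2), of _ w n] by (auto simp: min_def max_def split: if_splits)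
  then have "card (Pair i ` ?I) \<le> p" using order_trans[OF card_mono[OF assms(3)] assms(4)] by blast
  moreover have "card (Pair i ` ?I) = nat (\<bar>?h\<bar> + 1)"
    by (subst card_image) (auto simp: inj_on_def min_def max_def)
  ultimately show ?thesis by linarith
qed

subsection \<open>A rejecting run yields a countermodel\<close>

lemma not_valid_if_not_accepting:
  assumes wf: "wf_tm M" and na: "\<And>n. fst (run M w n) \<noteq> accept M"
  shows "\<not> wd_valid TYPE(nat) (runF M w W)"
proof
  assume v: "wd_valid TYPE(nat) (runF M w W)"
  \<comment> \<open>World \<open>Suc i\<close> is moment \<open>i\<close> of the run. World 0 sees
    all moments by \<open>Ra\<close>, and each moment sees its predecessor by \<open>Rb\<close>; the
    middle point for the edge to \<open>Suc i\<close> is the next moment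
    \<open>Suc (Suc i)\<close>.\<close>
  define Ra where "Ra = {(0::nat, Suc i) | i. True}"
  define Rb where "Rb = {(Suc (Suc i), Suc i) | i. True}"
  define V where "V a = {Suc i | i. \<exists>c k. a = atm (to_nat c) k \<and> hold (run M w i) c k}" for a
  have fr: "frame UNIV Ra Rb" by (simp add: frame_def)
  have wd: "weakly_dense Ra Rb" by (auto simp: weakly_dense_def Ra_def Rb_def)
  have s: "sat Ra Rb V 0 (runF M w W)" using v fr wd unfolding wd_valid_def by blast
  have fa: "sat Ra Rb V (Suc i) (fa c k) \<longleftrightarrow> hold (run M w i) c k" for i c k
    by (auto simp: fa_def V_def atm_inj)
  have lit: "sat Ra Rb V (Suc i) (lit l k) \<longleftrightarrow> lhold (run M w i) l k" for i l k
    by (simp add: lit_def lhold_def fa)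
  have ini: "sat Ra Rb V (Suc 0) (initF M (contents w (int k)) k)" for k
    using wf by (auto simp: initF_def sat_conjs fa run_0 hold_def init_def nth_Cons' contents_def wf_tm_def)
  have cl: "sat Ra Rb V (Suc i) (clause r k)" if r: "r \<in> rules_of M" for i r k
  proof -
    obtain q xs e h where r': "r = (q, xs, e, h)" by (cases r) auto
    have "lhold (run M w i) h k"
      if ij: "(Suc i, j) \<in> Rb" "sat Ra Rb V j (body r k)" for j
    proof -
      obtain i' where i': "i = Suc i'" "j = Suc i'" using ij(1) by (auto simp: Rb_def)
      obtain q0 ts where run: "run M w i' = (q0, ts)" by fastforce
      have reg: "regular M (q0, ts)" using regular_run[OF wf, of w i'] run by simp
      have b: "q0 = q" "\<forall>i<length xs. hold (q0, ts) (1, i, xs ! i) 0" "lhold (q0, ts) e k"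
        using ij(2) by (auto simp: r' i' fa lit sat_conjs run hold_def)
      have len: "length ts = tapes M" "length xs = tapes M"
        using reg r by (auto simp: regular_def rules_of_def r')
      have "map head ts = xs"
        by (rule nth_equalityI) (use b(2) len in \<open>auto simp: hold_def case_prod_beta\<close>)
      moreover have "sound_rule M r" "q \<noteq> accept M" "q \<noteq> reject M"
        using r by (auto simp: rules_of_def r')
      ultimately have "lhold (step M (q, ts)) h k"
        using b len unfolding sound_rule_def r' by auto
      then show ?thesis using i' run b by (simp add: run_Suc)
    qed
    then show ?thesis by (auto simp: clause_def lit r')
  qed
  have con: "sat Ra Rb V (Suc i) (consF M k)" for i k
    using cl na by (auto simp: consF_def sat_conjs set_rules fa hold_def)
  have "(0, Suc 0) \<in> Ra" by (simp add: Ra_def)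
  then have "\<not> sat Ra Rb V 0 (BoxA (Neg (conjs (map (\<lambda>k. initF M (contents w (int k)) k) [0..<W]))))"
    using ini by (auto simp: sat_conjs)
  moreover have "sat Ra Rb V 0 (BoxA (conjs (map (consF M) [0..<W])))"
    using con by (auto simp: sat_conjs Ra_def)
  ultimately show False using s by (simp add: runF_def)
qed

subsection \<open>An accepting run is forced\<close>

lemma dependent_chain:
  assumes "P x0" "\<And>x. P x \<Longrightarrow> \<exists>y. P y \<and> R y x"
  obtains f :: "nat \<Rightarrow> 'a" where "f 0 = x0" "\<And>n. P (f n)" "\<And>n. R (f (Suc n)) (f n)"
proof -
  have "\<exists>f. \<forall>n. (P (f n) \<and> (n = 0 \<longrightarrow> f n = x0)) \<and> R (f (Suc n)) (f n)"
    using assms by (intro dependent_nat_choice) auto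
  then show thesis using that by blast
qed

text \<open>Completeness of the rules: the content of a cell \<open>a\<close> of the window after a
  step follows by a rule instance whose extra premise is known before the step, namely the old
  content of the same cell, or the old state if the cell has just been overwritten. The bound on
  \<open>k\<close> ensures that this instance occurs in the formula.\<close>

lemma new_fact:
  assumes wf: "wf_tm M" and reg: "regular M cf" and nh: "\<not> halted M cf" and i: "i < tapes M"
    and cf: "cf = (q, ts)" and T: "ts ! i = (h, f)" and T': "snd (step M cf) ! i = (h', f')"
    and p: "\<bar>h\<bar> < int p" "\<bar>a\<bar> \<le> int p"
    and g: "g' = (if h' \<le> a then 1 else 2 :: nat)" "k' = nat (if h' \<le> a then a - h' else h' - 1 - a)"
  shows "\<exists>e hd k. (q, map head ts, e, hd) \<in> rules_of M \<and> k < 2 * p + 1 \<and>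
     (snd (snd e) = (0, q, 0) \<and> idx e k = 0 \<or>
      snd (snd e) = (if h \<le> a then 1 else 2, i, f a) \<and> idx e k = nat (if h \<le> a then a - h else h - 1 - a))
     \<and> lit hd k = fa (g', i, f' a) k'"
proof -
  obtain q' acts where d: "delta M q (map head ts) = (q', acts)" by fastforce
  note b = delta_bounded[OF wf reg[unfolded cf] d]
  obtain y m where ac: "acts ! i = (y, m)" by fastforce
  have y: "y < symbols M" using b(3)[of y m] b(2) i nth_mem ac by metis
  have len: "length ts = tapes M" using reg cf by (simp add: regular_def)
  have q: "q < states M" and fa: "f a < symbols M"
    using reg cf i T by (auto simp: regular_def dest!: spec[of _ i])
  have nh': "q \<noteq> accept M" "q \<noteq> reject M" using nh cf by (auto simp: halted_def)
  have s: "snd (step M (q, us)) ! i = act (y, m) (us ! i)"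
    if "length us = tapes M" "map head us = map head ts" for us
  proof -
    have "\<not> halted M (q, us)" using nh' by (simp add: halted_def)
    from step_eq[OF this, of q' acts] show ?thesis using that d i b(2) by (simp add: ac del: act.simps)
  qed
  have hf: "h' = (case m of Left \<Rightarrow> h - 1 | Stay \<Rightarrow> h | Right \<Rightarrow> h + 1)" "f' = f(h := y)"
    using s[OF len refl] T T' cf by auto
  have xs: "set (map head ts) \<subseteq> {..<symbols M}" by (rule heads_bounded[OF reg[unfolded cf]])
  have mem: "(q, map head ts, e, hd) \<in> rules_of M"
    if "e \<in> lits (states M + tapes M + symbols M)" "hd \<in> lits (states M + tapes M + symbols M)"
      "\<And>us k. length us = tapes M \<Longrightarrow> map head us = map head ts \<Longrightarrow> lhold (q, us) e k \<Longrightarrow>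
         lhold (step M (q, us)) hd k" for e hd
    using that q xs len nh' by (auto simp: rules_of_def sound_rule_def)
  define cell where "cell h g k = (if g = (1::nat) then h + int k else h - 1 - int k)" for h g k
  define \<delta> where "\<delta> = (case m of Left \<Rightarrow> - 1 | Stay \<Rightarrow> 0 | Right \<Rightarrow> (1::int))"
  have hold_iff: "hold cf (g, i, z) k \<longleftrightarrow> snd (snd cf ! i) (cell (fst (snd cf ! i)) g k) = z"
    if "g = 1 \<or> g = 2" for cf g z k
    using that by (auto simp: hold_def cell_def)
  have act: "act (y, m) (h, c) = (h + \<delta>, c(h := y))" for h c
    by (cases m) (auto simp: \<delta>_def)
  let ?S = "states M + tapes M + symbols M"
  \<comment> \<open>Rules for the overwritten cell: the old state serves as a trivial extra premise,
    and the new address depends on the move alone.\<close>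
  have wrt: "(q, map head ts, (False, 0, 0, q, 0), (False, n, g, i, y)) \<in> rules_of M"
    if "n \<le> 2" "g = 1 \<or> g = 2" "\<And>h. cell (h + \<delta>) g n = h" for n g
  proof (rule mem)
    fix us k assume us: "length us = tapes M" "map head us = map head ts"
    obtain h c where "us ! i = (h, c)" by fastforce
    then show "lhold (step M (q, us)) (False, n, g, i, y) k"
      using that by (simp add: lhold_def hold_iff s[OF us] act idx_def del: act.simps)
  qed (use that q i y in \<open>auto simp: lits_def\<close>)
  \<comment> \<open>Rules for a cell that is not scanned: the content is copied, and only the
    address relative to the head changes.\<close>
  have cpy: "(q, map head ts, (r1, n1, g1, i, z), (r2, n2, g2, i, z)) \<in> rules_of M"
    if "n1 \<le> 2" "n2 \<le> 2" "g1 = 1 \<or> g1 = 2" "g2 = 1 \<or> g2 = 2" "z < symbols M"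
      "\<And>h k. cell h g1 (idx (r1, n1, g1, i, z) k) \<noteq> h \<and>
         cell (h + \<delta>) g2 (idx (r2, n2, g2, i, z) k) = cell h g1 (idx (r1, n1, g1, i, z) k)"
    for r1 n1 g1 r2 n2 g2 z
  proof (rule mem)
    fix us k assume us: "length us = tapes M" "map head us = map head ts"
      and h: "lhold (q, us) (r1, n1, g1, i, z) k"
    obtain h c where "us ! i = (h, c)" by fastforce
    then show "lhold (step M (q, us)) (r2, n2, g2, i, z) k"
      using that(6)[of h k] h that(3,4) by (simp add: lhold_def hold_iff s[OF us] act del: act.simps)
  qed (use that i in \<open>auto simp: lits_def\<close>)
  have hf': "h' = h + \<delta>" "f' = f(h := y)" using hf by (auto simp: \<delta>_def split: move.split)
  show ?thesis
  proof (cases "a = h")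
    case True
    have "\<exists>n\<le>2. k' = n \<and> (\<forall>h. cell (h + \<delta>) g' n = h)"
      using True by (cases m) (auto simp: g hf' \<delta>_def cell_def)
    then have "(q, map head ts, (False, 0, 0, q, 0), (False, k', g', i, y)) \<in> rules_of M"
      using g by (intro wrt) auto
    then show ?thesis using True
      by (intro exI[of _ "(False, 0, 0, q, 0)"] exI[of _ "(False, k', g', i, y)"] exI[of _ 0])
        (simp add: hf' lit_def idx_def)
  next
    case False
    let ?z = "f a"
    have "\<exists>r1 n1 r2 n2 g1 k. n1 \<le> 2 \<and> n2 \<le> 2 \<and> g1 = (if h \<le> a then 1 else 2) \<and> k < 2 * p + 1 \<and>
      idx (r1, n1, g1, i, ?z) k = nat (if h \<le> a then a - h else h - 1 - a) \<and>
      idx (r2, n2, g', i, ?z) k = k' \<and>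
      (\<forall>h k. cell h g1 (idx (r1, n1, g1, i, ?z) k) \<noteq> h \<and>
         cell (h + \<delta>) g' (idx (r2, n2, g', i, ?z) k) = cell h g1 (idx (r1, n1, g1, i, ?z) k))"
    proof -
      \<comment> \<open>Right of the head and beyond its left neighbour a cell keeps its side, so
        its address can be given relative to \<open>k\<close>. The left neighbour may change sides,
        and its rule uses absolute addresses.\<close>
      consider (r) "a > h" | (l) "a < h - 1" | (b) "a = h - 1" using False by linarith
      then show ?thesis
      proof cases
        case r
        then show ?thesis using p
          by (intro exI[of _ True] exI[of _ 1] exI[of _ True] exI[of _ "nat (1 - \<delta>)"] exI[of _ 1] exI[of _ "nat (a - h - 1)"])
            (cases m; auto simp: g hf' \<delta>_def cell_def idx_def)
      next
        case l
        show ?thesis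
        proof (cases m)
          case Left
          then show ?thesis using p l
            by (intro exI[of _ True] exI[of _ 1] exI[of _ True] exI[of _ 0] exI[of _ 2] exI[of _ "nat (h - 2 - a)"])
              (auto simp: g hf' \<delta>_def cell_def idx_def)
        next
          case Stay
          then show ?thesis using p l
            by (intro exI[of _ True] exI[of _ 0] exI[of _ True] exI[of _ 0] exI[of _ 2] exI[of _ "nat (h - 1 - a)"])
              (auto simp: g hf' \<delta>_def cell_def idx_def)
        next
          case Right
          then show ?thesis using p l
            by (intro exI[of _ True] exI[of _ 0] exI[of _ True] exI[of _ 1] exI[of _ 2] exI[of _ "nat (h - 1 - a)"])
              (auto simp: g hf' \<delta>_def cell_def idx_def)
        qed
      next
        case b
        show ?thesis using p b
          by (intro exI[of _ False] exI[of _ 0] exI[of _ False] exI[of _ k'] exI[of _ 2] exI[of _ 0])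
            (cases m; auto simp: g hf' \<delta>_def cell_def idx_def)
      qed
    qed
    then obtain r1 n1 r2 n2 g1 k where w: "n1 \<le> 2" "n2 \<le> 2" "g1 = (if h \<le> a then 1 else 2)" "k < 2 * p + 1"
      "idx (r1, n1, g1, i, ?z) k = nat (if h \<le> a then a - h else h - 1 - a)"
      "idx (r2, n2, g', i, ?z) k = k'"
      "\<And>h k. cell h g1 (idx (r1, n1, g1, i, ?z) k) \<noteq> h \<and>
         cell (h + \<delta>) g' (idx (r2, n2, g', i, ?z) k) = cell h g1 (idx (r1, n1, g1, i, ?z) k)"
      by blast
    have "(q, map head ts, (r1, n1, g1, i, ?z), (r2, n2, g', i, ?z)) \<in> rules_of M"
      by (rule cpy) (use w g fa in auto)
    then show ?thesis using w False
      by (intro exI[of _ "(r1, n1, g1, i, ?z)"] exI[of _ "(r2, n2, g', i, ?z)"] exI[of _ k])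
        (simp add: hf' lit_def)
  qed
qed

lemma new_state:
  assumes wf: "wf_tm M" and reg: "regular M (q, ts)" and nh: "\<not> halted M (q, ts)"
  shows "(q, map head ts, (False, 0, 0, q, 0), (False, 0, 0, fst (step M (q, ts)), 0)) \<in> rules_of M"
proof -
  obtain q' acts where d: "delta M q (map head ts) = (q', acts)" by fastforce
  note b = delta_bounded[OF wf reg d]
  have "fst (step M (q, us)) = q'" if "map head us = map head ts" for us
    using step_eq[of M q us q' acts] that d nh by (simp add: halted_def)
  moreover have "set (map head ts) \<subseteq> {..<symbols M}" by (rule heads_bounded[OF reg])
  ultimately show ?thesis using b reg nh
    by (auto simp: rules_of_def sound_rule_def lits_def lhold_def hold_def regular_def halted_def)
qed

lemma valid_if_accepting:
  assumes wf: "wf_tm M" and acc: "\<exists>n. fst (run M w n) = accept M"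
    and vis: "finite (visited M w)" "card (visited M w) \<le> p" and W: "2 * p + 1 \<le> W"
  shows "wd_valid TYPE('v) (runF M w W)"
  unfolding wd_valid_def
proof (intro allI impI ballI, rule ccontr)
  fix F :: "'v set" and Ra Rb V s
  assume wd: "weakly_dense Ra Rb" and neg: "\<not> sat Ra Rb V s (runF M w W)"
  let ?S = "sat Ra Rb V"
  obtain u0 where u0: "(s, u0) \<in> Ra" "\<And>k. k < W \<Longrightarrow> ?S u0 (initF M (contents w (int k)) k)"
    using neg by (auto simp: runF_def sat_conjs)
  have con: "?S u (consF M k)" if "(s, u) \<in> Ra" "k < W" for u k
    using neg that by (auto simp: runF_def sat_conjs)
  \<comment> \<open>Weak density, applied to the edge from \<open>s\<close> to \<open>u n\<close>,
    provides \<open>u (Suc n)\<close>.\<close>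
  obtain u where u: "u 0 = u0" "\<And>n. (s, u n) \<in> Ra" "\<And>n. (u (Suc n), u n) \<in> Rb"
    using dependent_chain[of "\<lambda>x. (s, x) \<in> Ra" u0 "\<lambda>y x. (y, x) \<in> Rb"] u0(1) wd
    unfolding weakly_dense_def by metis
  \<comment> \<open>Only cells with \<open>\<bar>a\<bar> \<le> int p\<close> are tracked. Heads stay
    strictly below \<open>p\<close> in absolute value, so the scanned cells are among them, and all
    tracked cells have indices below \<open>2 * p\<close>.\<close>
  define ok where "ok n \<longleftrightarrow> ?S (u n) (fa (0, fst (run M w n), 0) 0) \<and>
     (\<forall>i<tapes M. \<forall>a. \<bar>a\<bar> \<le> int p \<longrightarrow> (case snd (run M w n) ! i of (h, f) \<Rightarrow>
        ?S (u n) (fa (if h \<le> a then 1 else 2, i, f a) (nat (if h \<le> a then a - h else h - 1 - a)))))" for n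
  have W0: "0 < W" using W by simp
  have ok0: "ok 0"
    unfolding ok_def
  proof (intro conjI allI impI)
    show "?S (u 0) (fa (0, fst (run M w 0), 0) 0)"
      using u0(2)[OF W0] by (simp add: u initF_def sat_conjs run_0 init_def)
    fix i a assume i: "i < tapes M" and a: "\<bar>a\<bar> \<le> int p"
    have k: "nat a < W" "nat (- 1 - a) < W" using a W by linarith+
    note f = u0(2)[OF k(1)] u0(2)[OF k(2)]
    show "case snd (run M w 0) ! i of (h, f) \<Rightarrow>
        ?S (u 0) (fa (if h \<le> a then 1 else 2, i, f a) (nat (if h \<le> a then a - h else h - 1 - a)))"
      using f i by (cases "i = 0"; cases "a \<ge> 0")
        (auto simp: u initF_def sat_conjs run_0 init_def nth_Cons' contents_def)
  qed
  have okS: "ok (Suc n)" if ok: "ok n" and nh: "\<not> halted M (run M w n)" for n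
  proof -
    obtain q ts where cf: "run M w n = (q, ts)" by fastforce
    have reg: "regular M (q, ts)" using regular_run[OF wf, of w n] cf by simp
    have hb: "\<bar>fst (ts ! i)\<bar> < int p" if "i < tapes M" for i
      using head_bound[OF wf that vis, of n] cf by simp
    have Q: "?S (u n) (fa (0, q, 0) 0)" using ok by (simp add: ok_def cf)
    have view: "?S (u n) (fa (1, i, head (ts ! i)) 0)" if "i < tapes M" for i
      using ok hb[OF that] that by (auto simp: ok_def cf dest!: spec[of _ i] spec[of _ "fst (ts ! i)"] split: prod.splits)
    have fire: "?S (u (Suc n)) (lit hd k)"
      if r: "(q, map head ts, e, hd) \<in> rules_of M" and k: "k < W" and e: "?S (u n) (lit e k)" for e hd k
    proof -
      have "?S (u (Suc n)) (clause (q, map head ts, e, hd) k)"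
        using con[OF u(2) k] r by (simp add: consF_def sat_conjs set_rules)
      moreover have "?S (u n) (body (q, map head ts, e, hd) k)"
        using Q e view reg by (auto simp: sat_conjs regular_def)
      ultimately show ?thesis using u(3)[of n] by (auto simp: clause_def)
    qed
    show ?thesis
      unfolding ok_def
    proof (intro conjI allI impI)
      have "?S (u (Suc n)) (lit (False, 0, 0, fst (step M (q, ts)), 0) 0)"
        using Q by (intro fire[OF new_state[OF wf reg]] W0) (use nh cf in \<open>simp_all add: lit_def idx_def\<close>)
      then show "?S (u (Suc n)) (fa (0, fst (run M w (Suc n)), 0) 0)"
        by (simp add: run_Suc cf lit_def idx_def)
      fix i a assume i: "i < tapes M" and a: "\<bar>a\<bar> \<le> int p"
      obtain h f where T: "ts ! i = (h, f)" by fastforce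
      obtain h' f' where T': "snd (step M (q, ts)) ! i = (h', f')" by fastforce
      have old: "?S (u n) (fa (if h \<le> a then 1 else 2, i, f a) (nat (if h \<le> a then a - h else h - 1 - a)))"
        using ok i a T by (auto simp: ok_def cf dest!: spec[of _ i] spec[of _ a])
      obtain e hd k where w: "(q, map head ts, e, hd) \<in> rules_of M" "k < 2 * p + 1"
        "snd (snd e) = (0, q, 0) \<and> idx e k = 0 \<or>
          snd (snd e) = (if h \<le> a then 1 else 2, i, f a) \<and> idx e k = nat (if h \<le> a then a - h else h - 1 - a)"
        "lit hd k = fa (if h' \<le> a then 1 else 2, i, f' a) (nat (if h' \<le> a then a - h' else h' - 1 - a))"
        using new_fact[OF wf reg _ i refl T T' _ a refl refl] nh cf hb[OF i] T by auto
      have "?S (u n) (lit e k)" using w(3) Q old unfolding lit_def by auto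
      then have "?S (u (Suc n)) (lit hd k)" using w(2) W by (intro fire[OF w(1)]) auto
      then show "case snd (run M w (Suc n)) ! i of (h, f) \<Rightarrow>
        ?S (u (Suc n)) (fa (if h \<le> a then 1 else 2, i, f a) (nat (if h \<le> a then a - h else h - 1 - a)))"
        using w(4) T' by (simp add: run_Suc cf)
    qed
  qed
  \<comment> \<open>The run is followed up to its first accepting configuration; an earlier halted
    configuration would persist and thus be accepting already.\<close>
  define n where "n = (LEAST n. fst (run M w n) = accept M)"
  have n: "fst (run M w n) = accept M" unfolding n_def by (rule LeastI_ex[OF acc])
  have nh: "\<not> halted M (run M w j)" if "j < n" for j
  proof
    assume h: "halted M (run M w j)"
    have "run M w n = run M w j" by (rule halted_stable[OF h]) (use that in simp)
    then show False using n not_less_Least[of j] that unfolding n_def by metis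
  qed
  have "ok j" if "j \<le> n" for j
    using that by (induction j) (use ok0 okS nh in auto)
  from this[of n] have "?S (u n) (fa (0, accept M, 0) 0)" using n by (simp add: ok_def)
  then show False using con[OF u(2) W0, of n] by (simp add: consF_def)
qed

text \<open>The countermodel lives on \<open>nat\<close>; validity over the given type is carried
  there by \<open>wd_valid_all_types\<close>.\<close>

theorem runF_correct:
  assumes inf: "infinite (UNIV :: 'w set)" and wf: "wf_tm M"
    and vis: "finite (visited M w)" "card (visited M w) \<le> p" and W: "2 * p + 1 \<le> W"
  shows "enc (runF M w W) \<in> DP_ab TYPE('w) \<longleftrightarrow> (\<exists>n. fst (run M w n) = accept M)"
proof -
  have "enc (runF M w W) \<in> DP_ab TYPE('w) \<longleftrightarrow> wd_valid TYPE('w) (runF M w W)"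
    using inj_enc by (auto simp: DP_ab_def dest: injD)
  also have "\<dots> \<longleftrightarrow> (\<exists>n. fst (run M w n) = accept M)"
    using valid_if_accepting[OF wf _ vis W] not_valid_if_not_accepting[OF wf]
      wd_valid_all_types[OF inf, where 'v = nat] by blast
  finally show ?thesis .
qed

section \<open>The reduction is computable in polynomial time\<close>

text \<open>An upper bound replaces the exact count, so that bounds can be rounded before they are
  composed.\<close>

definition runs :: "'a com \<Rightarrow> (nat \<Rightarrow> 'a list) \<Rightarrow> nat \<Rightarrow> (nat \<Rightarrow> 'a list) \<Rightarrow> bool" where
  "runs c \<sigma> T \<sigma>' \<longleftrightarrow> (\<exists>t\<le>T. exec \<infinity> c \<sigma> t \<sigma>')"

lemma runs_mono: "runs c \<sigma> T \<sigma>1 \<Longrightarrow> T \<le> T' \<Longrightarrow> \<sigma>1 = \<sigma>' \<Longrightarrow> runs c \<sigma> T' \<sigma>'"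
  unfolding runs_def by (metis le_trans)

lemma runs_Skip: "runs Skip \<sigma> 0 \<sigma>"
  and runs_Push: "runs (Push i a) \<sigma> 2 (\<sigma>(i := a # \<sigma> i))"
  and runs_Pop: "runs (Pop i) \<sigma> 1 (\<sigma>(i := tl (\<sigma> i)))"
  and runs_Emit: "runs (Emit i a) \<sigma> 1 (\<sigma>(i := \<sigma> i @ [a]))"
  unfolding runs_def
  by (rule exI[of _ 0], simp add: exec.Skip) (rule exI[of _ 2], simp add: exec.Push,
      rule exI[of _ 1], simp add: exec.Pop[simplified], rule exI[of _ 1], simp add: exec.Emit[simplified])

lemma runs_Seq: "runs c \<sigma> T \<sigma>1 \<Longrightarrow> runs d \<sigma>1 T' \<sigma>2 \<Longrightarrow> runs (c ;; d) \<sigma> (T + T' + 1) \<sigma>2"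
  unfolding runs_def by (meson add_le_mono exec.Seq order_refl)

lemma runs_Case: "runs (f (tos (\<sigma> i))) \<sigma> T \<sigma>' \<Longrightarrow> runs (Case i f) \<sigma> (T + 1) \<sigma>'"
  unfolding runs_def by (meson add_le_mono exec.Case order_refl)

lemma runs_WhileF: "\<sigma> i = [] \<Longrightarrow> runs (While i c) \<sigma> 1 \<sigma>"
  unfolding runs_def by (meson exec.WhileF order_refl)

lemma runs_WhileT: "\<sigma> i \<noteq> [] \<Longrightarrow> runs c \<sigma> T \<sigma>1 \<Longrightarrow> runs (While i c) \<sigma>1 T' \<sigma>2
    \<Longrightarrow> runs (While i c) \<sigma> (T + T' + 2) \<sigma>2"
  unfolding runs_def by (meson add_le_mono exec.WhileT order_refl)

text \<open>\<open>f j\<close> is the state after \<open>j\<close> rounds. A round costs two steps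
  beyond its body, one for the test and one for dropping the finished body; the final test costs one
  more.\<close>

lemma runs_loop:
  assumes "\<And>j. j < n \<Longrightarrow> f j i \<noteq> []" "f n i = []" "\<And>j. j < n \<Longrightarrow> runs c (f j) T (f (Suc j))"
  shows "runs (While i c) (f 0) (n * (T + 2) + 1) (f n)"
proof -
  have "runs (While i c) (f (n - m)) (m * (T + 2) + 1) (f n)" if "m \<le> n" for m
    using that
  proof (induction m)
    case 0
    then show ?case using runs_WhileF[of "f n" i c] assms(2) by simp
  next
    case (Suc m)
    then have lt: "n - Suc m < n" and s: "Suc (n - Suc m) = n - m" by auto
    have "runs (While i c) (f (n - m)) (m * (T + 2) + 1) (f n)" using Suc by simp
    from runs_WhileT[OF assms(1)[OF lt] assms(3)[OF lt, unfolded s] this]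
    show ?case by (rule runs_mono) simp_all
  qed
  from this[of n] show ?thesis by simp
qed

text \<open>Stack 0 is the input, 6 the output, 1 to 5 are scratch stacks holding unary numbers.\<close>

abbreviation ones :: "nat \<Rightarrow> bool list" where "ones n \<equiv> replicate n True"

definition emits :: "bool list \<Rightarrow> bool com" where
  "emits bs = foldr (\<lambda>b c. Emit 6 b ;; c) bs Skip"

lemma runs_emits: "runs (emits bs) \<sigma> (2 * length bs) (\<sigma>(6 := \<sigma> 6 @ bs))"
proof (induction bs arbitrary: \<sigma>)
  case Nil
  show ?case using runs_Skip[of \<sigma>] by (simp add: emits_def)
next
  case (Cons b bs)
  have "runs (Emit 6 b ;; emits bs) \<sigma> (1 + 2 * length bs + 1) (\<sigma>(6 := \<sigma> 6 @ b # bs))"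
    by (rule runs_mono[OF runs_Seq[OF runs_Emit Cons]]) (auto simp: fun_eq_iff)
  then show ?case by (simp add: emits_def fun_upd_def)
qed

text \<open>In a text template \<open>None\<close> is to be replaced by \<open>k\<close> binary digits 1.\<close>

type_synonym item = "bool list option"

definition render :: "nat \<Rightarrow> item list \<Rightarrow> bool list" where
  "render k its = concat (map (\<lambda>it. case it of None \<Rightarrow> concat (replicate k [False, True, True]) | Some bs \<Rightarrow> bs) its)"

definition rep_digits :: "bool com" where
  "rep_digits = While 5 (Pop 5 ;; Push 3 True ;; emits [False, True, True]) ;; While 3 (Pop 3 ;; Push 5 True)"

lemma ones_Suc: "j < k \<Longrightarrow> ones (k - j) = True # ones (k - Suc j)"
  by (metis Suc_diff_Suc replicate_Suc)

lemma runs_rep_digits: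
  assumes "\<sigma> 5 = ones k" "\<sigma> 3 = []"
  shows "runs rep_digits \<sigma> (20 * k + 3) (\<sigma>(6 := \<sigma> 6 @ concat (replicate k [False, True, True])))"
proof -
  define f where "f j = \<sigma>(5 := ones (k - j), 3 := ones j, 6 := \<sigma> 6 @ concat (replicate j [False, True, True]))" for j
  define g where "g j = (f k)(3 := ones (k - j), 5 := ones j)" for j
  have a: "runs (While 5 (Pop 5 ;; Push 3 True ;; emits [False, True, True])) (f 0) (k * (11 + 2) + 1) (f k)"
  proof (rule runs_loop)
    fix j assume j: "j < k"
    have "concat (replicate (Suc j) [False, True, True]) = concat (replicate j [False, True, True]) @ [False, True, True]"
      by (simp flip: replicate_append_same)
    then show "runs (Pop 5 ;; Push 3 True ;; emits [False, True, True]) (f j) 11 (f (Suc j))"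
      using j by (intro runs_mono[OF runs_Seq[OF runs_Pop runs_Seq[OF runs_Push runs_emits]]])
        (simp_all add: f_def ones_Suc fun_eq_iff)
  qed (auto simp: f_def)
  have b: "runs (While 3 (Pop 3 ;; Push 5 True)) (g 0) (k * (4 + 2) + 1) (g k)"
  proof (rule runs_loop)
    fix j assume "j < k"
    then show "runs (Pop 3 ;; Push 5 True) (g j) 4 (g (Suc j))"
      by (intro runs_mono[OF runs_Seq[OF runs_Pop runs_Push]]) (simp_all add: g_def ones_Suc fun_eq_iff)
  qed (auto simp: g_def)
  have e: "f 0 = \<sigma>" "g 0 = f k" using assms by (auto simp: f_def g_def fun_eq_iff)
  show ?thesis
    unfolding rep_digits_def
    by (rule runs_mono[OF runs_Seq[OF a[unfolded e] b[unfolded e]]])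
      (use assms in \<open>auto simp: f_def g_def fun_eq_iff\<close>)
qed

definition item_prog :: "item \<Rightarrow> bool com" where
  "item_prog it = (case it of None \<Rightarrow> rep_digits | Some bs \<Rightarrow> emits bs)"

definition items :: "item list \<Rightarrow> bool com" where
  "items its = foldr (\<lambda>it c. item_prog it ;; c) its Skip"

definition cost :: "item list \<Rightarrow> nat" where
  "cost its = (\<Sum>it\<leftarrow>its. case it of None \<Rightarrow> 24 | Some bs \<Rightarrow> 2 * length bs + 1)"

lemma runs_items:
  assumes "\<sigma> 5 = ones k" "\<sigma> 3 = []"
  shows "runs (items its) \<sigma> (cost its * (k + 1)) (\<sigma>(6 := \<sigma> 6 @ render k its))"
  using assms
proof (induction its arbitrary: \<sigma>)
  case Nil
  show ?case using runs_Skip[of \<sigma>] by (simp add: items_def render_def cost_def)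
next
  case (Cons it its)
  have 1: "runs (item_prog it) \<sigma> (case it of None \<Rightarrow> 20 * k + 3 | Some bs \<Rightarrow> 2 * length bs) (\<sigma>(6 := \<sigma> 6 @ render k [it]))"
    using runs_rep_digits[OF Cons.prems] runs_emits
    by (cases it) (auto simp: item_prog_def render_def)
  have "runs (items its) (\<sigma>(6 := \<sigma> 6 @ render k [it])) (cost its * (k + 1))
     (\<sigma>(6 := \<sigma> 6 @ render k [it], 6 := (\<sigma>(6 := \<sigma> 6 @ render k [it])) 6 @ render k its))"
    using Cons by (intro Cons.IH) simp_all
  from runs_mono[OF runs_Seq[OF 1 this]]
  have "runs (item_prog it ;; items its) \<sigma> (cost (it # its) * (k + 1)) (\<sigma>(6 := \<sigma> 6 @ render k (it # its)))"
    by (auto simp: cost_def render_def algebra_simps split: option.splits)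
  then show ?case by (simp add: items_def fun_upd_def)
qed

text \<open>Stack 4 counts the remaining rounds and stack 5 holds the current \<open>k\<close>. Each
  round pops one input symbol, so the \<open>k\<close>-th conjunct may depend on the
  \<open>k\<close>-th input bit, or on its absence once the input is exhausted.\<close>

definition gen :: "(bool option \<Rightarrow> item list) \<Rightarrow> bool com" where
  "gen f = While 4 (Case 0 (\<lambda>x. items (f x)) ;; Pop 0 ;; Pop 4 ;; Push 5 True)"

lemma runs_gen:
  assumes "\<sigma> 4 = ones u" "\<sigma> 5 = []" "\<sigma> 3 = []" and C: "\<And>x. cost (f x) \<le> C"
  shows "runs (gen f) \<sigma> (u * (C * (u + 1) + 10) + 1)
    (\<sigma>(0 := drop u (\<sigma> 0), 4 := [], 5 := ones u,
       6 := \<sigma> 6 @ concat (map (\<lambda>k. render k (f (tos (drop k (\<sigma> 0))))) [0..<u])))"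
proof -
  define g where "g j = \<sigma>(0 := drop j (\<sigma> 0), 4 := ones (u - j), 5 := ones j,
       6 := \<sigma> 6 @ concat (map (\<lambda>k. render k (f (tos (drop k (\<sigma> 0))))) [0..<j]))" for j
  have "runs (gen f) (g 0) (u * ((C * (u + 1) + 8) + 2) + 1) (g u)"
    unfolding gen_def
  proof (rule runs_loop)
    fix j assume j: "j < u"
    let ?x = "tos (g j 0)"
    have "runs (Case 0 (\<lambda>x. items (f x))) (g j) (cost (f ?x) * (j + 1) + 1)
       ((g j)(6 := g j 6 @ render j (f ?x)))"
      by (rule runs_Case, rule runs_items) (auto simp: g_def assms)
    from runs_Seq[OF this runs_Seq[OF runs_Pop runs_Seq[OF runs_Pop runs_Push]]]
    show "runs (Case 0 (\<lambda>x. items (f x)) ;; Pop 0 ;; Pop 4 ;; Push 5 True) (g j) (C * (u + 1) + 8) (g (Suc j))"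
    proof (rule runs_mono)
      have "cost (f ?x) * (j + 1) \<le> C * (u + 1)" by (rule mult_le_mono[OF C]) (use j in simp)
      then show "cost (f ?x) * (j + 1) + 1 + (1 + (1 + 2 + 1) + 1) + 1 \<le> C * (u + 1) + 8" by simp
    qed (use j in \<open>auto simp: g_def fun_eq_iff ones_Suc drop_Suc tl_drop\<close>)
  qed (auto simp: g_def)
  then show ?thesis by (rule back_subst[of "\<lambda>x. runs (gen f) x _ _", THEN runs_mono])
      (use assms in \<open>auto simp: g_def fun_eq_iff\<close>)
qed

definition length_prog :: "bool com" where
  "length_prog = While 0 (Case 0 (\<lambda>x. Pop 0 ;; Push 3 (the x) ;; Push 1 True)) ;;
     While 3 (Case 3 (\<lambda>x. Pop 3 ;; Push 0 (the x)))"

lemma runs_length_prog: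
  assumes "\<sigma> 3 = []" "\<sigma> 1 = []"
  shows "runs length_prog \<sigma> (20 * length (\<sigma> 0) + 3) (\<sigma>(1 := ones (length (\<sigma> 0))))"
proof -
  let ?n = "length (\<sigma> 0)"
  define f where "f j = \<sigma>(0 := drop j (\<sigma> 0), 3 := rev (take j (\<sigma> 0)), 1 := ones j)" for j
  define g where "g j = (f ?n)(3 := drop j (rev (\<sigma> 0)), 0 := rev (take j (rev (\<sigma> 0))))" for j
  have tk: "rev (take (Suc j) xs) = xs ! j # rev (take j xs)"
    and dr: "drop j xs = xs ! j # drop (Suc j) xs" if "j < length xs" for j and xs :: "bool list"
    using that by (simp_all add: take_Suc_conv_app_nth Cons_nth_drop_Suc)
  have a: "runs (While 0 (Case 0 (\<lambda>x. Pop 0 ;; Push 3 (the x) ;; Push 1 True))) (f 0) (?n * (8 + 2) + 1) (f ?n)"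
  proof (rule runs_loop)
    fix j assume "j < ?n"
    then show "runs (Case 0 (\<lambda>x. Pop 0 ;; Push 3 (the x) ;; Push 1 True)) (f j) 8 (f (Suc j))"
      by (intro runs_mono[OF runs_Case[OF runs_Seq[OF runs_Pop runs_Seq[OF runs_Push runs_Push]]]])
        (auto simp: f_def fun_eq_iff tk dr)
  qed (auto simp: f_def)
  have b: "runs (While 3 (Case 3 (\<lambda>x. Pop 3 ;; Push 0 (the x)))) (g 0) (?n * (5 + 2) + 1) (g ?n)"
  proof (rule runs_loop)
    fix j assume "j < ?n"
    then show "runs (Case 3 (\<lambda>x. Pop 3 ;; Push 0 (the x))) (g j) 5 (g (Suc j))"
      by (intro runs_mono[OF runs_Case[OF runs_Seq[OF runs_Pop runs_Push]]])
        (auto simp: g_def fun_eq_iff tk[of _ "rev (\<sigma> 0)"] dr[of _ "rev (\<sigma> 0)"])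
  qed (auto simp: g_def)
  have e: "f 0 = \<sigma>" "g 0 = f ?n" using assms by (auto simp: f_def g_def fun_eq_iff)
  show ?thesis
    unfolding length_prog_def
    by (rule runs_mono[OF runs_Seq[OF a[unfolded e] b[unfolded e]]])
      (use assms in \<open>auto simp: f_def g_def fun_eq_iff\<close>)
qed

text \<open>Stack 1 is added to stack 2 once for each entry of stack 4 and is restored from stack 3
  every time; the product finally replaces stack 4.\<close>

definition mul :: "bool com" where
  "mul = While 4 (Pop 4 ;; While 1 (Pop 1 ;; Push 3 True ;; Push 2 True) ;; While 3 (Pop 3 ;; Push 1 True)) ;;
     While 2 (Pop 2 ;; Push 4 True)"

lemma runs_mul:
  assumes "\<sigma> 1 = ones n" "\<sigma> 2 = []" "\<sigma> 3 = []" "\<sigma> 4 = ones a"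
  shows "runs mul \<sigma> (30 * (a + 1) * (n + 1)) (\<sigma>(4 := ones (a * n)))"
proof -
  have in1: "runs (While 1 (Pop 1 ;; Push 3 True ;; Push 2 True)) \<tau> (n * 9 + 1) (\<tau>(1 := [], 3 := ones n, 2 := ones (b + n)))"
    if "\<tau> 1 = ones n" "\<tau> 3 = []" "\<tau> 2 = ones b" for \<tau> b
  proof -
    define f where "f j = \<tau>(1 := ones (n - j), 3 := ones j, 2 := ones (b + j))" for j
    have "runs (While 1 (Pop 1 ;; Push 3 True ;; Push 2 True)) (f 0) (n * (7 + 2) + 1) (f n)"
    proof (rule runs_loop)
      fix j assume "j < n"
      then show "runs (Pop 1 ;; Push 3 True ;; Push 2 True) (f j) 7 (f (Suc j))"
        by (intro runs_mono[OF runs_Seq[OF runs_Pop runs_Seq[OF runs_Push runs_Push]]])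
          (simp_all add: f_def ones_Suc fun_eq_iff)
    qed (auto simp: f_def)
    moreover have "f 0 = \<tau>" using that by (auto simp: f_def fun_eq_iff)
    ultimately show ?thesis by (simp add: f_def)
  qed
  have in2: "runs (While 3 (Pop 3 ;; Push 1 True)) \<tau> (n * 6 + 1) (\<tau>(3 := [], 1 := ones n))"
    if "\<tau> 3 = ones n" "\<tau> 1 = []" for \<tau>
  proof -
    define f where "f j = \<tau>(3 := ones (n - j), 1 := ones j)" for j
    have "runs (While 3 (Pop 3 ;; Push 1 True)) (f 0) (n * (4 + 2) + 1) (f n)"
    proof (rule runs_loop)
      fix j assume "j < n"
      then show "runs (Pop 3 ;; Push 1 True) (f j) 4 (f (Suc j))"
        by (intro runs_mono[OF runs_Seq[OF runs_Pop runs_Push]]) (simp_all add: f_def ones_Suc fun_eq_iff)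
    qed (auto simp: f_def)
    moreover have "f 0 = \<tau>" using that by (auto simp: f_def fun_eq_iff)
    ultimately show ?thesis by (simp add: f_def)
  qed
  define f where "f j = \<sigma>(4 := ones (a - j), 2 := ones (j * n))" for j
  define g where "g j = (f a)(2 := ones (a * n - j), 4 := ones j)" for j
  have A: "runs (While 4 (Pop 4 ;; While 1 (Pop 1 ;; Push 3 True ;; Push 2 True) ;; While 3 (Pop 3 ;; Push 1 True)))
     (f 0) (a * ((15 * n + 5) + 2) + 1) (f a)"
  proof (rule runs_loop)
    fix j assume j: "j < a"
    let ?p = "(f j)(4 := tl (f j 4))"
    let ?q = "?p(1 := [], 3 := ones n, 2 := ones (j * n + n))"
    have 1: "runs (While 1 (Pop 1 ;; Push 3 True ;; Push 2 True)) ?p (n * 9 + 1) ?q"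
      by (rule in1) (use assms in \<open>auto simp: f_def\<close>)
    have 2: "runs (While 3 (Pop 3 ;; Push 1 True)) ?q (n * 6 + 1) (?q(3 := [], 1 := ones n))"
      by (rule in2) auto
    show "runs (Pop 4 ;; While 1 (Pop 1 ;; Push 3 True ;; Push 2 True) ;; While 3 (Pop 3 ;; Push 1 True))
       (f j) (15 * n + 5) (f (Suc j))"
      by (rule runs_mono[OF runs_Seq[OF runs_Pop runs_Seq[OF 1 2]]])
        (use j assms in \<open>auto simp: f_def fun_eq_iff ones_Suc algebra_simps\<close>)
  qed (auto simp: f_def)
  have B: "runs (While 2 (Pop 2 ;; Push 4 True)) (g 0) (a * n * (4 + 2) + 1) (g (a * n))"
  proof (rule runs_loop)
    fix j assume "j < a * n"
    then show "runs (Pop 2 ;; Push 4 True) (g j) 4 (g (Suc j))"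
      by (intro runs_mono[OF runs_Seq[OF runs_Pop runs_Push]]) (simp_all add: g_def ones_Suc fun_eq_iff)
  qed (auto simp: g_def)
  have e: "f 0 = \<sigma>" "g 0 = f a" using assms by (auto simp: f_def g_def fun_eq_iff)
  show ?thesis
    unfolding mul_def
    by (rule runs_mono[OF runs_Seq[OF A[unfolded e] B[unfolded e]]])
      (use assms in \<open>auto simp: f_def g_def fun_eq_iff algebra_simps\<close>)
qed

primrec pushes :: "nat \<Rightarrow> bool com" where
  "pushes 0 = Skip"
| "pushes (Suc c) = Push 1 True ;; pushes c"

lemma runs_pushes: "\<sigma> 1 = ones n \<Longrightarrow> runs (pushes c) \<sigma> (3 * c) (\<sigma>(1 := ones (n + c)))"
proof (induction c arbitrary: \<sigma> n)
  case 0
  then have "\<sigma>(1 := ones n) = \<sigma>" by auto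
  then show ?case using runs_Skip[of \<sigma>] by simp
next
  case (Suc c)
  have "runs (pushes c) (\<sigma>(1 := True # \<sigma> 1)) (3 * c) (\<sigma>(1 := True # \<sigma> 1, 1 := ones (Suc n + c)))"
    by (rule Suc.IH) (use Suc.prems in simp)
  from runs_Seq[OF runs_Push this] show ?case
    unfolding pushes.simps by (rule runs_mono) (auto simp: fun_eq_iff)
qed

primrec pow :: "nat \<Rightarrow> bool com" where
  "pow 0 = Push 4 True"
| "pow (Suc e) = pow e ;; mul"

lemma runs_pow:
  assumes "\<sigma> 1 = ones n" "\<sigma> 2 = []" "\<sigma> 3 = []" "\<sigma> 4 = []"
  shows "runs (pow e) \<sigma> (61 * (e + 1) * (n + 1) ^ (e + 1)) (\<sigma>(4 := ones (n ^ e)))"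
proof (induction e)
  case 0
  show ?case by (simp, rule runs_mono[OF runs_Push]) (use assms in auto)
next
  case (Suc e)
  let ?X = "(n + 1) ^ (e + 1)"
  have m: "runs mul (\<sigma>(4 := ones (n ^ e))) (30 * (n ^ e + 1) * (n + 1)) (\<sigma>(4 := ones (n ^ e), 4 := ones (n ^ e * n)))"
    by (rule runs_mul) (use assms in auto)
  \<comment> \<open>The constant 61: both summands of \<open>n ^ e + 1\<close> are at most
    \<open>(n + 1) ^ e\<close>, so one multiplication costs at most \<open>60 * ?X\<close>, and
    another \<open>?X\<close> pays for the sequencing step.\<close>
  have p: "n ^ e \<le> (n + 1) ^ e" "1 \<le> (n + 1) ^ e" "1 \<le> ?X" by (auto intro: power_mono one_le_power simp del: power_Suc power_Suc2)
  have "30 * (n ^ e + 1) * (n + 1) \<le> 30 * ((n + 1) ^ e + (n + 1) ^ e) * (n + 1)"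
    using p by (intro mult_le_mono add_le_mono) simp_all
  then have c: "30 * (n ^ e + 1) * (n + 1) \<le> 60 * ?X" by (simp add: algebra_simps)
  have "61 * (e + 1) * ?X + 30 * (n ^ e + 1) * (n + 1) + 1 \<le> 61 * (e + 1) * ?X + 60 * ?X + ?X"
    using c p(3) by (intro add_le_mono) auto
  also have "\<dots> = 61 * (Suc e + 1) * ?X" by (simp add: algebra_simps)
  also have "\<dots> \<le> 61 * (Suc e + 1) * (n + 1) ^ (Suc e + 1)" by (intro mult_le_mono power_increasing) auto
  finally have "61 * (e + 1) * ?X + 30 * (n ^ e + 1) * (n + 1) + 1 \<le> 61 * (Suc e + 1) * (n + 1) ^ (Suc e + 1)" .
  then show ?case unfolding pow.simps
    by (rule runs_mono[OF runs_Seq[OF Suc m]]) (auto simp: mult.commute fun_eq_iff)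
qed


section \<open>Families of formulas printed from a template that does not depend on the
  index\<close>

definition uniform :: "(nat \<Rightarrow> fm) \<Rightarrow> bool" where
  "uniform \<phi> \<longleftrightarrow> (\<exists>its. \<forall>k. enc (\<phi> k) = render k its)"

lemma render_append: "render k (xs @ ys) = render k xs @ render k ys"
  by (simp add: render_def)

lemma render_Some: "render k (Some bs # its) = bs @ render k its"
  by (simp add: render_def)

lemma uniform_const: "uniform (\<lambda>_. \<phi>)"
  unfolding uniform_def by (rule exI[of _ "[Some (enc \<phi>)]"]) (simp add: render_def)

lemma uniform_prefix:
  assumes "uniform \<phi>" "\<And>k. enc (\<psi> k) = bs @ enc (\<phi> k)"
  shows "uniform \<psi>"
proof -
  obtain its where "\<forall>k. enc (\<phi> k) = render k its" using assms(1) by (auto simp: uniform_def)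
  then show ?thesis unfolding uniform_def
    by (intro exI[of _ "Some bs # its"]) (simp add: assms(2) render_Some)
qed

lemma uniform_Neg: "uniform \<phi> \<Longrightarrow> uniform (\<lambda>k. Neg (\<phi> k))"
  and uniform_BoxB: "uniform \<phi> \<Longrightarrow> uniform (\<lambda>k. BoxB (\<phi> k))"
  by (erule uniform_prefix[of _ _ "[True, False, False]"], simp)
    (erule uniform_prefix[of _ _ "[True, True, True]"], simp)

lemma uniform_And:
  assumes "uniform \<phi>" "uniform \<psi>"
  shows "uniform (\<lambda>k. And (\<phi> k) (\<psi> k))"
proof -
  obtain its jts where "\<forall>k. enc (\<phi> k) = render k its" "\<forall>k. enc (\<psi> k) = render k jts"
    using assms by (auto simp: uniform_def)
  then show ?thesis unfolding uniform_def
    by (intro exI[of _ "Some [True, False, True] # its @ jts"]) (simp add: render_Some render_append)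
qed

lemma uniform_conjs: "(\<And>g. g \<in> set gs \<Longrightarrow> uniform g) \<Longrightarrow> uniform (\<lambda>k. conjs (map (\<lambda>g. g k) gs))"
  by (induction gs) (auto simp: conjs_def intro: uniform_const uniform_And)

lemma uniform_conjs_map: "(\<And>x. x \<in> set xs \<Longrightarrow> uniform (h x)) \<Longrightarrow> uniform (\<lambda>k. conjs (map (\<lambda>x. h x k) xs))"
  using uniform_conjs[of "map h xs"] by (auto simp: comp_def)

text \<open>By the choice of \<open>atm\<close>, the index occurs as a single run of digits, hence
  the single gap in the template.\<close>

lemma uniform_fa: "uniform (\<lambda>k. fa c k)"
  unfolding uniform_def
  by (rule exI[of _ "[Some [False, False, True, False, True, True], None,
        Some ([False, True, False] @ concat (replicate (to_nat c) [False, True, True]))]"])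
    (simp add: fa_def bin_atm render_def)

lemma uniform_fa_offset: "uniform (\<lambda>k. fa c (k + n))"
proof -
  have "concat (replicate (k + n) xs) = concat (replicate k xs) @ concat (replicate n xs)" for k and xs :: "bool list"
    by (simp add: replicate_add)
  then show ?thesis unfolding uniform_def
    by (intro exI[of _ "[Some [False, False, True, False, True, True], None,
        Some (concat (replicate n [False, True, True])),
        Some ([False, True, False] @ concat (replicate (to_nat c) [False, True, True]))]"])
      (simp add: fa_def bin_atm render_def)
qed

lemma uniform_lit: "uniform (lit l)"
proof -
  obtain r n c where l: "l = (r, n, c)" by (cases l) auto
  show ?thesis
  proof (cases r)
    case True
    then have "lit l = (\<lambda>k. fa c (k + n))" by (simp add: fun_eq_iff lit_def idx_def l)
    then show ?thesis using uniform_fa_offset by simp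
  next
    case False
    then have "lit l = (\<lambda>k. fa c n)" by (simp add: fun_eq_iff lit_def idx_def l)
    then show ?thesis using uniform_const by simp
  qed
qed

lemma uniform_clause: "uniform (clause r)"
proof -
  obtain q xs e h where r: "r = (q, xs, e, h)" by (cases r) auto
  have "uniform (\<lambda>k. clause (q, xs, e, h) k)"
    unfolding clause_def body.simps snd_conv fst_conv
    by (intro uniform_Neg uniform_And uniform_BoxB uniform_const uniform_lit)
  then show ?thesis by (simp add: r)
qed

lemma uniform_consF: "uniform (consF M)"
proof -
  have "uniform (\<lambda>k. consF M k)"
    unfolding consF_def by (intro uniform_And uniform_const uniform_conjs_map uniform_clause)
  then show ?thesis by simp
qed

lemma uniform_initF: "uniform (initF M x)"
proof -
  let ?gs = "[\<lambda>k. fa (0, start M, 0) 0, \<lambda>k. fa (1, 0, x) k, \<lambda>k. fa (2, 0, 0) k]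
     @ map (\<lambda>i k. fa (1, i, 0) k) [1..<tapes M] @ map (\<lambda>i k. fa (2, i, 0) k) [1..<tapes M]"
  have "uniform (\<lambda>k. conjs (map (\<lambda>g. g k) ?gs))"
    by (rule uniform_conjs) (auto intro: uniform_const uniform_fa)
  then have "uniform (\<lambda>k. initF M x k)" by (simp add: initF_def comp_def)
  then show ?thesis by simp
qed

lemma enc_conjs:
  "enc (conjs (map \<phi> [0..<W])) = concat (map (\<lambda>k. [True, False, True] @ enc (\<phi> k)) [0..<W])
     @ [True, False, False, False, False, False]"
proof -
  have "enc (conjs (map \<phi> xs)) = concat (map (\<lambda>k. [True, False, True] @ enc (\<phi> k)) xs)
     @ [True, False, False, False, False, False]" for xs :: "nat list"
    by (induction xs) (auto simp: conjs_def)
  then show ?thesis .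
qed

section \<open>Polynomial bounds and the printing program\<close>

definition polyb :: "(nat \<Rightarrow> nat) \<Rightarrow> bool" where
  "polyb f \<longleftrightarrow> (\<exists>p :: nat poly. \<forall>n. f n \<le> poly p n)"

lemma polyb_const: "polyb (\<lambda>n. c)"
  unfolding polyb_def by (rule exI[of _ "[:c:]"]) simp

lemma polyb_id: "polyb (\<lambda>n. n)"
  unfolding polyb_def by (rule exI[of _ "[:0, 1:]"]) simp

lemma polyb_add: "polyb f \<Longrightarrow> polyb g \<Longrightarrow> polyb (\<lambda>n. f n + g n)"
  unfolding polyb_def by (metis add_le_mono poly_add)

lemma polyb_mult: "polyb f \<Longrightarrow> polyb g \<Longrightarrow> polyb (\<lambda>n. f n * g n)"
  unfolding polyb_def by (metis mult_le_mono poly_mult)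

lemma polyb_power: "polyb f \<Longrightarrow> polyb (\<lambda>n. f n ^ e)"
  by (induction e) (auto intro: polyb_const polyb_mult)

lemma polyb_Suc: "polyb f \<Longrightarrow> polyb (\<lambda>n. Suc (f n))"
  using polyb_add[of f "\<lambda>_. 1"] polyb_const[of 1] by simp

lemmas polyb_intros = polyb_const polyb_id polyb_add polyb_mult polyb_power polyb_Suc

text \<open>The window only has to be large enough. Its polynomial size may therefore be replaced by
  a power of \<open>n + c\<close>, which \<open>pushes\<close> and \<open>pow\<close> compute in
  unary.\<close>

lemma poly_le_power:
  fixes p :: "nat poly"
  shows "\<exists>c e. \<forall>n. poly p n \<le> (n + c) ^ e"
proof (induction p)
  case 0
  show ?case by simp
next
  case (pCons a p)
  then obtain c e where ce: "poly p n \<le> (n + c) ^ e" for n by blast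
  have "poly (pCons a p) n \<le> (n + (c + a + 1)) ^ (e + 2)" for n
  proof -
    define m where "m = n + (c + a + 1)"
    have 1: "1 \<le> m ^ e" by (rule one_le_power) (simp add: m_def)
    have "poly (pCons a p) n = a + n * poly p n" by simp
    also have "\<dots> \<le> a * m ^ e + n * m ^ e"
      using 1 order_trans[OF ce power_mono[of "n + c" m e]] by (intro add_le_mono mult_le_mono2) (auto simp: m_def)
    also have "\<dots> = (a + n) * m ^ e" by (simp add: algebra_simps)
    also have "\<dots> \<le> (m * m) * m ^ e" by (intro mult_le_mono1) (simp add: m_def algebra_simps)
    finally show ?thesis unfolding m_def[symmetric] by (simp add: mult_ac)
  qed
  then show ?case by blast
qed

lemma wfc_simps [simp]: "wfc 6 (emits bs)" "wfc 6 (items its)" "wfc 6 (pushes c)" "wfc 6 (pow e)"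
proof -
  show e: "wfc 6 (emits bs)" for bs by (induction bs) (auto simp: emits_def)
  show "wfc 6 (items its)"
    by (induction its) (auto simp: items_def item_prog_def rep_digits_def e split: option.split)
  show "wfc 6 (pushes c)" by (induction c) auto
  show "wfc 6 (pow e)" by (induction e) (auto simp: mul_def)
qed

lemma poly_time_runF: "poly_time (\<lambda>w. enc (runF M w ((length w + c) ^ e)))"
proof -
  \<comment> \<open>What the input tape holds in cell \<open>k\<close> is determined by the top of
    the input stack after \<open>k\<close> pops; \<open>None\<close> accounts for the blanks beyond
    the input.\<close>
  define sym where "sym x = (case x of None \<Rightarrow> 0 :: nat | Some b \<Rightarrow> (if b then 2 else 1))" for x
  have sym: "contents w (int k) = sym (tos (drop k w))" for w k
    by (cases "k < length w") (auto simp: contents_def sym_def simp flip: Cons_nth_drop_Suc)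
  have "\<forall>x. \<exists>its. \<forall>k. enc (initF M (sym x) k) = render k its"
    using uniform_initF by (auto simp: uniform_def)
  then obtain f0 where f0: "\<And>x k. enc (initF M (sym x) k) = render k (f0 x)" by metis
  obtain g0 where g0: "\<And>k. enc (consF M k) = render k g0" using uniform_consF by (auto simp: uniform_def)
  define f where "f x = Some [True, False, True] # f0 x" for x
  define g where "g = (\<lambda>x :: bool option. Some [True, False, True] # g0)"
  define C where "C = Max (range (\<lambda>x. cost (f x))) + cost (g None)"
  have C: "cost (f x) \<le> C" "cost (g x) \<le> C" for x
    unfolding C_def by (auto simp: g_def intro!: trans_le_add1 Max_ge)
  \<comment> \<open>\<open>pre\<close> encodes the opening \<open>Neg\<close>, \<open>And\<close>,
    \<open>Neg\<close>, \<open>BoxA\<close>, \<open>Neg\<close> of \<open>runF\<close>;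
    \<open>mid\<close> closes the first conjunction by \<open>Neg Bot\<close> and opens the second
    \<open>BoxA\<close>; \<open>post\<close> closes the second conjunction.\<close>
  define pre where "pre = [True, False, False, True, False, True, True, False, False, True, True, False, True, False, False]"
  define mid where "mid = [True, False, False, False, False, False, True, True, False]"
  define post where "post = [True, False, False, False, False, False]"
  \<comment> \<open>The first \<open>gen\<close> has used up the counter on stack 4; it is recovered
    from stack 5 for the second one.\<close>
  define swap where "swap = (While 5 (Pop 5 ;; Push 4 True) :: bool com)"
  define prog where "prog = length_prog ;; pushes c ;; pow e ;; emits pre ;; gen f ;; emits mid ;; swap ;; gen g ;; emits post"
  define T where "T n = 20 * n + 3 + (3 * c + (61 * (e + 1) * (n + c + 1) ^ (e + 1) + (2 * length pre
     + ((n + c) ^ e * (C * ((n + c) ^ e + 1) + 10) + 1 + (2 * length mid + (6 * (n + c) ^ e + 1 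
     + ((n + c) ^ e * (C * ((n + c) ^ e + 1) + 10) + 1 + 2 * length post + 1) + 1) + 1) + 1) + 1) + 1) + 1) + 1" for n
  have "polyb T" unfolding T_def by (intro polyb_intros)
  then obtain p where p: "\<And>n. T n \<le> poly p n" by (auto simp: polyb_def)
  have wfc: "wfc 6 prog"
    by (auto simp: prog_def swap_def gen_def length_prog_def)
  show ?thesis
  proof (rule poly_timeI[OF _ wfc, where emb = id and p = p])
    fix w :: "bool list"
    let ?n = "length w" and ?W = "(length w + c) ^ e"
    let ?o1 = "concat (map (\<lambda>k. render k (f (tos (drop k w)))) [0..<?W])"
    let ?o2 = "concat (map (\<lambda>k. render k (g (tos (drop k (drop ?W w))))) [0..<?W])"
    define s0 where "s0 = (\<lambda>i :: nat. if i = 0 then map id w else [])"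
    define s1 where "s1 = s0(1 := ones ?n)"
    define s2 where "s2 = s0(1 := ones (?n + c))"
    define s3 where "s3 = s2(4 := ones ?W)"
    define s4 where "s4 = s3(6 := pre)"
    define s5 where "s5 = s4(0 := drop ?W w, 4 := [], 5 := ones ?W, 6 := pre @ ?o1)"
    define s6 where "s6 = s5(6 := pre @ ?o1 @ mid)"
    define s7 where "s7 = s6(5 := [], 4 := ones ?W)"
    define s8 where "s8 = s7(0 := drop ?W (drop ?W w), 4 := [], 5 := ones ?W, 6 := pre @ ?o1 @ mid @ ?o2)"
    define s9 where "s9 = s8(6 := pre @ ?o1 @ mid @ ?o2 @ post)"
    note sd = s0_def s1_def s2_def s3_def s4_def s5_def s6_def s7_def s8_def s9_def
    have 1: "runs length_prog s0 (20 * ?n + 3) s1"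
      using runs_length_prog[of s0] by (simp add: s0_def s1_def)
    have 2: "runs (pushes c) s1 (3 * c) s2"
      using runs_pushes[of s1 ?n c] by (simp add: s1_def s2_def)
    have 3: "runs (pow e) s2 (61 * (e + 1) * (?n + c + 1) ^ (e + 1)) s3"
      using runs_pow[of s2 "?n + c" e] by (simp add: s2_def s3_def s0_def)
    have 4: "runs (emits pre) s3 (2 * length pre) s4"
      using runs_emits[of pre s3] by (simp add: s4_def s3_def s2_def s0_def)
    have 5: "runs (gen f) s4 (?W * (C * (?W + 1) + 10) + 1) s5"
      unfolding s5_def
      by (rule runs_mono[OF runs_gen[where f = f, OF _ _ _ C(1)] le_refl]) (simp_all add: s4_def s3_def s2_def s0_def)
    have 6: "runs (emits mid) s5 (2 * length mid) s6"
      using runs_emits[of mid s5] by (simp add: s5_def s6_def)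
    have 7: "runs swap s6 (6 * ?W + 1) s7"
    proof -
      define h where "h j = s6(5 := ones (?W - j), 4 := ones j)" for j
      have "runs (While 5 (Pop 5 ;; Push 4 True)) (h 0) (?W * (4 + 2) + 1) (h ?W)"
      proof (rule runs_loop)
        fix j assume "j < ?W"
        then show "runs (Pop 5 ;; Push 4 True) (h j) 4 (h (Suc j))"
          by (intro runs_mono[OF runs_Seq[OF runs_Pop runs_Push]]) (simp_all add: h_def ones_Suc fun_eq_iff)
      qed (auto simp: h_def)
      moreover have "h 0 = s6" "h ?W = s7" by (auto simp: h_def s7_def s6_def s5_def fun_eq_iff)
      ultimately show ?thesis by (simp add: swap_def mult.commute)
    qed
    have 8: "runs (gen g) s7 (?W * (C * (?W + 1) + 10) + 1) s8"
      unfolding s8_def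
      by (rule runs_mono[OF runs_gen[where f = g, OF _ _ _ C(2)] le_refl])
        (simp_all add: s7_def s6_def s5_def s4_def s3_def s2_def s0_def)
    have 9: "runs (emits post) s8 (2 * length post) s9"
      using runs_emits[of post s8] by (simp add: s8_def s9_def)
    have "runs prog s0 (T ?n) s9"
      unfolding prog_def T_def
      by (rule runs_Seq[OF 1 runs_Seq[OF 2 runs_Seq[OF 3 runs_Seq[OF 4 runs_Seq[OF 5 runs_Seq[OF 6
          runs_Seq[OF 7 runs_Seq[OF 8 9]]]]]]]])
    then obtain t where t: "t \<le> T ?n" "exec \<infinity> prog s0 t s9" unfolding runs_def by blast
    have "s9 6 = enc (runF M w ?W)"
      by (simp add: s9_def runF_def enc_conjs f0 g0 sym f_def g_def render_Some pre_def mid_def post_def)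
    then show "\<exists>t \<sigma>. t \<le> poly p (length w) \<and> \<sigma> 6 = map id (enc (runF M w ((length w + c) ^ e)))
       \<and> exec \<infinity> prog (\<lambda>i. if i = 0 then map id w else []) t \<sigma>"
      using t order_trans[OF t(1) p] unfolding s0_def by auto
  qed simp_all
qed

theorem PSPACE_hard:
  assumes inf: "infinite (UNIV :: 'w set)" and L: "L \<in> PSPACE"
  shows "poly_reducible L (DP_ab TYPE('w))"
proof -
  obtain M and p :: "nat poly" where M: "wf_tm M" and
    *: "\<And>w. (w \<in> L \<longleftrightarrow> (\<exists>n. fst (run M w n) = accept M)) \<and>
     finite (visited M w) \<and> card (visited M w) \<le> poly p (length w)"
    using L unfolding PSPACE_def by blast
  obtain c e where ce: "\<And>n. poly ([:2:] * p + 1) n \<le> (n + c) ^ e" using poly_le_power by blast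
  show ?thesis
    unfolding poly_reducible_def
  proof (intro exI conjI allI)
    show "poly_time (\<lambda>w. enc (runF M w ((length w + c) ^ e)))" by (rule poly_time_runF)
    fix w :: "bool list"
    have "2 * poly p (length w) + 1 \<le> (length w + c) ^ e" using ce[of "length w"] by simp
    then show "w \<in> L \<longleftrightarrow> enc (runF M w ((length w + c) ^ e)) \<in> DP_ab TYPE('w)"
      using runF_correct[OF inf M, of w "poly p (length w)"] * by blast
  qed
qed

section \<open>A game characterizing satisfiability\<close>

datatype tok = TBot | TAtom | TDig bool | TNeg | TAnd | TBoxA | TBoxB

text \<open>Token positions serve as names of subformula occurrences. A type then is a plain bit
  list of the same length, which can be scanned in parallel with the formula.\<close>

fun toks :: "fm \<Rightarrow> tok list" where
  "toks Bot = [TBot]"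
| "toks (Atom n) = TAtom # map TDig (bin n)"
| "toks (Neg \<phi>) = TNeg # toks \<phi>"
| "toks (And \<phi> \<psi>) = TAnd # toks \<phi> @ toks \<psi>"
| "toks (BoxA \<phi>) = TBoxA # toks \<phi>"
| "toks (BoxB \<phi>) = TBoxB # toks \<phi>"

fun is_dig :: "tok \<Rightarrow> bool" where
  "is_dig (TDig d) = True"
| "is_dig _ = False"

text \<open>Guards the end of an atom: the digits of its index extend up to the next token that is
  not a digit.\<close>

definition ndig :: "tok list \<Rightarrow> bool" where
  "ndig r \<longleftrightarrow> (r \<noteq> [] \<longrightarrow> \<not> is_dig (hd r))"

definition digits :: "tok list \<Rightarrow> tok list" where
  "digits W = takeWhile is_dig W"

lemma toks_not_Nil [simp]: "toks \<phi> \<noteq> []"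
  by (cases \<phi>) auto

lemma ndig_toks: "ndig (toks \<phi> @ r)"
  by (cases \<phi>) (auto simp: ndig_def)

primrec depth :: "fm \<Rightarrow> nat" where
  "depth (Atom n) = 0"
| "depth Bot = 0"
| "depth (Neg \<phi>) = depth \<phi>"
| "depth (And \<phi> \<psi>) = max (depth \<phi>) (depth \<psi>)"
| "depth (BoxA \<phi>) = Suc (depth \<phi>)"
| "depth (BoxB \<phi>) = Suc (depth \<phi>)"

lemma depth_less: "depth \<phi> < length (toks \<phi>)"
  by (induction \<phi>) auto

text \<open>Partial also inside the formula, because the digits of an atom are positions without a
  subformula.\<close>

primrec sub_at :: "fm \<Rightarrow> nat \<Rightarrow> fm option" where
  "sub_at Bot i = (if i = 0 then Some Bot else None)"
| "sub_at (Atom n) i = (if i = 0 then Some (Atom n) else None)"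
| "sub_at (Neg \<phi>) i = (case i of 0 \<Rightarrow> Some (Neg \<phi>) | Suc j \<Rightarrow> sub_at \<phi> j)"
| "sub_at (And \<phi> \<psi>) i = (case i of 0 \<Rightarrow> Some (And \<phi> \<psi>) | Suc j \<Rightarrow>
     if j < length (toks \<phi>) then sub_at \<phi> j else sub_at \<psi> (j - length (toks \<phi>)))"
| "sub_at (BoxA \<phi>) i = (case i of 0 \<Rightarrow> Some (BoxA \<phi>) | Suc j \<Rightarrow> sub_at \<phi> j)"
| "sub_at (BoxB \<phi>) i = (case i of 0 \<Rightarrow> Some (BoxB \<phi>) | Suc j \<Rightarrow> sub_at \<phi> j)"

lemma at_0 [simp]: "sub_at \<phi> 0 = Some \<phi>"
  by (cases \<phi>) auto

lemma at_len: "sub_at \<phi> i = Some \<psi> \<Longrightarrow> i + length (toks \<psi>) \<le> length (toks \<phi>)"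
  by (induction \<phi> arbitrary: i) (fastforce split: nat.splits if_splits)+

lemma at_less: "sub_at \<phi> i = Some \<psi> \<Longrightarrow> i < length (toks \<phi>)"
  using at_len[of \<phi> i \<psi>] toks_not_Nil[of \<psi>] by (cases "toks \<psi>") auto

lemma at_trans: "sub_at \<phi> i = Some \<psi> \<Longrightarrow> sub_at \<psi> j = Some \<chi> \<Longrightarrow> sub_at \<phi> (i + j) = Some \<chi>"
proof (induction \<phi> arbitrary: i)
  case (And \<phi>1 \<phi>2)
  show ?case
  proof (cases i)
    case 0
    then show ?thesis using And.prems by simp
  next
    case (Suc k)
    show ?thesis
    proof (cases "k < length (toks \<phi>1)")
      case True
      then have "sub_at \<phi>1 (k + j) = Some \<chi>" using And Suc by simp
      then show ?thesis using Suc at_less[of \<phi>1 "k + j"] by simp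
    next
      case False
      then have "sub_at \<phi>2 (k - length (toks \<phi>1) + j) = Some \<chi>"
        using And.prems Suc by (intro And.IH(2)) auto
      moreover have "k - length (toks \<phi>1) + j = k + j - length (toks \<phi>1)" using False by simp
      ultimately have "sub_at \<phi>2 (k + j - length (toks \<phi>1)) = Some \<chi>" by metis
      then show ?thesis using Suc False by simp
    qed
  qed
qed (auto split: nat.splits if_splits)

lemma at_toks: "sub_at \<phi> i = Some \<psi> \<Longrightarrow> \<exists>r. drop i (toks \<phi>) = toks \<psi> @ r \<and> ndig r"
proof (induction \<phi> arbitrary: i)
  case (And \<phi>1 \<phi>2)
  show ?case
  proof (cases i)
    case 0
    then show ?thesis using And.prems by (auto simp: ndig_def)
  next
    case (Suc k)
    show ?thesis
    proof (cases "k < length (toks \<phi>1)")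
      case True
      then obtain r where "drop k (toks \<phi>1) = toks \<psi> @ r" "ndig r" using And Suc by fastforce
      moreover have "ndig (r @ toks \<phi>2)"
        using \<open>ndig r\<close> ndig_toks[of \<phi>2 "[]"] by (cases r) (auto simp: ndig_def)
      ultimately show ?thesis using Suc True by auto
    next
      case False
      then show ?thesis using And Suc by simp
    qed
  qed
qed (auto simp: ndig_def split: nat.splits if_splits)

lemma at_exists: "i < length (toks \<phi>) \<Longrightarrow> \<not> is_dig (toks \<phi> ! i) \<Longrightarrow> \<exists>\<psi>. sub_at \<phi> i = Some \<psi>"
  by (induction \<phi> arbitrary: i) (auto simp: nth_append nth_Cons split: nat.splits)

lemma at_nth: "sub_at \<phi> i = Some \<psi> \<Longrightarrow> toks \<phi> ! i = hd (toks \<psi>)"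
  using at_toks[of \<phi> i \<psi>] at_less[of \<phi> i \<psi>]
  by (metis hd_append2 hd_drop_conv_nth toks_not_Nil)

lemma at_box:
  assumes "i < length (toks \<phi>)"
  shows "toks \<phi> ! i = TBoxA \<longleftrightarrow> (\<exists>\<psi>. sub_at \<phi> i = Some (BoxA \<psi>))"
    "toks \<phi> ! i = TBoxB \<longleftrightarrow> (\<exists>\<psi>. sub_at \<phi> i = Some (BoxB \<psi>))"
    "toks \<phi> ! i = TAtom \<longleftrightarrow> (\<exists>n. sub_at \<phi> i = Some (Atom n))"
proof -
  have *: "(\<exists>\<psi>. sub_at \<phi> i = Some \<psi> \<and> hd (toks \<psi>) = X) \<longleftrightarrow> toks \<phi> ! i = X" if "\<not> is_dig X" for X
    using at_exists[OF assms] at_nth that by metis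
  have "hd (toks \<psi>) = TBoxA \<longleftrightarrow> (\<exists>\<chi>. \<psi> = BoxA \<chi>)" "hd (toks \<psi>) = TBoxB \<longleftrightarrow> (\<exists>\<chi>. \<psi> = BoxB \<chi>)"
    "hd (toks \<psi>) = TAtom \<longleftrightarrow> (\<exists>n. \<psi> = Atom n)" for \<psi>
    by (cases \<psi>; simp)+
  then show "toks \<phi> ! i = TBoxA \<longleftrightarrow> (\<exists>\<psi>. sub_at \<phi> i = Some (BoxA \<psi>))"
    "toks \<phi> ! i = TBoxB \<longleftrightarrow> (\<exists>\<psi>. sub_at \<phi> i = Some (BoxB \<psi>))"
    "toks \<phi> ! i = TAtom \<longleftrightarrow> (\<exists>n. sub_at \<phi> i = Some (Atom n))"
    using *[of TBoxA] *[of TBoxB] *[of TAtom] by auto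
qed

lemma at_digits:
  assumes "sub_at \<phi> i = Some (Atom n)"
  shows "digits (drop (Suc i) (toks \<phi>)) = map TDig (bin n)"
proof -
  obtain r where r: "drop i (toks \<phi>) = toks (Atom n) @ r" "ndig r" using at_toks[OF assms] by blast
  have "drop (Suc i) (toks \<phi>) = tl (drop i (toks \<phi>))" by (simp add: drop_Suc tl_drop)
  then have "drop (Suc i) (toks \<phi>) = map TDig (bin n) @ r" by (simp add: r)
  moreover have "takeWhile is_dig (map TDig (bin n) @ r) = map TDig (bin n)"
    using r(2) by (cases r) (auto simp: takeWhile_append ndig_def)
  ultimately show ?thesis by (simp add: digits_def)
qed

lemma map_TDig_inj: "map TDig (bin m) = map TDig (bin n) \<longleftrightarrow> m = n"
proof
  assume "map TDig (bin m) = map TDig (bin n)"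
  then have "bin m = bin n" by (simp add: inj_on_def inj_map_eq_map)
  then show "m = n" by (rule bin_inj)
qed simp

text \<open>
  A type assigns a truth value to every position of \<open>toks \<phi>\<close> (the values at digits are irrelevant).
  \<open>pcons\<close> is its consistency with respect to the propositional connectives.
\<close>

primrec pcons :: "fm \<Rightarrow> bool list \<Rightarrow> bool" where
  "pcons Bot S \<longleftrightarrow> \<not> hd S"
| "pcons (Atom n) S \<longleftrightarrow> True"
| "pcons (Neg \<phi>) S \<longleftrightarrow> hd S \<noteq> hd (tl S) \<and> pcons \<phi> (tl S)"
| "pcons (And \<phi> \<psi>) S \<longleftrightarrow> hd S = (hd (tl S) \<and> hd (drop (length (toks \<phi>)) (tl S)))
     \<and> pcons \<phi> (tl S) \<and> pcons \<psi> (drop (length (toks \<phi>)) (tl S))"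
| "pcons (BoxA \<phi>) S \<longleftrightarrow> pcons \<phi> (tl S)"
| "pcons (BoxB \<phi>) S \<longleftrightarrow> pcons \<phi> (tl S)"

lemma pcons_at: "pcons \<phi> S \<Longrightarrow> sub_at \<phi> i = Some \<psi> \<Longrightarrow> pcons \<psi> (drop i S)"
proof (induction \<phi> arbitrary: S i)
  case (And \<phi>1 \<phi>2)
  show ?case
  proof (cases i)
    case 0
    then show ?thesis using And.prems by auto
  next
    case (Suc k)
    show ?thesis
    proof (cases "k < length (toks \<phi>1)")
      case True
      then show ?thesis using And Suc by (simp add: drop_Suc)
    next
      case False
      then have "pcons \<psi> (drop (k - length (toks \<phi>1)) (drop (length (toks \<phi>1)) (tl S)))"
        using And.prems Suc by (intro And.IH(2)) auto
      then show ?thesis using Suc False by (simp add: drop_Suc)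
    qed
  qed
qed (auto simp: drop_Suc split: nat.splits if_splits)

text \<open>The argument of a box at \<open>i\<close> starts at \<open>i + 1\<close>. Positions
  beyond the end of \<open>S\<close> impose nothing, so \<open>[]\<close> in the place of
  \<open>S\<close> satisfies every condition; it serves as the open end of chains.\<close>

definition bsub :: "tok \<Rightarrow> tok list \<Rightarrow> bool list \<Rightarrow> bool list \<Rightarrow> bool" where
  "bsub X W S M \<longleftrightarrow> (\<forall>i<length W. W ! i = X \<longrightarrow> i < length S \<longrightarrow> S ! i \<longrightarrow> Suc i < length M \<and> M ! Suc i)"

definition hdF :: "bool list \<Rightarrow> bool" where
  "hdF xs \<longleftrightarrow> xs \<noteq> [] \<and> hd xs"

text \<open>
  The challenger marks positions in \<open>D\<close>.  If the first mark is at a box which \<open>S\<close> makes false, the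
  defender has to continue with an \<open>A\<close> that refutes the argument of the box; if the first two marks
  are at occurrences of the same atom with different truth values, the defender loses; otherwise the
  challenge is void.
\<close>

fun ascan :: "bool \<Rightarrow> tok list \<Rightarrow> tok list \<Rightarrow> bool list \<Rightarrow> bool list \<Rightarrow> bool" where
  "ascan s P [] S D = False"
| "ascan s P (t # W) S D = (if hdF D then t = TAtom \<and> hdF S \<noteq> s \<and> digits P = digits W
     else ascan s P W (tl S) (tl D))"

fun dscan :: "tok list \<Rightarrow> bool list \<Rightarrow> bool list \<Rightarrow> bool list \<Rightarrow> tok option \<times> bool" where
  "dscan [] S D A = (None, False)"
| "dscan (t # W) S D A = (if hdF D then
       (if t = TBoxA \<or> t = TBoxB then (if hdF S then (None, False) else (Some t, hdF (tl A)))
        else (None, t = TAtom \<and> ascan (hdF S) W W (tl S) (tl D)))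
     else dscan W (tl S) (tl D) (tl A))"

lemma ascan_drop:
  assumes "length S = length W" "length D = length W"
  shows "ascan s P W S D \<longleftrightarrow> (\<exists>j<length W. D ! j \<and> (\<forall>i<j. \<not> D ! i) \<and> W ! j = TAtom \<and> S ! j \<noteq> s
    \<and> digits P = digits (drop (Suc j) W))"
  using assms
proof (induction W arbitrary: S D)
  case (Cons t W)
  obtain s' S' d D' where e: "S = s' # S'" "D = d # D'"
    using Cons.prems by (metis length_Suc_conv)
  show ?case
  proof (cases d)
    case True
    then show ?thesis by (auto simp: e hdF_def nth_Cons' intro!: exI[of _ 0])
  next
    case False
    have "(\<exists>j<length (t # W). D ! j \<and> (\<forall>i<j. \<not> D ! i) \<and> (t # W) ! j = TAtom \<and> S ! j \<noteq> s
        \<and> digits P = digits (drop (Suc j) (t # W)))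
      \<longleftrightarrow> (\<exists>j<length W. D' ! j \<and> (\<forall>i<j. \<not> D' ! i) \<and> W ! j = TAtom \<and> S' ! j \<noteq> s
        \<and> digits P = digits (drop (Suc j) W))" 
    proof -
      have f: "(\<forall>i<Suc j. \<not> (d # D') ! i) \<longleftrightarrow> (\<forall>i<j. \<not> D' ! i)" for j
        using False by (simp only: All_less_Suc2 nth_Cons_0 nth_Cons_Suc simp_thms)
      show ?thesis
        unfolding e length_Cons Ex_less_Suc2 f using False by simp
    qed
    then show ?thesis using Cons False by (simp add: e hdF_def)
  qed
qed simp

text \<open>The first mark decides between a demand raised by a false box, a comparison of two
  atoms, and a void challenge. Only in the first case does the outcome depend on the answer
  \<open>A\<close>.\<close>

lemma dscan_cases:
  assumes "length S = length W" "length D = length W"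
  shows "(\<exists>i<length W. D ! i \<and> (\<forall>j<i. \<not> D ! j) \<and> (W ! i = TBoxA \<or> W ! i = TBoxB) \<and> \<not> S ! i \<and>
        (\<forall>A. length A = length W \<longrightarrow> dscan W S D A = (Some (W ! i), Suc i < length A \<and> A ! Suc i)))
    \<or> (\<exists>i<length W. D ! i \<and> (\<forall>j<i. \<not> D ! j) \<and> W ! i = TAtom \<and>
        (\<forall>A. dscan W S D A = (None, ascan (S ! i) (drop (Suc i) W) (drop (Suc i) W) (drop (Suc i) S) (drop (Suc i) D))))
    \<or> ((\<forall>A. dscan W S D A = (None, False)) \<and>
        (\<forall>i<length W. D ! i \<longrightarrow> (\<forall>j<i. \<not> D ! j) \<longrightarrow> W ! i \<noteq> TAtom \<and> (W ! i = TBoxA \<or> W ! i = TBoxB \<longrightarrow> S ! i)))"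
  (is "?A W S D \<or> ?B W S D \<or> ?C W S D")
  using assms
proof (induction W arbitrary: S D)
  case (Cons t W)
  obtain s S' d D' where e: "S = s # S'" "D = d # D'"
    using Cons.prems by (metis length_Suc_conv)
  show ?case
  proof (cases d)
    case True
    have hA: "hdF (tl A) = (Suc 0 < length A \<and> A ! Suc 0)" for A
      by (cases A; cases "tl A") (auto simp: hdF_def)
    consider "t = TBoxA \<or> t = TBoxB" "\<not> s" | "t = TAtom" | "t \<noteq> TAtom" "t = TBoxA \<or> t = TBoxB \<longrightarrow> s" by blast
    then show ?thesis
    proof cases
      case 1
      then have "?A (t # W) S D" using True
        by (intro exI[of _ 0]) (auto simp: e hdF_def[of "_ # _"] hA)
      then show ?thesis by blast
    next
      case 2
      then have "?B (t # W) S D" using True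
        by (intro exI[of _ 0]) (auto simp: e hdF_def[of "_ # _"])
      then show ?thesis by blast
    next
      case 3
      then have "?C (t # W) S D" using True
        by (auto simp: e hdF_def[of "_ # _"] less_Suc_eq_0_disj)
      then show ?thesis by blast
    qed
  next
    case False
    have st: "dscan (t # W) S D A = dscan W S' D' (tl A)" for A using False by (simp add: e hdF_def)
    have f: "(\<forall>j<Suc i. \<not> (d # D') ! j) \<longleftrightarrow> (\<forall>j<i. \<not> D' ! j)" for i
      using False by (auto simp: less_Suc_eq_0_disj)
    have IH: "?A W S' D' \<or> ?B W S' D' \<or> ?C W S' D'" by (rule Cons.IH) (use Cons.prems e in auto)
    then consider (A) "?A W S' D'" | (B) "?B W S' D'" | (C) "?C W S' D'" by blast
    then show ?thesis
    proof cases
      case A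
      then obtain i where i: "i < length W" "D' ! i" "\<forall>j<i. \<not> D' ! j" "W ! i = TBoxA \<or> W ! i = TBoxB" "\<not> S' ! i"
        "\<forall>A. length A = length W \<longrightarrow> dscan W S' D' A = (Some (W ! i), Suc i < length A \<and> A ! Suc i)" by blast
      have "?A (t # W) S D"
      proof (intro exI[of _ "Suc i"] conjI allI impI)
        fix A :: "bool list" assume "length A = length (t # W)"
        then obtain a A' where "A = a # A'" "length A' = length W" by (metis length_Suc_conv length_Cons)
        then show "dscan (t # W) S D A = (Some ((t # W) ! Suc i), Suc (Suc i) < length A \<and> A ! Suc (Suc i))"
          using i(6) unfolding st by simp
      qed (use i False in \<open>auto simp: e less_Suc_eq_0_disj\<close>)
      then show ?thesis by blast
    next
      case B
      then obtain i where i: "i < length W" "D' ! i" "\<forall>j<i. \<not> D' ! j" "W ! i = TAtom"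
        "\<forall>A. dscan W S' D' A = (None, ascan (S' ! i) (drop (Suc i) W) (drop (Suc i) W) (drop (Suc i) S') (drop (Suc i) D'))" by blast
      have "?B (t # W) S D"
        by (intro exI[of _ "Suc i"] conjI allI impI)
          (use i False in \<open>auto simp: e less_Suc_eq_0_disj hdF_def\<close>)
      then show ?thesis by blast
    next
      case C
      have "?C (t # W) S D"
      proof (intro conjI allI impI)
        fix A show "dscan (t # W) S D A = (None, False)" unfolding st using C by simp
      next
        fix i assume i: "i < length (t # W)" "D ! i" "\<forall>j<i. \<not> D ! j"
        obtain l where l: "i = Suc l" using i(2) False by (cases i) (auto simp: e)
        then have "l < length W" "D' ! l" "\<forall>j<l. \<not> D' ! j" using i by (auto simp: e)
        then have "W ! l \<noteq> TAtom \<and> (W ! l = TBoxA \<or> W ! l = TBoxB \<longrightarrow> S' ! l)" using C by blast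
        then show "(t # W) ! i \<noteq> TAtom" "(t # W) ! i = TBoxA \<or> (t # W) ! i = TBoxB \<Longrightarrow> S ! i"
          by (auto simp: l e)
      qed
      then show ?thesis by blast
    qed
  qed
qed simp

text \<open>
  For a \<open>\<box>\<^sub>a\<close>-demand the defender claims a chain \<open>A = T\<^sub>0, T\<^sub>1, \<dots>\<close> of \<open>2 ^ j\<close> types in which every type
  is an \<open>R\<^sub>b\<close>-successor of the next one, and proves it by repeated halving: he names the middle
  type, the challenger chooses a half.  For a \<open>\<box>\<^sub>b\<close>-demand the same game is played without
  the condition on neighbours, which makes the chain irrelevant.
\<close>

primrec halving :: "nat \<Rightarrow> tok \<Rightarrow> tok list \<Rightarrow> bool list \<Rightarrow> (bool list \<Rightarrow> bool) \<Rightarrow> nat \<Rightarrow> bool list \<Rightarrow> bool list \<Rightarrow> bool" where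
  "halving N X W S P 0 A B \<longleftrightarrow> bsub X W S A \<and> (X = TBoxA \<longrightarrow> bsub TBoxB W B A) \<and> P A"
| "halving N X W S P (Suc j) A B \<longleftrightarrow>
     (\<exists>M. length M = N \<and> halving N X W S P j M B \<and> halving N X W S P j A M)"

text \<open>The index counts the modal levels still to be played and drops by one with each demand.
  \<open>Suc N\<close> halvings claim a chain of \<open>2 ^ (N + 1)\<close> types, more than the
  \<open>2 ^ N\<close> that exist.\<close>

primrec win :: "fm \<Rightarrow> nat \<Rightarrow> bool list \<Rightarrow> bool" where
  "win \<phi> 0 S \<longleftrightarrow> True"
| "win \<phi> (Suc k) S \<longleftrightarrow> pcons \<phi> S \<and> (let W = toks \<phi>; N = length W in
     \<forall>D. length D = N \<longrightarrow> (\<exists>A. length A = N \<and> \<not> snd (dscan W S D A) \<and>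
       (case fst (dscan W S D A) of None \<Rightarrow> True | Some X \<Rightarrow> halving N X W S (win \<phi> k) (Suc N) A [])))"

subsection \<open>The types of a model win\<close>

primrec ty :: "('w \<times> 'w) set \<Rightarrow> ('w \<times> 'w) set \<Rightarrow> (nat \<Rightarrow> 'w set) \<Rightarrow> 'w \<Rightarrow> fm \<Rightarrow> bool list" where
  "ty Ra Rb V s Bot = [False]"
| "ty Ra Rb V s (Atom n) = (s \<in> V n) # replicate (length (bin n)) False"
| "ty Ra Rb V s (Neg \<phi>) = sat Ra Rb V s (Neg \<phi>) # ty Ra Rb V s \<phi>"
| "ty Ra Rb V s (And \<phi> \<psi>) = sat Ra Rb V s (And \<phi> \<psi>) # ty Ra Rb V s \<phi> @ ty Ra Rb V s \<psi>"
| "ty Ra Rb V s (BoxA \<phi>) = sat Ra Rb V s (BoxA \<phi>) # ty Ra Rb V s \<phi>"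
| "ty Ra Rb V s (BoxB \<phi>) = sat Ra Rb V s (BoxB \<phi>) # ty Ra Rb V s \<phi>"

lemma length_ty [simp]: "length (ty Ra Rb V s \<phi>) = length (toks \<phi>)"
  by (induction \<phi>) auto

lemma hd_ty: "hd (ty Ra Rb V s \<phi> @ r) = sat Ra Rb V s \<phi>"
  by (cases \<phi>) auto

lemma ty_at: "sub_at \<phi> i = Some \<psi> \<Longrightarrow> ty Ra Rb V s \<phi> ! i = sat Ra Rb V s \<psi>"
  by (induction \<phi> arbitrary: i) (auto simp: nth_append split: nat.splits if_splits)

lemma pcons_ty: "pcons \<phi> (ty Ra Rb V s \<phi> @ r)"
  by (induction \<phi> arbitrary: r) (auto simp: hd_ty)

text \<open>Both ends have to be treated together: a chain with open end \<open>[]\<close> splits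
  into a first half ending in the named middle type and a second half that is open again.\<close>

lemma halving_seq:
  assumes "\<And>n. length (T n) = N" "\<And>n. bsub X W S (T n)" "\<And>n. P (T n)"
    and "\<And>n. X = TBoxA \<Longrightarrow> bsub TBoxB W (T (Suc n)) (T n)"
  shows "halving N X W S P j (T n) (T (n + 2 ^ j)) \<and> halving N X W S P j (T n) []"
proof (induction j arbitrary: n)
  case 0
  show ?case using assms by (simp add: bsub_def)
next
  case (Suc j)
  have e: "T (n + 2 ^ Suc j) = T (n + 2 ^ j + 2 ^ j)" by (simp add: mult_2 add.assoc)
  show ?case
    unfolding halving.simps e using Suc[of n] Suc[of "n + 2 ^ j"] assms(1) by blast
qed

lemma win_ty:
  assumes wd: "weakly_dense Ra Rb"
  shows "win \<phi> k (ty Ra Rb V s \<phi>)"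
proof (induction k arbitrary: s)
  case (Suc k)
  let ?W = "toks \<phi>"
  let ?N = "length ?W"
  let ?T = "\<lambda>s. ty Ra Rb V s \<phi>"
  have subA: "bsub TBoxA ?W (?T s) (?T t)" if "(s, t) \<in> Ra" for s t
    unfolding bsub_def
  proof (intro allI impI)
    fix i assume i: "i < ?N" "?W ! i = TBoxA" "?T s ! i"
    then obtain \<psi> where \<psi>: "sub_at \<phi> i = Some (BoxA \<psi>)" using at_box(1) by blast
    have n: "sub_at \<phi> (i + 1) = Some \<psi>" by (rule at_trans[OF \<psi>]) simp
    show "Suc i < length (?T t) \<and> ?T t ! Suc i"
      using ty_at[OF \<psi>, of Ra Rb V s] ty_at[OF n, of Ra Rb V t] at_less[OF n] i that by simp
  qed
  have subB: "bsub TBoxB ?W (?T s) (?T t)" if "(s, t) \<in> Rb" for s t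
    unfolding bsub_def
  proof (intro allI impI)
    fix i assume i: "i < ?N" "?W ! i = TBoxB" "?T s ! i"
    then obtain \<psi> where \<psi>: "sub_at \<phi> i = Some (BoxB \<psi>)" using at_box(2) by blast
    have n: "sub_at \<phi> (i + 1) = Some \<psi>" by (rule at_trans[OF \<psi>]) simp
    show "Suc i < length (?T t) \<and> ?T t ! Suc i"
      using ty_at[OF \<psi>, of Ra Rb V s] ty_at[OF n, of Ra Rb V t] at_less[OF n] i that by simp
  qed
  have "\<exists>A. length A = ?N \<and> \<not> snd (dscan ?W (?T s) D A) \<and>
       (case fst (dscan ?W (?T s) D A) of None \<Rightarrow> True
        | Some X \<Rightarrow> halving ?N X ?W (?T s) (win \<phi> k) (Suc ?N) A [])" if D: "length D = ?N" for D
    using dscan_cases[of "?T s" ?W D, OF length_ty D]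
  proof (elim disjE)
    assume "\<exists>i<?N. D ! i \<and> (\<forall>j<i. \<not> D ! j) \<and> (?W ! i = TBoxA \<or> ?W ! i = TBoxB) \<and> \<not> ?T s ! i \<and>
        (\<forall>A. length A = ?N \<longrightarrow> dscan ?W (?T s) D A = (Some (?W ! i), Suc i < length A \<and> A ! Suc i))"
    then obtain i where i: "i < ?N" "?W ! i = TBoxA \<or> ?W ! i = TBoxB" "\<not> ?T s ! i"
      and d: "\<And>A. length A = ?N \<Longrightarrow> dscan ?W (?T s) D A = (Some (?W ! i), Suc i < length A \<and> A ! Suc i)" by blast
    show ?thesis
    proof (cases "?W ! i = TBoxA")
      case True
      then obtain \<psi> where \<psi>: "sub_at \<phi> i = Some (BoxA \<psi>)" using at_box(1)[OF i(1)] by blast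
      have n: "sub_at \<phi> (i + 1) = Some \<psi>" by (rule at_trans[OF \<psi>]) simp
      obtain t where t: "(s, t) \<in> Ra" "\<not> sat Ra Rb V t \<psi>"
        using i(3) ty_at[OF \<psi>, of Ra Rb V s] by auto
      obtain u where u: "u 0 = t" "\<And>n. (s, u n) \<in> Ra" "\<And>n. (u (Suc n), u n) \<in> Rb"
        using dependent_chain[of "\<lambda>x. (s, x) \<in> Ra" t "\<lambda>y x. (y, x) \<in> Rb"] t(1) wd
        unfolding weakly_dense_def by metis
      have "halving ?N TBoxA ?W (?T s) (win \<phi> k) (Suc ?N) (?T (u 0)) []"
        using halving_seq[of "\<lambda>n. ?T (u n)" ?N TBoxA ?W "?T s" "win \<phi> k" "Suc ?N" 0]
          subA[OF u(2)] subB[OF u(3)] Suc by simp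
      then show ?thesis
        using d[of "?T t"] True ty_at[OF n, of Ra Rb V t] t(2) u(1)
        by (intro exI[of _ "?T t"]) (simp del: halving.simps)
    next
      case False
      then have B: "?W ! i = TBoxB" using i(2) by blast
      then obtain \<psi> where \<psi>: "sub_at \<phi> i = Some (BoxB \<psi>)" using at_box(2)[OF i(1)] by blast
      have n: "sub_at \<phi> (i + 1) = Some \<psi>" by (rule at_trans[OF \<psi>]) simp
      obtain t where t: "(s, t) \<in> Rb" "\<not> sat Ra Rb V t \<psi>"
        using i(3) ty_at[OF \<psi>, of Ra Rb V s] by auto
      \<comment> \<open>For \<open>TBoxB\<close> neighbours are not compared, so the constant
        sequence will do.\<close>
      have "halving ?N TBoxB ?W (?T s) (win \<phi> k) (Suc ?N) (?T t) []"
        using halving_seq[of "\<lambda>n. ?T t" ?N TBoxB ?W "?T s" "win \<phi> k" "Suc ?N" 0]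
          subB[OF t(1)] Suc by simp
      then show ?thesis
        using d[of "?T t"] B ty_at[OF n, of Ra Rb V t] t(2)
        by (intro exI[of _ "?T t"]) (simp del: halving.simps)
    qed
  next
    assume "\<exists>i<?N. D ! i \<and> (\<forall>j<i. \<not> D ! j) \<and> ?W ! i = TAtom \<and>
        (\<forall>A. dscan ?W (?T s) D A = (None, ascan (?T s ! i) (drop (Suc i) ?W) (drop (Suc i) ?W) (drop (Suc i) (?T s)) (drop (Suc i) D)))"
    then obtain i where i: "i < ?N" "?W ! i = TAtom" and
      d: "\<And>A. dscan ?W (?T s) D A = (None, ascan (?T s ! i) (drop (Suc i) ?W) (drop (Suc i) ?W) (drop (Suc i) (?T s)) (drop (Suc i) D))"
      by blast
    \<comment> \<open>Two atom positions with equal digit runs are occurrences of the same atom,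
      which has only one truth value at \<open>s\<close>.\<close>
    have "\<not> ascan (?T s ! i) (drop (Suc i) ?W) (drop (Suc i) ?W) (drop (Suc i) (?T s)) (drop (Suc i) D)"
    proof
      assume "ascan (?T s ! i) (drop (Suc i) ?W) (drop (Suc i) ?W) (drop (Suc i) (?T s)) (drop (Suc i) D)"
      then obtain j where j: "j < ?N - Suc i" "drop (Suc i) ?W ! j = TAtom" "drop (Suc i) (?T s) ! j \<noteq> ?T s ! i"
        "digits (drop (Suc i) ?W) = digits (drop (Suc j) (drop (Suc i) ?W))"
        by (subst (asm) ascan_drop) (simp add: D, simp add: D, force)
      define l where "l = Suc i + j"
      have l: "l < ?N" "?W ! l = TAtom" "?T s ! l \<noteq> ?T s ! i" "digits (drop (Suc i) ?W) = digits (drop (Suc l) ?W)"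
        using j by (auto simp: l_def add.commute)
      obtain m n where "sub_at \<phi> i = Some (Atom m)" "sub_at \<phi> l = Some (Atom n)"
        using at_box(3)[OF i(1)] at_box(3)[OF l(1)] i(2) l(2) by blast
      then have "sub_at \<phi> i = Some (Atom m)" "sub_at \<phi> l = Some (Atom m)"
        using l(4) at_digits[of \<phi> i m] at_digits[of \<phi> l n] map_TDig_inj by simp_all
      then show False using l(3) ty_at by metis
    qed
    then show ?thesis using d length_ty by (intro exI[of _ "?T s"]) simp
  next
    assume "(\<forall>A. dscan ?W (?T s) D A = (None, False)) \<and> 
      (\<forall>i<?N. D ! i \<longrightarrow> (\<forall>j<i. \<not> D ! j) \<longrightarrow> ?W ! i \<noteq> TAtom \<and> (?W ! i = TBoxA \<or> ?W ! i = TBoxB \<longrightarrow> ?T s ! i))"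
    then show ?thesis using length_ty by (intro exI[of _ "?T s"]) simp
  qed
  moreover have "pcons \<phi> (?T s)" using pcons_ty[of \<phi> Ra Rb V s "[]"] by simp
  ultimately show ?case by (simp add: Let_def del: halving.simps)
qed simp

subsection \<open>A winning strategy yields a model\<close>

lemma halving_first: "halving N X W S P j A B \<Longrightarrow> bsub X W S A \<and> P A"
  by (induction j arbitrary: B) auto

lemma halving_chain:
  assumes "halving N X W S P j A B" "length A = N"
  shows "\<exists>f. f 0 = A \<and> f (2 ^ j) = B \<and> (\<forall>i<2 ^ j. length (f i) = N \<and> bsub X W S (f i) \<and> P (f i) \<and>
    (X = TBoxA \<longrightarrow> bsub TBoxB W (f (Suc i)) (f i)))"
  using assms
proof (induction j arbitrary: A B)
  case 0
  then show ?case by (intro exI[of _ "\<lambda>i. if i = 0 then A else B"]) auto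
next
  case (Suc j)
  then obtain M where M: "length M = N" "halving N X W S P j A M" "halving N X W S P j M B" by auto
  let ?ok = "\<lambda>f i. length (f i) = N \<and> bsub X W S (f i) \<and> P (f i) \<and> (X = TBoxA \<longrightarrow> bsub TBoxB W (f (Suc i)) (f i))"
  obtain f where f: "f 0 = A" "f (2 ^ j) = M" "\<And>i. i < 2 ^ j \<Longrightarrow> ?ok f i"
    using Suc.IH[OF M(2) Suc.prems(2)] by blast
  obtain g where g: "g 0 = M" "g (2 ^ j) = B" "\<And>i. i < 2 ^ j \<Longrightarrow> ?ok g i"
    using Suc.IH[OF M(3) M(1)] by blast
  define h where "h i = (if i < 2 ^ j then f i else g (i - 2 ^ j))" for i
  have "?ok h i" if "i < 2 ^ Suc j" for i
  proof (cases "i < 2 ^ j")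
    case True
    have "h (Suc i) = f (Suc i)"
    proof (cases "Suc i < 2 ^ j")
      case False
      then have "Suc i = 2 ^ j" using True by simp
      then show ?thesis using f(2) g(1) by (simp add: h_def)
    qed (simp add: h_def)
    then show ?thesis using f(3)[OF True] True by (simp add: h_def)
  next
    case False
    then have "i - 2 ^ j < 2 ^ j" "Suc i - 2 ^ j = Suc (i - 2 ^ j)" using that by auto
    then show ?thesis using g(3)[of "i - 2 ^ j"] False by (simp add: h_def)
  qed
  moreover have "h 0 = A" "h (2 ^ Suc j) = B" using f(1) g(2) by (simp_all add: h_def)
  ultimately show ?case by blast
qed

text \<open>By the pigeonhole principle a chain of \<open>2 ^ Suc N\<close> types of length
  \<open>N\<close> repeats one. Its part before the repetition is a finite set closed under the
  neighbours that weak density asks for, and takes the place of an infinite chain.\<close>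

lemma halving_loop:
  assumes "halving N TBoxA W S P (Suc N) A B" "length A = N"
  shows "\<exists>C. A \<in> C \<and> (\<forall>T\<in>C. length T = N \<and> bsub TBoxA W S T \<and> P T \<and> (\<exists>T'\<in>C. bsub TBoxB W T' T))"
proof -
  obtain f where f: "f 0 = A" "\<And>i. i < 2 ^ Suc N \<Longrightarrow> length (f i) = N \<and> bsub TBoxA W S (f i) \<and> P (f i) \<and>
    bsub TBoxB W (f (Suc i)) (f i)"
    using halving_chain[OF assms] by auto
  let ?L = "{xs :: bool list. set xs \<subseteq> UNIV \<and> length xs = N}"
  have "f ` {..<2 ^ Suc N} \<subseteq> ?L" using f(2) by auto
  then have "card (f ` {..<2 ^ Suc N}) \<le> card ?L"
    by (intro card_mono finite_lists_length_eq) auto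
  also have "\<dots> = 2 ^ N" by (subst card_lists_length_eq) auto
  also have "\<dots> < card {..<2 ^ Suc N :: nat}" by simp
  finally have "\<not> inj_on f {..<2 ^ Suc N}" by (rule pigeonhole)
  then obtain a b where "a < 2 ^ Suc N" "b < 2 ^ Suc N" "f a = f b" "a \<noteq> b" by (auto simp: inj_on_def)
  then obtain i j where ij: "i < j" "j < 2 ^ Suc N" "f i = f j" by (metis linorder_neqE_nat)
  \<comment> \<open>The last type before the repetition \<open>f j = f i\<close> gets
    \<open>f i\<close> as its neighbour.\<close>
  have "\<exists>T'\<in>f ` {..<j}. bsub TBoxB W T' (f m)" if "m < j" for m
  proof (cases "Suc m < j")
    case True
    then show ?thesis using f(2)[of m] ij(2) that by auto
  next
    case False
    then have "Suc m = j" using that by simp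
    then have "bsub TBoxB W (f i) (f m)" using f(2)[of m] ij by simp
    then show ?thesis using ij(1) by blast
  qed
  then show ?thesis using f ij
    by (intro exI[of _ "f ` {..<j}"]) (auto intro!: image_eqI[of _ _ 0])
qed

text \<open>A single mark at the box raises its demand.\<close>

lemma challenge_box:
  assumes "i < length W" "length S = length W" "W ! i = TBoxA \<or> W ! i = TBoxB" "\<not> S ! i"
  shows "\<exists>D. length D = length W \<and> (\<forall>A. length A = length W \<longrightarrow>
    dscan W S D A = (Some (W ! i), Suc i < length A \<and> A ! Suc i))"
proof -
  define D where "D = (replicate (length W) False)[i := True]"
  have len: "length D = length W" by (simp add: D_def)
  have D: "D ! j \<longleftrightarrow> j = i" if "j < length W" for j
    using that assms(1) by (simp add: D_def nth_list_update)
  have u: "j = i" if "j < length W" "D ! j" for j using D that by blast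
  have t: "D ! i" "\<forall>j<i. \<not> D ! j" using D assms(1) by auto
  consider (A) i' where "i' < length W" "D ! i'"
      "\<forall>A. length A = length W \<longrightarrow> dscan W S D A = (Some (W ! i'), Suc i' < length A \<and> A ! Suc i')"
    | (B) i' where "i' < length W" "D ! i'" "W ! i' = TAtom"
    | (C) "\<forall>i<length W. D ! i \<longrightarrow> (\<forall>j<i. \<not> D ! j) \<longrightarrow> W ! i \<noteq> TAtom \<and> (W ! i = TBoxA \<or> W ! i = TBoxB \<longrightarrow> S ! i)"
    using dscan_cases[OF assms(2) len] by blast
  then show ?thesis
  proof cases
    case A
    then show ?thesis using u[of i'] len by blast
  next
    case B
    then show ?thesis using u[of i'] assms(3) by auto
  next
    case C
    then show ?thesis using t assms by blast
  qed
qed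

text \<open>With marks at both occurrences every answer loses. A winning type therefore gives the
  same value to all occurrences of an atom.\<close>

lemma challenge_atoms:
  assumes "i < l" "l < length W" "length S = length W" "W ! i = TAtom" "W ! l = TAtom" "S ! i \<noteq> S ! l"
    and "digits (drop (Suc i) W) = digits (drop (Suc l) W)"
  shows "\<exists>D. length D = length W \<and> (\<forall>A. snd (dscan W S D A))"
proof -
  define D where "D = (replicate (length W) False)[i := True, l := True]"
  have len: "length D = length W" by (simp add: D_def)
  have D: "D ! j \<longleftrightarrow> j = i \<or> j = l" if "j < length W" for j
    using that assms(1,2) by (auto simp: D_def nth_list_update)
  have u: "j = i" if "j < length W" "D ! j" "\<forall>k<j. \<not> D ! k" for j
    using D that assms(1,2) by (metis order.strict_trans)
  have t: "D ! i" "\<forall>j<i. \<not> D ! j" using D assms(1,2) by auto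
  have "ascan (S ! i) (drop (Suc i) W) (drop (Suc i) W) (drop (Suc i) S) (drop (Suc i) D)"
  proof (subst ascan_drop)
    have "Suc i + (l - Suc i) = l" using assms(1) by simp
    then show "\<exists>j<length (drop (Suc i) W). drop (Suc i) D ! j \<and> (\<forall>ia<j. \<not> drop (Suc i) D ! ia) \<and>
        drop (Suc i) W ! j = TAtom \<and> drop (Suc i) S ! j \<noteq> S ! i \<and>
        digits (drop (Suc i) W) = digits (drop (Suc j) (drop (Suc i) W))"
      using assms D len by (intro exI[of _ "l - Suc i"]) auto
  qed (use assms len in auto)
  then have s: "ascan (S ! i') (drop (Suc i') W) (drop (Suc i') W) (drop (Suc i') S) (drop (Suc i') D)" if "i' = i" for i'
    using that by simp
  consider (A) i' where "i' < length W" "D ! i'" "\<forall>j<i'. \<not> D ! j" "W ! i' = TBoxA \<or> W ! i' = TBoxB"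
    | (B) i' where "i' < length W" "D ! i'" "\<forall>j<i'. \<not> D ! j" "W ! i' = TAtom"
      "\<forall>A. dscan W S D A = (None, ascan (S ! i') (drop (Suc i') W) (drop (Suc i') W) (drop (Suc i') S) (drop (Suc i') D))"
    | (C) "\<forall>i<length W. D ! i \<longrightarrow> (\<forall>j<i. \<not> D ! j) \<longrightarrow> W ! i \<noteq> TAtom \<and> (W ! i = TBoxA \<or> W ! i = TBoxB \<longrightarrow> S ! i)"
    using dscan_cases[OF assms(3) len] by blast
  then show ?thesis
  proof cases
    case A
    then show ?thesis using u[of i'] assms(4) by auto
  next
    case B
    then show ?thesis using s[OF u[OF B(1-3)]] len by (intro exI[of _ D]) simp
  next
    case C
    then show ?thesis using t assms by auto
  qed
qed

lemma win_challenge: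
  assumes "win \<phi> (Suc k) S" "length D = length (toks \<phi>)"
  shows "\<exists>A. length A = length (toks \<phi>) \<and> \<not> snd (dscan (toks \<phi>) S D A) \<and>
    (case fst (dscan (toks \<phi>) S D A) of None \<Rightarrow> True
     | Some X \<Rightarrow> halving (length (toks \<phi>)) X (toks \<phi>) S (win \<phi> k) (Suc (length (toks \<phi>))) A [])"
  using assms unfolding win.simps Let_def by blast

lemma win_pcons: "win \<phi> (Suc k) S \<Longrightarrow> pcons \<phi> S"
  unfolding win.simps by blast

declare win.simps [simp del] halving.simps [simp del]

text \<open>A world is a type together with a number of levels; successors have to be winning for
  their own level. The root carries the length of the formula, which exceeds its modal
  depth.\<close>

lemma model_of_win:
  assumes S: "length S = length (toks \<phi>)" "\<not> hd S" "win \<phi> (length (toks \<phi>)) S"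
  shows "\<not> wd_valid TYPE(nat \<times> bool list) \<phi>"
proof
  assume valid: "wd_valid TYPE(nat \<times> bool list) \<phi>"
  define W where "W = toks \<phi>"
  define N where "N = length W"
  \<comment> \<open>An \<open>Ra\<close>-edge must lead into some set \<open>C\<close> closed under
    neighbours. The middle point for the edge is then found in the same \<open>C\<close>, which also
    justifies the edge to the middle point.\<close>
  define Ra where "Ra = {((Suc k, S), (k, T)) | k S T. \<exists>C. T \<in> C \<and>
    (\<forall>U\<in>C. length U = N \<and> bsub TBoxA W S U \<and> win \<phi> k U \<and> (\<exists>U'\<in>C. bsub TBoxB W U' U))}"
  \<comment> \<open>Edges within a level are needed because the middle point \<open>(k, U)\<close>
    for an edge to \<open>(k, T)\<close> lies on the level of its target.\<close>
  define Rb where "Rb = {((k', S), (k, T)) | k' k S T. (k' = k \<or> k' = Suc k) \<and> length T = N \<and> win \<phi> k T \<and> bsub TBoxB W S T}"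
  define V where "V n = {(k :: nat, T). \<exists>i. sub_at \<phi> i = Some (Atom n) \<and> T ! i}" for n
  have "weakly_dense Ra Rb"
    unfolding weakly_dense_def
  proof (intro allI impI)
    fix s t assume "(s, t) \<in> Ra"
    then obtain k S T C where s: "s = (Suc k, S)" "t = (k, T)" "T \<in> C" and
      C: "\<forall>U\<in>C. length U = N \<and> bsub TBoxA W S U \<and> win \<phi> k U \<and> (\<exists>U'\<in>C. bsub TBoxB W U' U)"
      by (auto simp: Ra_def)
    obtain U where U: "U \<in> C" "bsub TBoxB W U T" using C s(3) by blast
    have "(s, (k, U)) \<in> Ra" "((k, U), t) \<in> Rb"
      using s U C by (auto simp: Ra_def Rb_def)
    then show "\<exists>u. (s, u) \<in> Ra \<and> (u, t) \<in> Rb" by blast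
  qed
  moreover have "frame UNIV Ra Rb" by (simp add: frame_def)
  ultimately have sat: "sat Ra Rb V (N, S) \<phi>" using valid unfolding wd_valid_def by blast
  have tl_dr: "tl (drop i xs) = drop (Suc i) xs" for i and xs :: "bool list"
    by (simp add: drop_Suc tl_drop)
  \<comment> \<open>The induction is on the subformula with the level arbitrary, so
    \<open>Rb\<close>-edges that do not lower the level do no harm. The strict bound on the depth
    leaves one level on which the challenges to \<open>T\<close> itself can be played.\<close>
  have truth: "sat Ra Rb V (k, T) \<psi> \<longleftrightarrow> T ! i"
    if "sub_at \<phi> i = Some \<psi>" "depth \<psi> < k" "length T = N" "win \<phi> k T" for k T i \<psi>
    using that
  proof (induction \<psi> arbitrary: k T i)
    case (Atom n)
    obtain k' where k: "k = Suc k'" using Atom.prems(2) by (cases k) auto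
    have "T ! i = T ! j" if "sub_at \<phi> j = Some (Atom n)" for j
    proof (rule ccontr)
      assume ne: "T ! i \<noteq> T ! j"
      have *: False if ij: "a < b" and a: "sub_at \<phi> a = Some (Atom n)" and b: "sub_at \<phi> b = Some (Atom n)" and ne: "T ! a \<noteq> T ! b" for a b
      proof -
        have "W ! a = TAtom" "W ! b = TAtom" using at_nth[OF a] at_nth[OF b] by (simp_all add: W_def)
        moreover have "b < length W" using at_less[OF b] by (simp add: W_def)
        moreover have "digits (drop (Suc a) W) = digits (drop (Suc b) W)"
          using at_digits[OF a] at_digits[OF b] by (simp add: W_def)
        ultimately obtain D where "length D = N" "\<And>A. snd (dscan W T D A)"
          using challenge_atoms[of a b W T] ij ne Atom.prems(3) by (auto simp: N_def)
        then show False using win_challenge[of \<phi> k' T D] Atom.prems(4) unfolding k W_def N_def by blast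
      qed
      have "i \<noteq> j" using ne by blast
      then consider "i < j" | "j < i" by linarith
      then show False
      proof cases
        case 1
        then show False by (rule *[OF _ Atom.prems(1) that ne])
      next
        case 2
        then show False by (rule *[OF _ that Atom.prems(1) ne[symmetric]])
      qed
    qed
    moreover have "sat Ra Rb V (k, T) (Atom n) \<longleftrightarrow> (\<exists>j. sub_at \<phi> j = Some (Atom n) \<and> T ! j)"
      by (simp add: V_def)
    ultimately show ?case using Atom.prems(1) by blast
  next
    case Bot
    obtain k' where k: "k = Suc k'" using Bot.prems(2) by (cases k) auto
    have "pcons \<phi> T" by (rule win_pcons[OF Bot.prems(4)[unfolded k]])
    from pcons_at[OF this Bot.prems(1)] show ?case
      using at_less[OF Bot.prems(1)] Bot.prems(3) by (simp add: hd_drop_conv_nth N_def W_def)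
  next
    case (Neg \<psi>)
    obtain k' where k: "k = Suc k'" using Neg.prems(2) by (cases k) auto
    have p: "pcons \<phi> T" by (rule win_pcons[OF Neg.prems(4)[unfolded k]])
    have n: "sub_at \<phi> (i + 1) = Some \<psi>" by (rule at_trans[OF Neg.prems(1)]) simp
    have "sat Ra Rb V (k, T) \<psi> \<longleftrightarrow> T ! (i + 1)" by (rule Neg.IH[OF n]) (use Neg.prems in auto)
    moreover have "T ! i \<noteq> T ! (i + 1)"
      using pcons_at[OF p Neg.prems(1)] at_less[OF Neg.prems(1)] at_less[OF n] Neg.prems(3)
      by (simp add: hd_drop_conv_nth N_def W_def tl_dr)
    ultimately show ?case by simp
  next
    case (And \<psi>1 \<psi>2)
    obtain k' where k: "k = Suc k'" using And.prems(2) by (cases k) auto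
    have p: "pcons \<phi> T" by (rule win_pcons[OF And.prems(4)[unfolded k]])
    have n1: "sub_at \<phi> (i + 1) = Some \<psi>1" by (rule at_trans[OF And.prems(1)]) simp
    have n2: "sub_at \<phi> (i + (1 + length (toks \<psi>1))) = Some \<psi>2" by (rule at_trans[OF And.prems(1)]) simp
    have "sat Ra Rb V (k, T) \<psi>1 \<longleftrightarrow> T ! (i + 1)" by (rule And.IH(1)[OF n1]) (use And.prems in auto)
    moreover have "sat Ra Rb V (k, T) \<psi>2 \<longleftrightarrow> T ! (i + (1 + length (toks \<psi>1)))"
      by (rule And.IH(2)[OF n2]) (use And.prems in auto)
    moreover have "T ! i = (T ! (i + 1) \<and> T ! (i + (1 + length (toks \<psi>1))))"
      using pcons_at[OF p And.prems(1)] at_less[OF And.prems(1)] at_less[OF n1] at_less[OF n2] And.prems(3)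
      by (simp add: hd_drop_conv_nth N_def W_def tl_dr add.commute)
    ultimately show ?case by simp
  next
    case (BoxA \<psi>)
    obtain k' where k: "k = Suc k'" using BoxA.prems(2) by (cases k) auto
    have n: "sub_at \<phi> (Suc i) = Some \<psi>" using at_trans[OF BoxA.prems(1), of 1 \<psi>] by simp
    have Wi: "W ! i = TBoxA" "i < length W"
      using at_nth[OF BoxA.prems(1)] at_less[OF BoxA.prems(1)] by (simp_all add: W_def)
    have IH: "sat Ra Rb V (k', U) \<psi> \<longleftrightarrow> U ! Suc i" if "length U = N" "win \<phi> k' U" for U
      by (rule BoxA.IH[OF n]) (use that BoxA.prems(2) k in simp_all)
    show ?case
    proof
      assume s: "sat Ra Rb V (k, T) (BoxA \<psi>)"
      show "T ! i"
      proof (rule ccontr)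
        assume "\<not> T ! i"
        then obtain D where D: "length D = N" "\<And>A. length A = N \<Longrightarrow>
            dscan W T D A = (Some TBoxA, Suc i < length A \<and> A ! Suc i)"
          using challenge_box[of i W T] Wi BoxA.prems(3) by (auto simp: N_def)
        then obtain A where A: "length A = N" "\<not> snd (dscan W T D A)" and
          c: "case fst (dscan W T D A) of None \<Rightarrow> True | Some X \<Rightarrow> halving N X W T (win \<phi> k') (Suc N) A []"
          using win_challenge[OF BoxA.prems(4)[unfolded k], of D] unfolding N_def W_def by blast
        have h: "halving N TBoxA W T (win \<phi> k') (Suc N) A []"
          using c unfolding D(2)[OF A(1)] fst_conv option.case .
        have "\<not> A ! Suc i" using A(1,2) D(2) at_less[OF n] by (simp add: N_def W_def)
        moreover have "((Suc k', T), (k', A)) \<in> Ra"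
          using halving_loop[OF h A(1)] by (auto simp: Ra_def)
        moreover have "win \<phi> k' A" using halving_first[OF h] by simp
        ultimately show False using s IH[OF A(1)] by (auto simp: k)
      qed
    next
      assume T: "T ! i"
      have "sat Ra Rb V t \<psi>" if R: "((k, T), t) \<in> Ra" for t
      proof -
        obtain U where U: "t = (k', U)" "length U = N" "bsub TBoxA W T U" "win \<phi> k' U"
          using R by (auto simp: Ra_def k)
        have "U ! Suc i" using U(3) Wi T BoxA.prems(3) by (auto simp: bsub_def N_def)
        then show ?thesis using IH U by simp
      qed
      then show "sat Ra Rb V (k, T) (BoxA \<psi>)" by simp
    qed
  next
    case (BoxB \<psi>)
    obtain k' where k: "k = Suc k'" using BoxB.prems(2) by (cases k) auto
    have n: "sub_at \<phi> (Suc i) = Some \<psi>" using at_trans[OF BoxB.prems(1), of 1 \<psi>] by simp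
    have Wi: "W ! i = TBoxB" "i < length W"
      using at_nth[OF BoxB.prems(1)] at_less[OF BoxB.prems(1)] by (simp_all add: W_def)
    have IH: "sat Ra Rb V (j, U) \<psi> \<longleftrightarrow> U ! Suc i" if "length U = N" "win \<phi> j U" "j = k' \<or> j = k" for U j
      by (rule BoxB.IH[OF n]) (use that BoxB.prems(2) k in auto)
    show ?case
    proof
      assume s: "sat Ra Rb V (k, T) (BoxB \<psi>)"
      show "T ! i"
      proof (rule ccontr)
        assume "\<not> T ! i"
        then obtain D where D: "length D = N" "\<And>A. length A = N \<Longrightarrow>
            dscan W T D A = (Some TBoxB, Suc i < length A \<and> A ! Suc i)"
          using challenge_box[of i W T] Wi BoxB.prems(3) by (auto simp: N_def)
        then obtain A where A: "length A = N" "\<not> snd (dscan W T D A)" and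
          c: "case fst (dscan W T D A) of None \<Rightarrow> True | Some X \<Rightarrow> halving N X W T (win \<phi> k') (Suc N) A []"
          using win_challenge[OF BoxB.prems(4)[unfolded k], of D] unfolding N_def W_def by blast
        have h: "halving N TBoxB W T (win \<phi> k') (Suc N) A []"
          using c unfolding D(2)[OF A(1)] fst_conv option.case .
        have "\<not> A ! Suc i" using A(1,2) D(2) at_less[OF n] by (simp add: N_def W_def)
        moreover have "((Suc k', T), (k', A)) \<in> Rb" "win \<phi> k' A"
          using halving_first[OF h] A(1) by (auto simp: Rb_def)
        ultimately show False using s IH[OF A(1)] by (auto simp: k)
      qed
    next
      assume T: "T ! i"
      have "sat Ra Rb V t \<psi>" if R: "((k, T), t) \<in> Rb" for t
      proof -
        obtain j U where U: "t = (j, U)" "length U = N" "bsub TBoxB W T U" "win \<phi> j U" "j = k' \<or> j = k"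
          using R by (auto simp: Rb_def k)
        have "U ! Suc i" using U(3) Wi T BoxB.prems(3) by (auto simp: bsub_def N_def)
        then show ?thesis using IH U by simp
      qed
      then show "sat Ra Rb V (k, T) (BoxB \<psi>)" by simp
    qed
  qed
  have "sat Ra Rb V (N, S) \<phi> \<longleftrightarrow> S ! 0"
    by (rule truth) (use S depth_less in \<open>auto simp: N_def W_def\<close>)
  moreover have "S \<noteq> []" using S(1) by auto
  ultimately show False using S(2) sat by (simp add: hd_conv_nth)
qed

theorem win_iff:
  assumes "infinite (UNIV :: 'w set)"
  shows "wd_valid TYPE('w) \<phi> \<longleftrightarrow> \<not> (\<exists>S. length S = length (toks \<phi>) \<and> \<not> hd S \<and> win \<phi> (length (toks \<phi>)) S)"
proof
  assume "wd_valid TYPE('w) \<phi>"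
  then have "wd_valid TYPE(nat \<times> bool list) \<phi>" by (rule wd_valid_all_types[OF assms])
  then show "\<not> (\<exists>S. length S = length (toks \<phi>) \<and> \<not> hd S \<and> win \<phi> (length (toks \<phi>)) S)"
    using model_of_win by blast
next
  assume nw: "\<not> (\<exists>S. length S = length (toks \<phi>) \<and> \<not> hd S \<and> win \<phi> (length (toks \<phi>)) S)"
  show "wd_valid TYPE('w) \<phi>"
    unfolding wd_valid_def
  proof (intro allI impI ballI)
    fix F :: "'w set" and Ra Rb V s
    assume "weakly_dense Ra Rb"
    then have "win \<phi> (length (toks \<phi>)) (ty Ra Rb V s \<phi>)" by (rule win_ty)
    then have "hd (ty Ra Rb V s \<phi>)"
      by (rule_tac ccontr) (rule notE[OF nw], intro exI conjI, rule length_ty)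
    then show "sat Ra Rb V s \<phi>" using hd_ty[of Ra Rb V s \<phi> "[]"] by simp
  qed
qed

section \<open>The decision procedure as a function\<close>

subsection \<open>Parsing\<close>

fun btok :: "bool \<Rightarrow> bool \<Rightarrow> bool \<Rightarrow> tok" where
  "btok False False False = TBot"
| "btok False False True = TAtom"
| "btok False True d = TDig d"
| "btok True False False = TNeg"
| "btok True False True = TAnd"
| "btok True True False = TBoxA"
| "btok True True True = TBoxB"

fun bits :: "tok \<Rightarrow> bool list" where
  "bits TBot = [False, False, False]"
| "bits TAtom = [False, False, True]"
| "bits (TDig d) = [False, True, d]"
| "bits TNeg = [True, False, False]"
| "bits TAnd = [True, False, True]"
| "bits TBoxA = [True, True, False]"
| "bits TBoxB = [True, True, True]"

fun tkz :: "bool list \<Rightarrow> tok list \<times> bool" where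
  "tkz [] = ([], False)"
| "tkz [a] = ([], True)"
| "tkz [a, b] = ([], True)"
| "tkz (a # b # c # w) = (btok a b c # fst (tkz w), snd (tkz w))"

lemma bits_btok: "bits (btok a b c) = [a, b, c]"
  by (cases a; cases b; cases c) auto

lemma tkz_bits: "tkz (concat (map bits ts)) = (ts, False)"
proof (induction ts)
  case (Cons t ts)
  then show ?case by (cases t rule: bits.cases) auto
qed simp

lemma bits_tkz: "\<not> snd (tkz w) \<Longrightarrow> w = concat (map bits (fst (tkz w)))"
  by (induction w rule: tkz.induct) (auto simp: bits_btok)

lemma enc_toks: "enc \<phi> = concat (map bits (toks \<phi>))"
  by (induction \<phi>) (auto simp: comp_def)

text \<open>
  A formula in prefix notation is evaluated from right to left with a stack of truth values.  The
  second component of the state is the digit to the right of the current position, if any; the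
  third one records ill-formedness, the fourth one that a value in \<open>S\<close> contradicts the
  propositional connectives.
\<close>

type_synonym pstate = "bool list \<times> bool option \<times> bool \<times> bool"

fun pstep :: "tok \<Rightarrow> bool \<Rightarrow> pstate \<Rightarrow> pstate" where
  "pstep TBot s (V, dg, bad, inc) = (s # V, None, bad \<or> dg \<noteq> None, inc \<or> s)"
| "pstep TAtom s (V, dg, bad, inc) = (s # V, None, bad \<or> dg = Some False, inc)"
| "pstep (TDig d) s (V, dg, bad, inc) = (V, Some d, bad, inc)"
| "pstep TNeg s (V, dg, bad, inc) =
     (s # tl V, None, bad \<or> dg \<noteq> None \<or> V = [], inc \<or> V \<noteq> [] \<and> s = hd V)"
| "pstep TAnd s (V, dg, bad, inc) =
     (s # tl (tl V), None, bad \<or> dg \<noteq> None \<or> tl V = [], inc \<or> tl V \<noteq> [] \<and> s \<noteq> (hd V \<and> hd (tl V)))"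
| "pstep TBoxA s (V, dg, bad, inc) = (s # tl V, None, bad \<or> dg \<noteq> None \<or> V = [], inc)"
| "pstep TBoxB s (V, dg, bad, inc) = (s # tl V, None, bad \<or> dg \<noteq> None \<or> V = [], inc)"

fun prun :: "tok list \<Rightarrow> bool list \<Rightarrow> pstate \<Rightarrow> pstate" where
  "prun [] S st = st"
| "prun (t # W) S st = prun W (tl S) (pstep t (hdF S) st)"

lemma prun_append: "prun (U @ W) S st = prun W (drop (length U) S) (prun U S st)"
  by (induction U arbitrary: S st) (auto simp: drop_Suc)

lemma prun_append2: "length S = length W \<Longrightarrow> prun W (S @ S') st = prun W S st"
proof (induction W arbitrary: S st)
  case (Cons t W)
  then show ?case by (cases S) (auto simp: hdF_def)
qed simp

lemma prun_rev_Cons: "length S = length W \<Longrightarrow>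
    prun (rev (t # W)) (rev (s # S)) st = pstep t s (prun (rev W) (rev S) st)"
  by (simp add: prun_append prun_append2 hdF_def)

lemma prun_rev_append: "length S = length U \<Longrightarrow> length S' = length W \<Longrightarrow>
    prun (rev (U @ W)) (rev (S @ S')) st = prun (rev U) (rev S) (prun (rev W) (rev S') st)"
  by (simp add: prun_append prun_append2)

lemma pcons_append: "length U = length (toks \<phi>) \<Longrightarrow> pcons \<phi> (U @ U') = pcons \<phi> U"
proof (induction \<phi> arbitrary: U U')
  case (And \<phi> \<psi>)
  obtain u U1 where U: "U = u # U1" using And.prems by (cases U) auto
  define U2 where "U2 = take (length (toks \<phi>)) U1"
  define U3 where "U3 = drop (length (toks \<phi>)) U1"
  have U1: "U1 = U2 @ U3" "length U2 = length (toks \<phi>)" "length U3 = length (toks \<psi>)"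
    using And.prems U by (auto simp: U2_def U3_def)
  have ne: "U2 \<noteq> []" "U3 \<noteq> []" using U1(2,3) toks_not_Nil by (metis length_0_conv)+
  show ?case
    using And.IH(1)[OF U1(2), of "U3 @ U'"] And.IH(1)[OF U1(2), of U3] And.IH(2)[OF U1(3), of U'] U1(2,3) ne
    by (simp add: U U1(1))
next
  case (Neg \<phi>)
  then obtain u U1 where U: "U = u # U1" "length U1 = length (toks \<phi>)" by (cases U) auto
  then have "U1 \<noteq> []" using toks_not_Nil by (metis length_0_conv)
  then show ?case using Neg.IH[OF U(2)] by (auto simp: U(1))
next
  case (BoxA \<phi>)
  then obtain u U1 where U: "U = u # U1" "length U1 = length (toks \<phi>)" by (cases U) auto
  then show ?case using BoxA.IH[OF U(2)] by auto
next
  case (BoxB \<phi>)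
  then obtain u U1 where U: "U = u # U1" "length U1 = length (toks \<phi>)" by (cases U) auto
  then show ?case using BoxB.IH[OF U(2)] by auto
next
  case Bot
  then show ?case by (cases U) auto
qed simp

text \<open>A formula acts on the evaluation stack as a single push of the value at its root,
  whatever lies below. This makes the scan from right to left compositional.\<close>

lemma prun_toks:
  assumes "length S = length (toks \<phi>)"
  shows "prun (rev (toks \<phi>)) (rev S) (V, None, bad, inc) = (hd S # V, None, bad, inc \<or> \<not> pcons \<phi> S)"
  using assms
proof (induction \<phi> arbitrary: S V bad inc)
  case Bot
  then obtain s where "S = [s]" by (auto simp: length_Suc_conv)
  then show ?case by (simp add: hdF_def)
next
  case (Atom n)
  then obtain s S' where S: "S = s # S'" "length S' = length (bin n)" by (auto simp: length_Suc_conv)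
  have d: "prun (rev (map TDig ds)) (rev S') (V, None, bad, inc)
      = (V, if ds = [] then None else Some (hd ds), bad, inc)"
    if "length S' = length ds" for ds S'
    using that
  proof (induction ds arbitrary: S')
    case (Cons d ds)
    then obtain s T where T: "S' = s # T" "length T = length ds" by (auto simp: length_Suc_conv)
    show ?case using prun_rev_Cons[of T "map TDig ds" "TDig d" s "(V, None, bad, inc)"] Cons.IH[OF T(2)] T
      by simp
  qed simp
  \<comment> \<open>Numerals have no leading zero, so the check made at \<open>TAtom\<close> raises
    no error.\<close>
  have "bin n = [] \<or> hd (bin n)"
  proof (cases "bin n")
    case (Cons b bs)
    have "bin k \<noteq> [] \<Longrightarrow> hd (bin k)" for k
    proof (induction k rule: less_induct)
      case (less k)
      then have k: "k \<noteq> 0" using bin_0 by metis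
      show ?case
      proof (cases "bin (k div 2) = []")
        case True
        then have "k div 2 = 0" using bin_pos by fastforce
        then have "k = 1" using k by linarith
        then show ?thesis by (simp add: bin_pos bin_0)
      next
        case False
        then have "hd (bin (k div 2))" using less.IH[of "k div 2"] k by simp
        then show ?thesis using False by (simp add: bin_pos[OF k])
      qed
    qed
    then show ?thesis by blast
  qed simp
  then show ?case
    using prun_rev_Cons[of S' "map TDig (bin n)" TAtom s "(V, None, bad, inc)"] d[OF S(2)] S by auto
next
  case (Neg \<phi>)
  then obtain s T where S: "S = s # T" "length T = length (toks \<phi>)" by (auto simp: length_Suc_conv)
  then show ?case using prun_rev_Cons[of T "toks \<phi>" TNeg s "(V, None, bad, inc)"] Neg.IH[OF S(2)] by auto
next
  case (BoxA \<phi>)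
  then obtain s T where S: "S = s # T" "length T = length (toks \<phi>)" by (auto simp: length_Suc_conv)
  then show ?case using prun_rev_Cons[of T "toks \<phi>" TBoxA s "(V, None, bad, inc)"] BoxA.IH[OF S(2)] by auto
next
  case (BoxB \<phi>)
  then obtain s T where S: "S = s # T" "length T = length (toks \<phi>)" by (auto simp: length_Suc_conv)
  then show ?case using prun_rev_Cons[of T "toks \<phi>" TBoxB s "(V, None, bad, inc)"] BoxB.IH[OF S(2)] by auto
next
  case (And \<phi>1 \<phi>2)
  let ?n = "length (toks \<phi>1)"
  obtain s T where S: "S = s # T" "length T = ?n + length (toks \<phi>2)"
    using And.prems by (auto simp: length_Suc_conv)
  define T1 where "T1 = take ?n T"
  define T2 where "T2 = drop ?n T"
  have T: "T = T1 @ T2" "length T1 = ?n" "length T2 = length (toks \<phi>2)"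
    using S by (auto simp: T1_def T2_def)
  have ne: "T1 \<noteq> []" using T(2) by (metis length_0_conv toks_not_Nil)
  have "prun (rev (toks \<phi>1 @ toks \<phi>2)) (rev T) (V, None, bad, inc)
     = (hd T1 # hd T2 # V, None, bad, (inc \<or> \<not> pcons \<phi>2 T2) \<or> \<not> pcons \<phi>1 T1)"
    unfolding T(1) prun_rev_append[OF T(2,3)] And.IH(2)[OF T(3)] And.IH(1)[OF T(2)] ..
  then have "prun (rev (toks (And \<phi>1 \<phi>2))) (rev S) (V, None, bad, inc)
    = pstep TAnd s (hd T1 # hd T2 # V, None, bad, (inc \<or> \<not> pcons \<phi>2 T2) \<or> \<not> pcons \<phi>1 T1)"
    using prun_rev_Cons[of T "toks \<phi>1 @ toks \<phi>2" TAnd s "(V, None, bad, inc)"] S by simp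
  then show ?case using T pcons_append[OF T(2), of T2] ne by (auto simp: S(1))
qed

text \<open>The scan that checks consistency is reused with an empty list of values, all of which
  read as \<open>False\<close>.\<close>

definition parse_ok :: "tok list \<Rightarrow> bool" where
  "parse_ok W \<longleftrightarrow> (case prun (rev W) [] ([], None, False, False) of (V, dg, bad, inc) \<Rightarrow>
     \<not> bad \<and> dg = None \<and> length V = 1)"

lemma prun_Nil: "prun (rev (t # W)) [] st = pstep t False (prun (rev W) [] st)"
  by (simp add: prun_append hdF_def)

lemma prun_False: "prun W (replicate n False) st = prun W [] st"
proof (induction W arbitrary: n st)
  case (Cons t W)
  then show ?case by (cases n) (auto simp: hdF_def)
qed simp

text \<open>Invariant of the scan: the suffix read so far is a run of digits not yet claimed by an
  atom, followed by one formula for each entry of the stack.\<close>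

lemma parse_sound:
  assumes "prun (rev W) [] ([], None, False, False) = (V, dg, False, inc)"
  shows "\<exists>ds \<phi>s. W = map TDig ds @ concat (map toks \<phi>s) \<and> length \<phi>s = length V
    \<and> dg = (if ds = [] then None else Some (hd ds))"
  using assms
proof (induction W arbitrary: V dg inc)
  case (Cons t W)
  obtain V0 dg0 bad0 inc0 where p: "prun (rev W) [] ([], None, False, False) = (V0, dg0, bad0, inc0)"
    by (metis prod_cases4)
  have st: "pstep t False (V0, dg0, bad0, inc0) = (V, dg, False, inc)"
    using Cons.prems unfolding prun_Nil p .
  have "bad0 = False" using st by (cases t) auto
  then obtain ds \<phi>s where W: "W = map TDig ds @ concat (map toks \<phi>s)" "length \<phi>s = length V0"
    and dg0: "dg0 = (if ds = [] then None else Some (hd ds))" using Cons.IH p by blast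
  show ?case
  proof (cases t)
    case TBot
    then have "ds = []" "V = False # V0" "dg = None" using st dg0 by (auto split: if_splits)
    then show ?thesis using W TBot by (intro exI[of _ "[]"] exI[of _ "Bot # \<phi>s"]) auto
  next
    case TAtom
    then have d: "ds = [] \<or> hd ds" "V = False # V0" "dg = None" using st dg0 by (auto split: if_splits)
    have "\<exists>n. bin n = ds"
    proof (cases ds)
      case Nil
      then show ?thesis using bin_0 by blast
    next
      case (Cons b bs)
      then have "bin (val (True # bs)) = ds" using d(1) bin_val by simp
      then show ?thesis by blast
    qed
    then obtain n where "bin n = ds" by blast
    then show ?thesis using W TAtom d by (intro exI[of _ "[]"] exI[of _ "Atom n # \<phi>s"]) auto
  next
    case (TDig d)
    then have "V = V0" "dg = Some d" using st by auto
    then show ?thesis using W TDig by (intro exI[of _ "d # ds"] exI[of _ \<phi>s]) auto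
  next
    case TNeg
    then have d: "ds = []" "V0 \<noteq> []" "V = False # tl V0" "dg = None" using st dg0 by (auto split: if_splits)
    then obtain \<psi> \<psi>s where "\<phi>s = \<psi> # \<psi>s" using W(2) by (cases \<phi>s) auto
    then show ?thesis using W TNeg d by (intro exI[of _ "[]"] exI[of _ "Neg \<psi> # \<psi>s"]) auto
  next
    case TAnd
    then have d: "ds = []" "tl V0 \<noteq> []" "V = False # tl (tl V0)" "dg = None" using st dg0 by (auto split: if_splits)
    then obtain \<psi> \<chi> \<psi>s where "\<phi>s = \<psi> # \<chi> # \<psi>s" using W(2)
      by (cases \<phi>s; cases V0; cases "tl \<phi>s"; cases "tl V0") auto
    then show ?thesis using W TAnd d by (intro exI[of _ "[]"] exI[of _ "And \<psi> \<chi> # \<psi>s"]) auto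
  next
    case TBoxA
    then have d: "ds = []" "V0 \<noteq> []" "V = False # tl V0" "dg = None" using st dg0 by (auto split: if_splits)
    then obtain \<psi> \<psi>s where "\<phi>s = \<psi> # \<psi>s" using W(2) by (cases \<phi>s) auto
    then show ?thesis using W TBoxA d by (intro exI[of _ "[]"] exI[of _ "BoxA \<psi> # \<psi>s"]) auto
  next
    case TBoxB
    then have d: "ds = []" "V0 \<noteq> []" "V = False # tl V0" "dg = None" using st dg0 by (auto split: if_splits)
    then obtain \<psi> \<psi>s where "\<phi>s = \<psi> # \<psi>s" using W(2) by (cases \<phi>s) auto
    then show ?thesis using W TBoxB d by (intro exI[of _ "[]"] exI[of _ "BoxB \<psi> # \<psi>s"]) auto
  qed
qed auto

lemma parse_ok_iff: "parse_ok W \<longleftrightarrow> (\<exists>\<phi>. W = toks \<phi>)"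
proof
  assume "parse_ok W"
  then obtain V inc where p: "prun (rev W) [] ([], None, False, False) = (V, None, False, inc)" "length V = 1"
    by (auto simp: parse_ok_def split: prod.splits)
  obtain ds \<phi>s where "W = map TDig ds @ concat (map toks \<phi>s)" "length \<phi>s = 1" "ds = []"
    using parse_sound[OF p(1)] p(2) by (auto split: if_splits)
  then show "\<exists>\<phi>. W = toks \<phi>" by (auto simp: length_Suc_conv)
next
  assume "\<exists>\<phi>. W = toks \<phi>"
  then obtain \<phi> where W: "W = toks \<phi>" by blast
  have "prun (rev W) [] ([], None, False, False) = prun (rev (toks \<phi>)) (rev (replicate (length (toks \<phi>)) False)) ([], None, False, False)"
    unfolding W rev_replicate prun_False ..
  then show "parse_ok W" by (subst (asm) prun_toks) (auto simp: parse_ok_def)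
qed

subsection \<open>The quantifier prefix\<close>

fun qeval :: "bool list \<Rightarrow> (bool list \<Rightarrow> bool) \<Rightarrow> bool" where
  "qeval [] P = P []"
| "qeval (q # qs) P = (if q then qeval qs (\<lambda>y. P (False # y)) \<or> qeval qs (\<lambda>y. P (True # y))
     else qeval qs (\<lambda>y. P (False # y)) \<and> qeval qs (\<lambda>y. P (True # y)))"

lemma qeval_append: "qeval (qs @ rs) P = qeval qs (\<lambda>x. qeval rs (\<lambda>y. P (x @ y)))"
  by (induction qs arbitrary: P) auto

lemma qeval_ex: "qeval (replicate n True) P \<longleftrightarrow> (\<exists>x. length x = n \<and> P x)"
proof (induction n arbitrary: P)
  case (Suc n)
  have "(\<exists>x. length x = Suc n \<and> P x) \<longleftrightarrow> (\<exists>b y. length y = n \<and> P (b # y))"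
    by (metis length_Suc_conv length_Cons)
  also have "\<dots> \<longleftrightarrow> qeval (replicate (Suc n) True) P" by (auto simp: Suc) (metis (full_types))
  finally show ?case ..
qed simp

lemma qeval_all: "qeval (replicate n False) P \<longleftrightarrow> (\<forall>x. length x = n \<longrightarrow> P x)"
proof (induction n arbitrary: P)
  case (Suc n)
  have "(\<forall>x. length x = Suc n \<longrightarrow> P x) \<longleftrightarrow> (\<forall>b y. length y = n \<longrightarrow> P (b # y))"
    by (metis length_Suc_conv length_Cons)
  also have "\<dots> \<longleftrightarrow> qeval (replicate (Suc n) False) P" by (auto simp: Suc) (metis (full_types))
  finally show ?case ..
qed simp

text \<open>The prefix has fixed length, but a play may be decided early; the quantifiers left over
  then range over a constant.\<close>

lemma qeval_const: "qeval qs (\<lambda>_. b) = b"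
  by (induction qs) auto

text \<open>Blocks of the transcript are read onto stacks, hence the reversals.\<close>

fun hl :: "nat \<Rightarrow> nat \<Rightarrow> bool list \<Rightarrow> bool list \<Rightarrow> bool list \<Rightarrow> bool list \<times> bool list \<times> bool list" where
  "hl N 0 A B Y = (A, B, Y)"
| "hl N (Suc j) A B Y = (if Y ! N then hl N j (rev (take N Y)) B (drop (Suc N) Y)
     else hl N j A (rev (take N Y)) (drop (Suc N) Y))"

definition incons :: "tok list \<Rightarrow> bool list \<Rightarrow> bool" where
  "incons W S = snd (snd (snd (prun (rev W) (rev S) ([], None, False, False))))"

text \<open>The outcome of a play as a function of its transcript, in which the bits of both players
  appear in the order of choice. A void challenge ends the play and leaves the rest unread.\<close>

fun lev :: "tok list \<Rightarrow> nat \<Rightarrow> bool list \<Rightarrow> bool list \<Rightarrow> bool" where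
  "lev W 0 S Y = True"
| "lev W (Suc k) S Y = (let N = length W; D = rev (take N Y); A = rev (take N (drop N Y)) in
     \<not> incons W S \<and> \<not> snd (dscan W S D A) \<and>
     (case fst (dscan W S D A) of None \<Rightarrow> True
      | Some X \<Rightarrow> (case hl N (Suc N) A [] (drop N (drop N Y)) of (A', B', Y') \<Rightarrow>
          bsub X W S A' \<and> (X = TBoxA \<longrightarrow> bsub TBoxB W B' A') \<and> lev W k A' Y')))"

definition leaf :: "tok list \<Rightarrow> bool list \<Rightarrow> bool" where
  "leaf W Y = (\<not> hdF (rev (take (length W) Y)) \<and> lev W (length W) (rev (take (length W) Y)) (drop (length W) Y))"

text \<open>\<open>True\<close> stands for existential bits of the defender, \<open>False\<close>
  for universal bits of the challenger. In a halving \<open>N\<close> bits name the middle type and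
  one bit chooses a half; in \<open>lpat\<close> these are preceded by \<open>N\<close> marks and
  \<open>N\<close> bits of the answer.\<close>

definition hpat :: "nat \<Rightarrow> nat \<Rightarrow> bool list" where
  "hpat N j = concat (replicate j (replicate N True @ [False]))"

definition lpat :: "nat \<Rightarrow> nat \<Rightarrow> bool list" where
  "lpat N k = concat (replicate k (replicate N False @ replicate N True @ hpat N (Suc N)))"

definition pat :: "nat \<Rightarrow> bool list" where
  "pat N = replicate N True @ lpat N N"

lemma ex_rev: "(\<exists>x. length x = n \<and> P (rev x)) \<longleftrightarrow> (\<exists>x. length x = n \<and> P x)"
  by (metis length_rev rev_rev_ident)

lemma all_rev: "(\<forall>x. length x = n \<longrightarrow> P (rev x)) \<longleftrightarrow> (\<forall>x. length x = n \<longrightarrow> P x)"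
  by (metis length_rev rev_rev_ident)

text \<open>The continuation \<open>F\<close> is kept abstract so that the evaluation of the later
  levels can be plugged in. The universal bit after each middle type splits into the two conjuncts
  of \<open>halving\<close>.\<close>

lemma qeval_hpat:
  assumes "\<And>A B. length A = N \<Longrightarrow> qeval rs (\<lambda>Y. F A B Y) =
     (bsub X W S A \<and> (X = TBoxA \<longrightarrow> bsub TBoxB W B A) \<and> P A)"
    and "length A = N"
  shows "qeval (hpat N j @ rs) (\<lambda>Y. case hl N j A B Y of (A', B', Y') \<Rightarrow> F A' B' Y')
     = halving N X W S P j A B"
  using assms(2)
proof (induction j arbitrary: A B)
  case 0
  then show ?case using assms(1) by (simp add: hpat_def halving.simps)
next
  case (Suc j)
  have "qeval (hpat N (Suc j) @ rs) (\<lambda>Y. case hl N (Suc j) A B Y of (A', B', Y') \<Rightarrow> F A' B' Y')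
    \<longleftrightarrow> (\<exists>x. length x = N \<and> qeval [False] (\<lambda>c. qeval (hpat N j @ rs)
        (\<lambda>Y. case hl N (Suc j) A B (x @ c @ Y) of (A', B', Y') \<Rightarrow> F A' B' Y')))"
    by (simp add: hpat_def qeval_append[of "replicate N True"] qeval_ex)
  also have "\<dots> \<longleftrightarrow> (\<exists>x. length x = N \<and> halving N X W S P j A (rev x) \<and> halving N X W S P j (rev x) B)"
  proof (intro ex_cong1 conj_cong refl)
    fix x :: "bool list" assume x: "length x = N"
    have "qeval [False] (\<lambda>c. qeval (hpat N j @ rs) (\<lambda>Y. case hl N (Suc j) A B (x @ c @ Y) of (A', B', Y') \<Rightarrow> F A' B' Y'))
      \<longleftrightarrow> qeval (hpat N j @ rs) (\<lambda>Y. case hl N j A (rev x) Y of (A', B', Y') \<Rightarrow> F A' B' Y')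
        \<and> qeval (hpat N j @ rs) (\<lambda>Y. case hl N j (rev x) B Y of (A', B', Y') \<Rightarrow> F A' B' Y')"
      using x by (simp add: nth_append)
    also have "\<dots> \<longleftrightarrow> halving N X W S P j A (rev x) \<and> halving N X W S P j (rev x) B"
      using Suc.IH[OF Suc.prems, of "rev x"] Suc.IH[of "rev x" B] x by simp
    finally show "qeval [False] (\<lambda>c. qeval (hpat N j @ rs) (\<lambda>Y. case hl N (Suc j) A B (x @ c @ Y) of (A', B', Y') \<Rightarrow> F A' B' Y'))
      = (halving N X W S P j A (rev x) \<and> halving N X W S P j (rev x) B)" .
  qed
  also have "\<dots> \<longleftrightarrow> halving N X W S P (Suc j) A B"
    unfolding halving.simps ex_rev[of N "\<lambda>M. halving N X W S P j A M \<and> halving N X W S P j M B"] by blast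
  finally show ?case .
qed

lemma qeval_lpat:
  assumes W: "W = toks \<phi>" "N = length W" and "length S = N"
  shows "qeval (lpat N k) (\<lambda>Y. lev W k S Y) = win \<phi> k S"
  using assms(3)
proof (induction k arbitrary: S)
  case 0
  then show ?case by (simp add: lpat_def win.simps)
next
  case (Suc k)
  have inc: "incons W S \<longleftrightarrow> \<not> pcons \<phi> S"
    using prun_toks[of S \<phi> "[]" False False] Suc.prems W by (simp add: incons_def)
  let ?G = "\<lambda>D A. \<not> snd (dscan W S D A) \<and> (case fst (dscan W S D A) of None \<Rightarrow> True
     | Some X \<Rightarrow> halving N X W S (win \<phi> k) (Suc N) A [])"
  have "qeval (lpat N (Suc k)) (\<lambda>Y. lev W (Suc k) S Y) \<longleftrightarrow>
    (\<forall>D. length D = N \<longrightarrow> (\<exists>A. length A = N \<and> qeval (hpat N (Suc N) @ lpat N k) (\<lambda>Y. lev W (Suc k) S (D @ A @ Y))))"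
    by (simp add: lpat_def qeval_append[of "replicate N True"] qeval_append[of "replicate N False"] qeval_ex qeval_all)
  also have "\<dots> \<longleftrightarrow> (\<forall>D. length D = N \<longrightarrow> (\<exists>A. length A = N \<and> pcons \<phi> S \<and> ?G (rev D) (rev A)))"
  proof (intro all_cong1 imp_cong ex_cong1 conj_cong refl)
    fix D A :: "bool list" assume D: "length D = N" and A: "length A = N"
    have q: "qeval (hpat N (Suc N) @ lpat N k) (\<lambda>Y. case hl N (Suc N) (rev A) [] Y of (A', B', Y') \<Rightarrow>
          bsub X W S A' \<and> (X = TBoxA \<longrightarrow> bsub TBoxB W B' A') \<and> lev W k A' Y')
       = halving N X W S (win \<phi> k) (Suc N) (rev A) []" for X
    proof (rule qeval_hpat)
      fix A' B' :: "bool list" assume A': "length A' = N"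
      show "qeval (lpat N k) (\<lambda>Y. bsub X W S A' \<and> (X = TBoxA \<longrightarrow> bsub TBoxB W B' A') \<and> lev W k A' Y)
        = (bsub X W S A' \<and> (X = TBoxA \<longrightarrow> bsub TBoxB W B' A') \<and> win \<phi> k A')"
        using Suc.IH[OF A'] qeval_const[of "lpat N k" False] by (cases "bsub X W S A' \<and> (X = TBoxA \<longrightarrow> bsub TBoxB W B' A')") auto
    qed (simp add: A)
    show "qeval (hpat N (Suc N) @ lpat N k) (\<lambda>Y. lev W (Suc k) S (D @ A @ Y))
      = (pcons \<phi> S \<and> ?G (rev D) (rev A))"
    proof (cases "pcons \<phi> S \<and> \<not> snd (dscan W S (rev D) (rev A))")
      case True
      then show ?thesis using D A W(2) inc q qeval_const
        by (cases "fst (dscan W S (rev D) (rev A))") (simp_all add: Let_def)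
    next
      case False
      then have "(\<lambda>Y. lev W (Suc k) S (D @ A @ Y)) = (\<lambda>_. False)" using D A W(2) inc by (auto simp: Let_def)
      then show ?thesis using False qeval_const by auto
    qed
  qed
  \<comment> \<open>Consistency of \<open>S\<close> does not depend on \<open>D\<close> and
    \<open>A\<close> and moves out of the quantifiers; the universal one is not vacuous, as lists of
    length \<open>N\<close> exist.\<close>
  also have "\<dots> \<longleftrightarrow> pcons \<phi> S \<and> (\<forall>D. length D = N \<longrightarrow> (\<exists>A. length A = N \<and> ?G D A))"
  proof -
    have "(\<forall>D. length D = N \<longrightarrow> (\<exists>A. length A = N \<and> pcons \<phi> S \<and> G (rev D) (rev A)))
      \<longleftrightarrow> pcons \<phi> S \<and> (\<forall>D. length D = N \<longrightarrow> (\<exists>A. length A = N \<and> G D A))" for G :: "bool list \<Rightarrow> bool list \<Rightarrow> bool"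
    proof -
      have 1: "(\<exists>A. length A = N \<and> pcons \<phi> S \<and> G D (rev A)) \<longleftrightarrow> pcons \<phi> S \<and> (\<exists>A. length A = N \<and> G D A)" for D
        unfolding ex_rev[of N "G D", symmetric] by blast
      have 2: "\<exists>D :: bool list. length D = N" by (rule exI[of _ "replicate N False"]) simp
      have 3: "(\<forall>D :: bool list. length D = N \<longrightarrow> c \<and> Q D) \<longleftrightarrow> c \<and> (\<forall>D. length D = N \<longrightarrow> Q D)" for c Q
        using 2 by blast
      show ?thesis
        unfolding 1 3 all_rev[of N "\<lambda>D. \<exists>A. length A = N \<and> G D A"] ..
    qed
    from this[of ?G] show ?thesis .
  qed
  also have "\<dots> \<longleftrightarrow> win \<phi> (Suc k) S"
    by (simp only: win.simps Let_def W)
  finally show ?case .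
qed

theorem qeval_pat:
  assumes "infinite (UNIV :: 'w set)"
  shows "qeval (pat (length (toks \<phi>))) (leaf (toks \<phi>)) \<longleftrightarrow> \<not> wd_valid TYPE('w) \<phi>"
proof -
  let ?W = "toks \<phi>"
  let ?N = "length ?W"
  have "qeval (pat ?N) (leaf ?W) \<longleftrightarrow> (\<exists>S. length S = ?N \<and> qeval (lpat ?N ?N) (\<lambda>Y. leaf ?W (S @ Y)))"
    by (simp add: pat_def qeval_append qeval_ex)
  also have "\<dots> \<longleftrightarrow> (\<exists>S. length S = ?N \<and> \<not> hdF (rev S) \<and> win \<phi> ?N (rev S))"
  proof (intro ex_cong1 conj_cong refl)
    fix S :: "bool list" assume S: "length S = ?N"
    have "(\<lambda>Y. leaf ?W (S @ Y)) = (\<lambda>Y. \<not> hdF (rev S) \<and> lev ?W ?N (rev S) Y)"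
      using S by (simp add: leaf_def)
    then show "qeval (lpat ?N ?N) (\<lambda>Y. leaf ?W (S @ Y)) = (\<not> hdF (rev S) \<and> win \<phi> ?N (rev S))"
      using qeval_lpat[of ?W \<phi> ?N "rev S" ?N] S qeval_const[of "lpat ?N ?N" False] by (cases "hdF (rev S)") auto
  qed
  also have "\<dots> \<longleftrightarrow> (\<exists>S. length S = ?N \<and> \<not> hdF S \<and> win \<phi> ?N S)"
    by (rule ex_rev[of ?N "\<lambda>S. \<not> hdF S \<and> win \<phi> ?N S"])
  also have "\<dots> \<longleftrightarrow> (\<exists>S. length S = ?N \<and> \<not> hd S \<and> win \<phi> ?N S)"
  proof (intro ex_cong1 conj_cong refl)
    fix S :: "bool list" assume "length S = ?N"
    then have "S \<noteq> []" using toks_not_Nil by (metis length_0_conv)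
    then show "(\<not> hdF S) = (\<not> hd S)" by (simp add: hdF_def)
  qed
  finally show ?thesis using win_iff[OF assms, of \<phi>] by blast
qed

theorem spec_correct:
  assumes "infinite (UNIV :: 'w set)"
  shows "w \<in> DP_ab TYPE('w) \<longleftrightarrow> \<not> snd (tkz w) \<and> parse_ok (fst (tkz w))
    \<and> \<not> qeval (pat (length (fst (tkz w)))) (leaf (fst (tkz w)))"
proof
  assume "w \<in> DP_ab TYPE('w)"
  then obtain \<phi> where "w = enc \<phi>" "wd_valid TYPE('w) \<phi>" by (auto simp: DP_ab_def)
  then show "\<not> snd (tkz w) \<and> parse_ok (fst (tkz w)) \<and> \<not> qeval (pat (length (fst (tkz w)))) (leaf (fst (tkz w)))"
    using qeval_pat[OF assms] parse_ok_iff by (auto simp: enc_toks tkz_bits)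
next
  assume *: "\<not> snd (tkz w) \<and> parse_ok (fst (tkz w)) \<and> \<not> qeval (pat (length (fst (tkz w)))) (leaf (fst (tkz w)))"
  then obtain \<phi> where \<phi>: "fst (tkz w) = toks \<phi>" using parse_ok_iff by blast
  then have "w = enc \<phi>" using bits_tkz[of w] * by (simp add: enc_toks)
  moreover have "wd_valid TYPE('w) \<phi>" using * qeval_pat[OF assms, of \<phi>] unfolding \<phi> by blast
  ultimately show "w \<in> DP_ab TYPE('w)" unfolding DP_ab_def by blast
qed

section \<open>The decision procedure as a program\<close>

text \<open>For membership only termination within bounded stacks matters, so the step count is
  hidden.\<close>

definition xc :: "nat \<Rightarrow> 'a com \<Rightarrow> (nat \<Rightarrow> 'a list) \<Rightarrow> (nat \<Rightarrow> 'a list) \<Rightarrow> bool" where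
  "xc B c \<sigma> \<sigma>' \<longleftrightarrow> (\<exists>t. exec (enat B) c \<sigma> t \<sigma>')"

lemma xc_Skip: "xc B Skip \<sigma> \<sigma>' \<longleftrightarrow> \<sigma> = \<sigma>'"
  unfolding xc_def by (subst exec.simps) auto

lemma xc_Push: "xc B (Push i a) \<sigma> \<sigma>' \<longleftrightarrow> length (\<sigma> i) < B \<and> \<sigma>(i := a # \<sigma> i) = \<sigma>'"
  unfolding xc_def by (subst exec.simps) auto

lemma xc_Pop: "xc B (Pop i) \<sigma> \<sigma>' \<longleftrightarrow> \<sigma>(i := tl (\<sigma> i)) = \<sigma>'"
  unfolding xc_def by (subst exec.simps) auto

lemma xc_Seq: "xc B (c ;; d) \<sigma> \<sigma>' \<longleftrightarrow> (\<exists>\<sigma>1. xc B c \<sigma> \<sigma>1 \<and> xc B d \<sigma>1 \<sigma>')"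
  unfolding xc_def by (subst exec.simps) auto

lemma xc_Case: "xc B (Case i f) \<sigma> \<sigma>' \<longleftrightarrow> xc B (f (tos (\<sigma> i))) \<sigma> \<sigma>'"
  unfolding xc_def by (subst exec.simps) auto

lemma xc_assoc: "xc B ((c ;; d) ;; e) \<sigma> \<sigma>' \<longleftrightarrow> xc B (c ;; d ;; e) \<sigma> \<sigma>'"
  by (auto simp: xc_Seq)

lemma xc_SeqI: "xc B c \<sigma> \<sigma>1 \<Longrightarrow> xc B d \<sigma>1 \<sigma>' \<Longrightarrow> xc B (c ;; d) \<sigma> \<sigma>'"
  by (auto simp: xc_Seq)

lemma xc_Skip_Seq: "xc B (Skip ;; c) \<sigma> \<sigma>' \<longleftrightarrow> xc B c \<sigma> \<sigma>'"
  and xc_Push_Seq: "xc B (Push i a ;; c) \<sigma> \<sigma>' \<longleftrightarrow> length (\<sigma> i) < B \<and> xc B c (\<sigma>(i := a # \<sigma> i)) \<sigma>'"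
  and xc_Pop_Seq: "xc B (Pop i ;; c) \<sigma> \<sigma>' \<longleftrightarrow> xc B c (\<sigma>(i := tl (\<sigma> i))) \<sigma>'"
  and xc_Case_Seq: "xc B (Case i f ;; c) \<sigma> \<sigma>' \<longleftrightarrow> xc B (f (tos (\<sigma> i)) ;; c) \<sigma> \<sigma>'"
  by (simp_all add: xc_Seq xc_Skip xc_Push xc_Pop xc_Case)

text \<open>Rewriting with these equivalences executes straight-line code symbolically; only loops
  need inductions.\<close>

lemmas xcs = xc_Skip xc_Push xc_Pop xc_Case xc_assoc xc_Skip_Seq xc_Push_Seq xc_Pop_Seq xc_Case_Seq

lemma xc_WhileF: "\<sigma> i = [] \<Longrightarrow> xc B (While i c) \<sigma> \<sigma>"
  unfolding xc_def by (blast intro: exec.WhileF)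

lemma xc_WhileT: "\<sigma> i \<noteq> [] \<Longrightarrow> xc B c \<sigma> \<tau> \<Longrightarrow> xc B (While i c) \<tau> \<sigma>' \<Longrightarrow> xc B (While i c) \<sigma> \<sigma>'"
  unfolding xc_def by (blast intro: exec.WhileT)

lemma xc_eq: "xc B c \<sigma> \<sigma>1 \<Longrightarrow> \<sigma>1 = \<sigma>' \<Longrightarrow> xc B c \<sigma> \<sigma>'"
  by simp

text \<open>Stack symbols: truth values, tokens, quantifiers and quantifiers with an assigned value.
  The flag distinguishes \<open>\<exists>\<close> from \<open>\<forall>\<close>.\<close>

datatype sym = Bt bool | Tk tok | Lb bool | Cl bool bool

instance tok :: finite
proof
  have "(UNIV :: tok set) \<subseteq> {TBot, TAtom, TDig False, TDig True, TNeg, TAnd, TBoxA, TBoxB}"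
  proof
    fix t :: tok
    show "t \<in> {TBot, TAtom, TDig False, TDig True, TNeg, TAnd, TBoxA, TBoxB}" by (cases t rule: bits.cases) auto
  qed
  then show "finite (UNIV :: tok set)" by (rule finite_subset) simp
qed

instance sym :: finite
proof
  have "(UNIV :: sym set) \<subseteq> range Bt \<union> range Tk \<union> range Lb \<union> range (\<lambda>(q, b). Cl q b)"
  proof
    fix s :: sym
    show "s \<in> range Bt \<union> range Tk \<union> range Lb \<union> range (\<lambda>(q, b). Cl q b)" by (cases s) auto
  qed
  then show "finite (UNIV :: sym set)" by (rule finite_subset) simp
qed

abbreviation (input) "vW \<equiv> 2 :: nat"   \<comment> \<open>tokens of the formula\<close>
abbreviation (input) "vX \<equiv> 3 :: nat"   \<comment> \<open>assigned quantifiers, innermost on top\<close>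
abbreviation (input) "vR \<equiv> 4 :: nat"   \<comment> \<open>unassigned quantifiers, outermost on top\<close>
abbreviation (input) "vY \<equiv> 5 :: nat"   \<comment> \<open>rest of the transcript of a play\<close>
abbreviation (input) "vS \<equiv> 6 :: nat"
abbreviation (input) "vA \<equiv> 7 :: nat"
abbreviation (input) "vB \<equiv> 8 :: nat"
abbreviation (input) "vM \<equiv> 9 :: nat"
abbreviation (input) "vD \<equiv> 10 :: nat"
abbreviation (input) "t1 \<equiv> 11 :: nat"
abbreviation (input) "t2 \<equiv> 12 :: nat"
abbreviation (input) "t3 \<equiv> 13 :: nat"
abbreviation (input) "t4 \<equiv> 14 :: nat"
abbreviation (input) "t5 \<equiv> 15 :: nat"
abbreviation (input) "vK \<equiv> 16 :: nat"  \<comment> \<open>loop counters\<close>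
abbreviation (input) "vJ \<equiv> 17 :: nat"
abbreviation (input) "vfl \<equiv> 18 :: nat" \<comment> \<open>flag: the defender has lost\<close>
abbreviation (input) "vmd \<equiv> 19 :: nat" \<comment> \<open>kind of the current demand\<close>
abbreviation (input) "vV \<equiv> 20 :: nat"
abbreviation (input) "vdg \<equiv> 21 :: nat"
abbreviation (input) "vbad \<equiv> 22 :: nat" \<comment> \<open>flag: ill-formed input\<close>
abbreviation (input) "vgo \<equiv> 23 :: nat"
abbreviation (input) "vP \<equiv> 24 :: nat"
abbreviation (input) "vph \<equiv> 25 :: nat" \<comment> \<open>direction of the depth-first search\<close>

definition fl :: "bool \<Rightarrow> sym list" where
  "fl b = (if b then [Bt True] else [])"

lemma fl_simps [simp]: "fl True = [Bt True]" "fl False = []" "tl (fl b) = []" "length (fl b) \<le> 1"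
  by (simp_all add: fl_def)

text \<open>The preceding \<open>Pop\<close> keeps a flag at height at most one, so that it may be
  set repeatedly.\<close>

definition setf :: "nat \<Rightarrow> sym com" where
  "setf i = Pop i ;; Push i (Bt True)"

section \<open>Moving, clearing and copying stacks\<close>

definition move :: "nat \<Rightarrow> nat \<Rightarrow> 'a com" where
  "move a b = While a (Case a (\<lambda>x. Pop a ;; Push b (the x)))"

definition clear :: "nat \<Rightarrow> 'a com" where
  "clear a = While a (Pop a)"

definition dup :: "nat \<Rightarrow> nat \<Rightarrow> nat \<Rightarrow> 'a com" where
  "dup t a b = While t (Case t (\<lambda>x. Pop t ;; Push a (the x) ;; Push b (the x)))"

text \<open>The stack is reversed onto \<open>t\<close> and reversed again by \<open>dup\<close>,
  which restores the order in both copies.\<close>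

definition copy :: "nat \<Rightarrow> nat \<Rightarrow> nat \<Rightarrow> 'a com" where
  "copy a b t = move a t ;; dup t a b"

lemma xc_move: "a \<noteq> b \<Longrightarrow> length (\<sigma> a) + length (\<sigma> b) \<le> B \<Longrightarrow>
   xc B (move a b) \<sigma> (\<sigma>(a := [], b := rev (\<sigma> a) @ \<sigma> b))"
proof (induction "\<sigma> a" arbitrary: \<sigma>)
  case Nil
  then show ?case unfolding move_def by (intro xc_eq[OF xc_WhileF]) (auto simp: fun_eq_iff)
next
  case (Cons x xs)
  let ?s = "\<sigma>(a := xs, b := x # \<sigma> b)"
  have IH: "xc B (move a b) ?s (?s(a := [], b := rev (?s a) @ ?s b))"
    by (rule Cons.hyps(1)) (use Cons.prems Cons.hyps(2)[symmetric] in auto)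
  note e = Cons.hyps(2)[symmetric]
  show ?case
    unfolding move_def
  proof (rule xc_WhileT[where \<tau> = ?s])
    show "xc B (Case a (\<lambda>x. Pop a ;; Push b (the x))) \<sigma> ?s" using Cons.prems e by (simp add: xcs fun_eq_iff)
  qed (use e in simp, rule xc_eq[OF IH[unfolded move_def]], use Cons.prems e in \<open>auto simp: fun_eq_iff\<close>)
qed

lemma xc_clear: "xc B (clear a) \<sigma> (\<sigma>(a := []))"
proof (induction "\<sigma> a" arbitrary: \<sigma>)
  case Nil
  then show ?case unfolding clear_def by (intro xc_eq[OF xc_WhileF]) (auto simp: fun_eq_iff)
next
  case (Cons x xs)
  let ?s = "\<sigma>(a := xs)"
  have IH: "xc B (clear a) ?s (?s(a := []))"
    by (rule Cons.hyps(1)) simp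
  note e = Cons.hyps(2)[symmetric]
  show ?case
    unfolding clear_def
  proof (rule xc_WhileT[where \<tau> = ?s])
    show "xc B (Pop a) \<sigma> ?s" using Cons.prems e by (simp add: xcs fun_eq_iff)
  qed (use e in simp, rule xc_eq[OF IH[unfolded clear_def]], use Cons.prems e in \<open>auto simp: fun_eq_iff\<close>)
qed

lemma xc_dup: "distinct [t, a, b] \<Longrightarrow> length (\<sigma> t) + length (\<sigma> a) \<le> B \<Longrightarrow> length (\<sigma> t) + length (\<sigma> b) \<le> B \<Longrightarrow>
   xc B (dup t a b) \<sigma> (\<sigma>(t := [], a := rev (\<sigma> t) @ \<sigma> a, b := rev (\<sigma> t) @ \<sigma> b))"
proof (induction "\<sigma> t" arbitrary: \<sigma>)
  case Nil
  then show ?case unfolding dup_def by (intro xc_eq[OF xc_WhileF]) (auto simp: fun_eq_iff)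
next
  case (Cons x xs)
  let ?s = "\<sigma>(t := xs, a := x # \<sigma> a, b := x # \<sigma> b)"
  have IH: "xc B (dup t a b) ?s (?s(t := [], a := rev (?s t) @ ?s a, b := rev (?s t) @ ?s b))"
    by (rule Cons.hyps(1)) (use Cons.prems Cons.hyps(2)[symmetric] in auto)
  note e = Cons.hyps(2)[symmetric]
  show ?case
    unfolding dup_def
  proof (rule xc_WhileT[where \<tau> = ?s])
    show "xc B (Case t (\<lambda>x. Pop t ;; Push a (the x) ;; Push b (the x))) \<sigma> ?s" using Cons.prems e by (simp add: xcs fun_eq_iff)
  qed (use e in simp, rule xc_eq[OF IH[unfolded dup_def]], use Cons.prems e in \<open>auto simp: fun_eq_iff\<close>)
qed

lemma xc_copy:
  assumes "distinct [a, b, t]" "\<sigma> t = []" "length (\<sigma> a) + length (\<sigma> b) \<le> B"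
  shows "xc B (copy a b t) \<sigma> (\<sigma>(b := \<sigma> a @ \<sigma> b))"
  unfolding copy_def
proof (rule xc_SeqI)
  show "xc B (move a t) \<sigma> (\<sigma>(a := [], t := rev (\<sigma> a) @ \<sigma> t))"
    by (rule xc_move) (use assms in auto)
  show "xc B (dup t a b) (\<sigma>(a := [], t := rev (\<sigma> a) @ \<sigma> t)) (\<sigma>(b := \<sigma> a @ \<sigma> b))"
    by (rule xc_eq[OF xc_dup]) (use assms in \<open>auto simp: fun_eq_iff\<close>)
qed

text \<open>A copy of the token stack serves as a unary counter for \<open>N\<close>, as in other
  loops of this program. The block arrives in reverse order.\<close>

definition fetch :: "nat \<Rightarrow> sym com" where
  "fetch v = copy vW t1 t2 ;; While t1 (Pop t1 ;; Case vY (\<lambda>c. Pop vY ;; Push v (the c)))"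

lemma xc_fetch:
  assumes v: "v \<notin> {vW, t1, t2, vY}" and "\<sigma> t1 = []" "\<sigma> t2 = []" "length (\<sigma> vW) \<le> length (\<sigma> vY)"
    and B: "length (\<sigma> vW) + length (\<sigma> v) \<le> B"
  shows "xc B (fetch v) \<sigma> (\<sigma>(vY := drop (length (\<sigma> vW)) (\<sigma> vY), v := rev (take (length (\<sigma> vW)) (\<sigma> vY)) @ \<sigma> v))"
proof -
  have l: "xc B (While t1 (Pop t1 ;; Case vY (\<lambda>c. Pop vY ;; Push v (the c)))) \<tau>
     (\<tau>(t1 := [], vY := drop (length (\<tau> t1)) (\<tau> vY), v := rev (take (length (\<tau> t1)) (\<tau> vY)) @ \<tau> v))"
    if "length (\<tau> t1) \<le> length (\<tau> vY)" "length (\<tau> t1) + length (\<tau> v) \<le> B" for \<tau>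
    using that
  proof (induction "\<tau> t1" arbitrary: \<tau>)
    case Nil
    then show ?case using v by (intro xc_eq[OF xc_WhileF]) (auto simp: fun_eq_iff)
  next
    case (Cons x xs)
    obtain y ys where y: "\<tau> vY = y # ys" using Cons.prems(1) Cons.hyps(2)[symmetric] by (cases "\<tau> vY") auto
    let ?s = "\<tau>(t1 := xs, vY := ys, v := y # \<tau> v)"
    let ?r = "?s(t1 := [], vY := drop (length (?s t1)) (?s vY), v := rev (take (length (?s t1)) (?s vY)) @ ?s v)"
    have 1: "xc B (While t1 (Pop t1 ;; Case vY (\<lambda>c. Pop vY ;; Push v (the c)))) ?s ?r"
      by (rule Cons.hyps(1)) (use v y Cons.prems Cons.hyps(2)[symmetric] in auto)
    show ?case
    proof (rule xc_WhileT[where \<tau> = ?s])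
      show "xc B (Pop t1 ;; Case vY (\<lambda>c. Pop vY ;; Push v (the c))) \<tau> ?s"
        using v y Cons.prems Cons.hyps(2)[symmetric] by (auto simp: xcs fun_eq_iff)
    qed (use Cons.hyps(2)[symmetric] in simp, rule xc_eq[OF 1], use v y Cons.hyps(2)[symmetric] in \<open>auto simp: fun_eq_iff\<close>)
  qed
  let ?s = "\<sigma>(t1 := \<sigma> vW @ \<sigma> t1)"
  have 1: "xc B (copy vW t1 t2) \<sigma> ?s" by (rule xc_copy) (use assms in auto)
  show ?thesis
    unfolding fetch_def by (rule xc_SeqI[OF 1], rule xc_eq[OF l]) (use assms in \<open>auto simp: fun_eq_iff\<close>)
qed

subsection \<open>Evaluation from right to left\<close>

definition ckdg :: "sym com" where
  "ckdg = Case vdg (\<lambda>x. if x = None then Skip else setf vbad) ;; Pop vdg"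

definition opV :: "(bool \<Rightarrow> sym com) \<Rightarrow> sym com" where
  "opV f = Case vV (\<lambda>x. case x of Some (Bt v) \<Rightarrow> Pop vV ;; f v | _ \<Rightarrow> setf vbad)"

fun pact :: "tok \<Rightarrow> bool \<Rightarrow> sym com" where
  "pact TBot s = ckdg ;; (if s then setf vfl else Skip) ;; Push vV (Bt s)"
| "pact TAtom s = Case vdg (\<lambda>x. if x = Some (Bt False) then setf vbad else Skip) ;; Pop vdg ;; Push vV (Bt s)"
| "pact (TDig d) s = Pop vdg ;; Push vdg (Bt d)"
| "pact TNeg s = ckdg ;; opV (\<lambda>v. if s = v then setf vfl else Skip) ;; Push vV (Bt s)"
| "pact TAnd s = ckdg ;; opV (\<lambda>u. opV (\<lambda>v. if s \<noteq> (u \<and> v) then setf vfl else Skip)) ;; Push vV (Bt s)"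
| "pact TBoxA s = ckdg ;; opV (\<lambda>v. Skip) ;; Push vV (Bt s)"
| "pact TBoxB s = ckdg ;; opV (\<lambda>v. Skip) ;; Push vV (Bt s)"

definition pbody :: "sym com" where
  "pbody = Case t1 (\<lambda>t. Pop t1 ;; Case t2 (\<lambda>s. Pop t2 ;;
     (case t of Some (Tk k) \<Rightarrow> pact k (s = Some (Bt True)) | _ \<Rightarrow> Skip)))"

fun pst :: "(nat \<Rightarrow> sym list) \<Rightarrow> tok list \<Rightarrow> bool list \<Rightarrow> pstate \<Rightarrow> nat \<Rightarrow> sym list" where
  "pst \<sigma> ws ss (V, dg, bad, inc) = \<sigma>(t1 := map Tk ws, t2 := map Bt ss, vV := map Bt V,
     vdg := (case dg of None \<Rightarrow> [] | Some d \<Rightarrow> [Bt d]), vbad := fl bad, vfl := fl inc)"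

lemma tos_Bt: "tos (map Bt ss) = Some (Bt True) \<longleftrightarrow> hdF ss"
  by (cases ss) (auto simp: hdF_def)

lemma pbody_step:
  assumes "length (fst st) < B" "0 < B"
  shows "xc B pbody (pst \<sigma> (t # ws) ss st) (pst \<sigma> ws (tl ss) (pstep t (hdF ss) st))"
proof -
  obtain V dg bad inc where st: "st = (V, dg, bad, inc)" by (cases st) auto
  note defs = pbody_def xcs ckdg_def opV_def setf_def tos_Bt map_tl fun_eq_iff
  show ?thesis
  proof (cases t)
    case TBot
    then show ?thesis using assms by (cases dg) (auto simp: st defs)
  next
    case TAtom
    then show ?thesis using assms by (cases dg) (auto simp: st defs)
  next
    case (TDig d)
    then show ?thesis using assms by (cases dg) (auto simp: st defs)
  next
    case TNeg
    then show ?thesis using assms by (cases dg; cases V) (auto simp: st defs)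
  next
    case TAnd
    then show ?thesis using assms
      by (cases dg; cases V; cases "tl V"; cases "hd V"; cases "hd (tl V)") (auto simp: st defs)
  next
    case TBoxA
    then show ?thesis using assms by (cases dg; cases V) (auto simp: st defs)
  next
    case TBoxB
    then show ?thesis using assms by (cases dg; cases V) (auto simp: st defs)
  qed
qed

lemma length_pstep: "length (fst (pstep t s st)) \<le> Suc (length (fst st))"
  by (cases st; cases t) auto

lemma xc_ploop: "length (fst st) + length ws \<le> B \<Longrightarrow> 0 < B \<Longrightarrow>
    xc B (While t1 pbody) (pst \<sigma> ws ss st) (pst \<sigma> [] (drop (length ws) ss) (prun ws ss st))"
proof (induction ws arbitrary: ss st)
  case Nil
  show ?case by (cases st) (auto intro!: xc_WhileF)
next
  case (Cons t ws)
  have b: "xc B pbody (pst \<sigma> (t # ws) ss st) (pst \<sigma> ws (tl ss) (pstep t (hdF ss) st))"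
    by (rule pbody_step) (use Cons.prems in auto)
  have "xc B (While t1 pbody) (pst \<sigma> ws (tl ss) (pstep t (hdF ss) st))
     (pst \<sigma> [] (drop (length ws) (tl ss)) (prun ws (tl ss) (pstep t (hdF ss) st)))"
    by (rule Cons.IH) (use Cons.prems length_pstep[of t "hdF ss" st] in auto)
  moreover have "pst \<sigma> (t # ws) ss st t1 \<noteq> []" by (cases st) simp
  ultimately have "xc B (While t1 pbody) (pst \<sigma> (t # ws) ss st)
     (pst \<sigma> [] (drop (length ws) (tl ss)) (prun ws (tl ss) (pstep t (hdF ss) st)))"
    using b by (blast intro: xc_WhileT)
  then show ?case by (simp add: drop_Suc del: pst.simps)
qed

text \<open>Each list is copied and then moved, hence reversed, because the scan goes from right to
  left. The code serves both for parsing, with \<open>vS\<close> empty, and for checking the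
  consistency of a type.\<close>

definition pass :: "sym com" where
  "pass = copy vW t2 t1 ;; move t2 t1 ;; copy vS t3 t2 ;; move t3 t2 ;; While t1 pbody ;; clear t2"

lemma xc_pass:
  assumes "\<sigma> vW = map Tk W" "\<sigma> vS = map Bt S" "\<sigma> t1 = []" "\<sigma> t2 = []" "\<sigma> t3 = []" "\<sigma> vV = []" "\<sigma> vdg = []"
    "\<sigma> vbad = fl b" "\<sigma> vfl = fl f"
    and B: "length W \<le> B" "length S \<le> B" "0 < B"
    and p: "prun (rev W) (rev S) ([], None, b, f) = (V, dg, b', f')"
  shows "xc B pass \<sigma> (\<sigma>(vV := map Bt V, vdg := (case dg of None \<Rightarrow> [] | Some d \<Rightarrow> [Bt d]), vbad := fl b', vfl := fl f'))"
proof -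
  let ?s1 = "\<sigma>(t2 := map Tk W)" and ?s2 = "\<sigma>(t1 := map Tk (rev W))"
  let ?s3 = "?s2(t3 := map Bt S)" and ?s4 = "?s2(t2 := map Bt (rev S))"
  have 1: "xc B (copy vW t2 t1) \<sigma> ?s1" by (rule xc_eq[OF xc_copy]) (use assms in \<open>auto simp: fun_eq_iff\<close>)
  have 2: "xc B (move t2 t1) ?s1 ?s2" by (rule xc_eq[OF xc_move]) (use assms in \<open>auto simp: fun_eq_iff rev_map\<close>)
  have 3: "xc B (copy vS t3 t2) ?s2 ?s3" by (rule xc_eq[OF xc_copy]) (use assms in \<open>auto simp: fun_eq_iff\<close>)
  have 4: "xc B (move t3 t2) ?s3 ?s4" by (rule xc_eq[OF xc_move]) (use assms in \<open>auto simp: fun_eq_iff rev_map\<close>)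
  have e: "?s4 = pst \<sigma> (rev W) (rev S) ([], None, b, f)" using assms by (auto simp: fun_eq_iff)
  have 5: "xc B (While t1 pbody) ?s4 (pst \<sigma> [] (drop (length W) (rev S)) (V, dg, b', f'))"
    unfolding e using xc_ploop[of "([], None, b, f)" "rev W" B \<sigma> "rev S"] B p by simp
  show ?thesis
    unfolding pass_def
    by (rule xc_SeqI[OF 1 xc_SeqI[OF 2 xc_SeqI[OF 3 xc_SeqI[OF 4 xc_SeqI[OF 5 xc_eq[OF xc_clear]]]]]])
      (use assms in \<open>auto simp: fun_eq_iff\<close>)
qed

subsection \<open>Comparison of types\<close>

text \<open>\<open>bsub\<close> as a loop over three lists. Entries read beyond the end of a list
  count as false, in agreement with the length conditions of \<open>bsub\<close>.\<close>

fun bs :: "tok \<Rightarrow> tok list \<Rightarrow> bool list \<Rightarrow> bool list \<Rightarrow> bool" where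
  "bs X [] S M = True"
| "bs X (t # W) S M = ((t = X \<and> hdF S \<longrightarrow> hdF (tl M)) \<and> bs X W (tl S) (tl M))"

lemma bs_bsub: "bs X W S M \<longleftrightarrow> bsub X W S M"
proof (induction W arbitrary: S M)
  case (Cons t W)
  have "bsub X (t # W) S M \<longleftrightarrow> (t = X \<and> hdF S \<longrightarrow> hdF (tl M)) \<and> bsub X W (tl S) (tl M)"
    unfolding bsub_def length_Cons All_less_Suc2
    by (cases S; cases M; cases "tl M") (auto simp: hdF_def nth_tl)
  then show ?case using Cons by simp
qed (simp add: bsub_def)

definition sbody :: "tok \<Rightarrow> sym com" where
  "sbody X = Case t1 (\<lambda>t. Pop t1 ;; Case t2 (\<lambda>s. Pop t2 ;; Pop t3 ;;
     (if t = Some (Tk X) \<and> s = Some (Bt True) then Case t3 (\<lambda>m. if m = Some (Bt True) then Skip else setf vfl) else Skip)))"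

definition sub :: "tok \<Rightarrow> nat \<Rightarrow> nat \<Rightarrow> sym com" where
  "sub X s m = copy vW t1 t4 ;; copy s t2 t4 ;; copy m t3 t4 ;; While t1 (sbody X) ;; clear t2 ;; clear t3"

definition sst :: "(nat \<Rightarrow> sym list) \<Rightarrow> tok list \<Rightarrow> bool list \<Rightarrow> bool list \<Rightarrow> bool \<Rightarrow> nat \<Rightarrow> sym list" where
  "sst \<sigma> ws S M f = \<sigma>(t1 := map Tk ws, t2 := map Bt S, t3 := map Bt M, vfl := fl f)"

lemma xc_sloop: "0 < B \<Longrightarrow> xc B (While t1 (sbody X)) (sst \<sigma> ws S M f)
    (sst \<sigma> [] (drop (length ws) S) (drop (length ws) M) (f \<or> \<not> bs X ws S M))"
proof (induction ws arbitrary: S M f)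
  case Nil
  show ?case by (auto simp: sst_def intro!: xc_WhileF)
next
  case (Cons t ws)
  have b: "xc B (sbody X) (sst \<sigma> (t # ws) S M f) (sst \<sigma> ws (tl S) (tl M) (f \<or> \<not> (t = X \<and> hdF S \<longrightarrow> hdF (tl M))))"
    using Cons.prems by (auto simp: sbody_def xcs sst_def setf_def tos_Bt map_tl[symmetric] fun_eq_iff)
  show ?case
    by (rule xc_WhileT[OF _ b], simp add: sst_def, rule xc_eq[OF Cons.IH[OF Cons.prems]])
      (auto simp: drop_Suc intro!: arg_cong[where f = "sst _ _ _ _"])
qed

lemma xc_sub:
  assumes "\<sigma> vW = map Tk W" "\<sigma> s = map Bt S" "\<sigma> m = map Bt M" "\<sigma> vfl = fl f"
    "\<sigma> t1 = []" "\<sigma> t2 = []" "\<sigma> t3 = []" "\<sigma> t4 = []"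
    and "s \<notin> {t1, t2, t3, t4}" "m \<notin> {t1, t2, t3, t4}"
    and B: "length W \<le> B" "length S \<le> B" "length M \<le> B" "0 < B"
  shows "xc B (sub X s m) \<sigma> (\<sigma>(vfl := fl (f \<or> \<not> bsub X W S M)))"
proof -
  let ?s1 = "\<sigma>(t1 := map Tk W)" and ?s2 = "\<sigma>(t1 := map Tk W, t2 := map Bt S)"
  have 1: "xc B (copy vW t1 t4) \<sigma> ?s1" by (rule xc_eq[OF xc_copy]) (use assms in \<open>auto simp: fun_eq_iff\<close>)
  have 2: "xc B (copy s t2 t4) ?s1 ?s2" by (rule xc_eq[OF xc_copy]) (use assms in \<open>auto simp: fun_eq_iff\<close>)
  have 3: "xc B (copy m t3 t4) ?s2 (sst \<sigma> W S M f)"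
    by (rule xc_eq[OF xc_copy]) (use assms in \<open>auto simp: fun_eq_iff sst_def\<close>)
  have 5: "xc B (clear t2 ;; clear t3) (sst \<sigma> [] (drop (length W) S) (drop (length W) M) (f \<or> \<not> bs X W S M))
    (\<sigma>(vfl := fl (f \<or> \<not> bsub X W S M)))"
    by (rule xc_SeqI[OF xc_clear xc_eq[OF xc_clear]]) (use assms in \<open>auto simp: fun_eq_iff sst_def bs_bsub\<close>)
  show ?thesis
    unfolding sub_def
    by (rule xc_SeqI[OF 1 xc_SeqI[OF 2 xc_SeqI[OF 3 xc_SeqI[OF xc_sloop[OF B(4)] 5]]]])
qed

subsection \<open>Challenges\<close>

definition isd :: "sym option \<Rightarrow> bool" where
  "isd x = (case x of Some (Tk t) \<Rightarrow> is_dig t | _ \<Rightarrow> False)"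

text \<open>Equal digits are removed from both tops. At the first other pair the loop ends, and the
  numerals agree iff neither top is a digit. The flag \<open>vgo\<close> controls the loop because
  its end is not marked by an empty stack.\<close>

definition cmpb :: "sym com" where
  "cmpb = Case vP (\<lambda>p. Case t1 (\<lambda>q. if p = q \<and> isd p then Pop vP ;; Pop t1
     else if isd p \<or> isd q then Pop vgo else Pop vgo ;; setf vfl))"

definition cmp :: "sym com" where
  "cmp = Push vgo (Bt True) ;; While vgo cmpb"

lemma xc_cmp:
  assumes "\<sigma> vgo = []" "0 < B"
  shows "\<exists>p w. xc B cmp (\<sigma>(vP := map Tk P, t1 := map Tk W, vfl := fl f))
    (\<sigma>(vP := p, t1 := w, vfl := fl (f \<or> digits P = digits W)))"
proof -
  let ?g = "\<sigma>(vgo := [Bt True])"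
  have "\<exists>p w. xc B (While vgo cmpb) (?g(vP := map Tk P, t1 := map Tk W, vfl := fl f))
    (\<sigma>(vP := p, t1 := w, vfl := fl (f \<or> digits P = digits W)))"
  proof (induction P arbitrary: W)
    case Nil
    let ?e = "digits [] = digits W"
    let ?r = "\<sigma>(vP := [], t1 := map Tk W, vfl := fl (f \<or> ?e))"
    have e: "?e \<longleftrightarrow> \<not> isd (tos (map Tk W))" by (cases W) (auto simp: digits_def isd_def)
    have "xc B cmpb (?g(vP := map Tk [], t1 := map Tk W, vfl := fl f)) ?r"
      using assms e by (auto simp: cmpb_def xcs setf_def isd_def fun_eq_iff)
    then have "xc B (While vgo cmpb) (?g(vP := map Tk [], t1 := map Tk W, vfl := fl f)) ?r"
      by (rule xc_WhileT[OF _ _ xc_WhileF, rotated]) (use assms in auto)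
    moreover have "?r = \<sigma>(vP := [], t1 := map Tk W, vfl := fl (f \<or> digits [] = digits W))" ..
    ultimately show ?case by blast
  next
    case (Cons t P)
    show ?case
    proof (cases "is_dig t \<and> tos W = Some t")
      case True
      then obtain W' where W: "W = t # W'" by (cases W) auto
      have b: "xc B cmpb (?g(vP := map Tk (t # P), t1 := map Tk W, vfl := fl f)) (?g(vP := map Tk P, t1 := map Tk W', vfl := fl f))"
        using True by (auto simp: cmpb_def xcs isd_def W fun_eq_iff)
      have eq: "(digits (t # P) = digits W) = (digits P = digits W')" using True by (simp add: digits_def W)
      obtain p w where "xc B (While vgo cmpb) (?g(vP := map Tk P, t1 := map Tk W', vfl := fl f))
          (\<sigma>(vP := p, t1 := w, vfl := fl (f \<or> digits P = digits W')))"
        using Cons.IH[of W'] by blast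
      then have "xc B (While vgo cmpb) (?g(vP := map Tk (t # P), t1 := map Tk W, vfl := fl f))
          (\<sigma>(vP := p, t1 := w, vfl := fl (f \<or> digits P = digits W')))"
        by (rule xc_WhileT[OF _ b, rotated]) simp
      then show ?thesis unfolding eq by blast
    next
      case False
      let ?e = "digits (t # P) = digits W"
      let ?r = "\<sigma>(vP := map Tk (t # P), t1 := map Tk W, vfl := fl (f \<or> ?e))"
      have e: "?e \<longleftrightarrow> \<not> is_dig t \<and> \<not> isd (tos (map Tk W))"
        using False by (cases W) (auto simp: digits_def isd_def)
      have n: "\<not> (Some (Tk t) = tos (map Tk W) \<and> is_dig t)" using False by (cases W) auto
      have "xc B cmpb (?g(vP := map Tk (t # P), t1 := map Tk W, vfl := fl f)) ?r"
        using assms e n by (auto simp: cmpb_def xcs setf_def isd_def[of "Some _"] fun_eq_iff)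
      then have "xc B (While vgo cmpb) (?g(vP := map Tk (t # P), t1 := map Tk W, vfl := fl f)) ?r"
        by (rule xc_WhileT[OF _ _ xc_WhileF, rotated]) (use assms in auto)
      then show ?thesis by blast
    qed
  qed
  then show ?thesis
    using assms unfolding cmp_def by (auto simp: xcs fun_upd_twist)
qed

definition abody :: "bool \<Rightarrow> sym com" where
  "abody s = Case t1 (\<lambda>t. Pop t1 ;; Case t2 (\<lambda>s'. Pop t2 ;; Case t3 (\<lambda>d. Pop t3 ;;
     (if d = Some (Bt True) then (if t = Some (Tk TAtom) \<and> s' \<noteq> Some (Bt s) then cmp else Skip) ;; clear t1 else Skip))))"

lemma xc_aloop:
  assumes "\<sigma> vgo = []" "0 < B" "length S = length W" "length D = length W"
  shows "\<exists>p s' d. xc B (While t1 (abody s))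
     (\<sigma>(vP := map Tk P, t1 := map Tk W, t2 := map Bt S, t3 := map Bt D, vfl := fl f))
     (\<sigma>(vP := p, t1 := [], t2 := s', t3 := d, vfl := fl (f \<or> ascan s P W S D)))"
  using assms(3,4)
proof (induction W arbitrary: S D)
  case Nil
  then show ?case by (intro exI xc_eq[OF xc_WhileF]) (auto simp: fun_eq_iff)
next
  case (Cons t W)
  obtain b S' d D' where e: "S = b # S'" "D = d # D'" "length S' = length W" "length D' = length W"
    using Cons.prems by (metis length_Suc_conv)
  let ?s0 = "\<sigma>(vP := map Tk P, t1 := map Tk (t # W), t2 := map Bt S, t3 := map Bt D, vfl := fl f)"
  show ?case
  proof (cases d)
    case False
    let ?s1 = "\<sigma>(vP := map Tk P, t1 := map Tk W, t2 := map Bt S', t3 := map Bt D', vfl := fl f)"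
    have 1: "xc B (abody s) ?s0 ?s1" using False by (auto simp: abody_def xcs e fun_eq_iff)
    have eq: "ascan s P (t # W) S D = ascan s P W S' D'" using False by (simp add: e hdF_def)
    obtain p s' d'' where "xc B (While t1 (abody s)) ?s1
        (\<sigma>(vP := p, t1 := [], t2 := s', t3 := d'', vfl := fl (f \<or> ascan s P W S' D')))"
      using Cons.IH[OF e(3,4)] by blast
    then have "xc B (While t1 (abody s)) ?s0
        (\<sigma>(vP := p, t1 := [], t2 := s', t3 := d'', vfl := fl (f \<or> ascan s P W S' D')))"
      by (rule xc_WhileT[OF _ 1, rotated]) simp
    then show ?thesis unfolding eq by blast
  next
    case True
    let ?a = "t = TAtom \<and> b \<noteq> s \<and> digits P = digits W"
    have a: "ascan s P (t # W) S D = ?a" using True by (simp add: e hdF_def)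
    let ?\<tau> = "\<sigma>(t2 := map Bt S', t3 := map Bt D')"
    have "\<exists>p. xc B (abody s) ?s0 (\<sigma>(vP := p, t1 := [], t2 := map Bt S', t3 := map Bt D', vfl := fl (f \<or> ?a)))"
    proof (cases "t = TAtom \<and> b \<noteq> s")
      case c: True
      obtain p w where p: "xc B cmp (?\<tau>(vP := map Tk P, t1 := map Tk W, vfl := fl f))
          (?\<tau>(vP := p, t1 := w, vfl := fl (f \<or> digits P = digits W)))"
        using xc_cmp[of ?\<tau> B P W f] assms by auto
      have "xc B (cmp ;; clear t1) (?\<tau>(vP := map Tk P, t1 := map Tk W, vfl := fl f))
         (\<sigma>(vP := p, t1 := [], t2 := map Bt S', t3 := map Bt D', vfl := fl (f \<or> ?a)))"
        by (rule xc_SeqI[OF p xc_eq[OF xc_clear]]) (use c in \<open>auto simp: fun_eq_iff\<close>)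
      moreover have "?\<tau>(vP := map Tk P, t1 := map Tk W, vfl := fl f)
         = ?s0(t1 := map Tk W, t2 := map Bt S', t3 := map Bt D')" by (auto simp: fun_eq_iff)
      ultimately show ?thesis using c True by (intro exI[of _ p]) (simp add: abody_def xcs e)
    next
      case c: False
      have "xc B (clear t1) (?s0(t1 := map Tk W, t2 := map Bt S', t3 := map Bt D'))
         (\<sigma>(vP := map Tk P, t1 := [], t2 := map Bt S', t3 := map Bt D', vfl := fl (f \<or> ?a)))"
        by (rule xc_eq[OF xc_clear]) (use c in \<open>auto simp: fun_eq_iff\<close>)
      then show ?thesis using c True by (intro exI[of _ "map Tk P"]) (auto simp: abody_def xcs e)
    qed
    then obtain p where p: "xc B (abody s) ?s0 (\<sigma>(vP := p, t1 := [], t2 := map Bt S', t3 := map Bt D', vfl := fl (f \<or> ?a)))"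
      by blast
    have "xc B (While t1 (abody s)) ?s0 (\<sigma>(vP := p, t1 := [], t2 := map Bt S', t3 := map Bt D', vfl := fl (f \<or> ?a)))"
      by (rule xc_WhileT[OF _ p xc_WhileF]) simp_all
    then show ?thesis unfolding a by blast
  qed
qed

text \<open>After the pops the top of \<open>t5\<close> is the value that \<open>A\<close> gives to
  the next position, which is the argument if the current token is a box. Emptying \<open>t1\<close>
  ends the loop at the first mark.\<close>

definition dbody :: "sym com" where
  "dbody = Case t1 (\<lambda>t. Pop t1 ;; Case t2 (\<lambda>s. Pop t2 ;; Case t3 (\<lambda>d. Pop t3 ;; Pop t5 ;;
     (if d \<noteq> Some (Bt True) then Skip
      else if t = Some (Tk TBoxA) \<or> t = Some (Tk TBoxB) then
        (if s = Some (Bt True) then clear t1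
         else Push vmd (the t) ;; Case t5 (\<lambda>a. if a = Some (Bt True) then setf vfl else Skip) ;; clear t1)
      else if t = Some (Tk TAtom) then copy t1 vP t4 ;; While t1 (abody (s = Some (Bt True))) ;; clear vP
      else clear t1))))"

definition md :: "tok option \<Rightarrow> sym list" where
  "md m = (case m of None \<Rightarrow> [] | Some X \<Rightarrow> [Tk X])"

lemma xc_dloop:
  assumes "\<sigma> vgo = []" "\<sigma> vP = []" "\<sigma> t4 = []" "\<sigma> vmd = []" "length W \<le> B" "0 < B"
    "length S = length W" "length D = length W"
  shows "\<exists>s d a. xc B (While t1 dbody)
     (\<sigma>(t1 := map Tk W, t2 := map Bt S, t3 := map Bt D, t5 := map Bt A, vfl := fl f))
     (\<sigma>(t1 := [], t2 := s, t3 := d, t5 := a, vmd := md (fst (dscan W S D A)), vfl := fl (f \<or> snd (dscan W S D A))))"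
  using assms(5,7,8)
proof (induction W arbitrary: S D A)
  case Nil
  have "xc B (While t1 dbody) (\<sigma>(t1 := map Tk [], t2 := map Bt S, t3 := map Bt D, t5 := map Bt A, vfl := fl f))
    (\<sigma>(t1 := [], t2 := map Bt S, t3 := map Bt D, t5 := map Bt A, vmd := md (fst (dscan [] S D A)),
       vfl := fl (f \<or> snd (dscan [] S D A))))"
    by (rule xc_eq[OF xc_WhileF]) (use assms in \<open>auto simp: fun_eq_iff md_def\<close>)
  then show ?case by blast
next
  case (Cons t W)
  obtain b S' d D' where e: "S = b # S'" "D = d # D'" "length S' = length W" "length D' = length W"
    using Cons.prems by (metis length_Suc_conv)
  let ?s0 = "\<sigma>(t1 := map Tk (t # W), t2 := map Bt S, t3 := map Bt D, t5 := map Bt A, vfl := fl f)"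
  let ?s1 = "\<sigma>(t1 := map Tk W, t2 := map Bt S', t3 := map Bt D', t5 := map Bt (tl A), vfl := fl f)"
  let ?fin = "\<lambda>s d a m l. \<sigma>(t1 := [], t2 := s, t3 := d, t5 := a, vmd := md m, vfl := fl (f \<or> l))"
  have s1: "?s0(t1 := map Tk W, t2 := map Bt S', t3 := map Bt D', t5 := map Bt (tl A)) = ?s1"
    by (auto simp: fun_eq_iff)
  have body: "xc B dbody ?s0 r" if "xc B
     (if \<not> d then Skip
      else if t = TBoxA \<or> t = TBoxB then
        (if b then clear t1
         else Push vmd (Tk t) ;; Case t5 (\<lambda>a. if a = Some (Bt True) then setf vfl else Skip) ;; clear t1)
      else if t = TAtom then copy t1 vP t4 ;; While t1 (abody b) ;; clear vP
      else clear t1) ?s1 r" for r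
  proof -
    let ?a1 = "?s0(t1 := map Tk W)"
    let ?a2 = "?s0(t1 := map Tk W, t2 := map Bt S')"
    let ?a3 = "?s0(t1 := map Tk W, t2 := map Bt S', t3 := map Bt D')"
    have v: "?s0 t1 = Tk t # map Tk W" "?a1 t2 = Bt b # map Bt S'" "?a2 t3 = Bt d # map Bt D'"
      by (simp_all add: e)
    have p1: "xc B (Pop t1) ?s0 ?a1" by (auto simp: xcs fun_eq_iff)
    have p2: "xc B (Pop t2) ?a1 ?a2" by (auto simp: xcs e fun_eq_iff)
    have p3: "xc B (Pop t3) ?a2 ?a3" by (auto simp: xcs e fun_eq_iff)
    have p5: "xc B (Pop t5) ?a3 ?s1" by (auto simp: xcs map_tl fun_eq_iff)
    have cmd: "(if Some (Bt d) \<noteq> Some (Bt True) then Skip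
      else if Some (Tk t) = Some (Tk TBoxA) \<or> Some (Tk t) = Some (Tk TBoxB) then
        (if Some (Bt b) = Some (Bt True) then clear t1
         else Push vmd (the (Some (Tk t))) ;; Case t5 (\<lambda>a. if a = Some (Bt True) then setf vfl else Skip) ;; clear t1)
      else if Some (Tk t) = Some (Tk TAtom) then copy t1 vP t4 ;; While t1 (abody (Some (Bt b) = Some (Bt True))) ;; clear vP
      else clear t1) =
     (if \<not> d then Skip
      else if t = TBoxA \<or> t = TBoxB then
        (if b then clear t1
         else Push vmd (Tk t) ;; Case t5 (\<lambda>a. if a = Some (Bt True) then setf vfl else Skip) ;; clear t1)
      else if t = TAtom then copy t1 vP t4 ;; While t1 (abody b) ;; clear vP
      else clear t1)" by simp
    show ?thesis
      unfolding dbody_def xc_Case v(1) tos.simps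
      apply (rule xc_SeqI[OF p1])
      unfolding xc_Case v(2) tos.simps
      apply (rule xc_SeqI[OF p2])
      unfolding xc_Case v(3) tos.simps
      apply (rule xc_SeqI[OF p3 xc_SeqI[OF p5]])
      unfolding cmd by (rule that)
  qed
  show ?case
  proof (cases d)
    case False
    have 1: "xc B dbody ?s0 ?s1" by (rule body) (use False in \<open>simp add: xcs\<close>)
    have eq: "dscan (t # W) S D A = dscan W S' D' (tl A)" using False by (simp add: e hdF_def)
    have "\<exists>s d a. xc B (While t1 dbody) ?s1 (?fin s d a (fst (dscan W S' D' (tl A))) (snd (dscan W S' D' (tl A))))"
      by (rule Cons.IH) (use Cons.prems e in auto)
    then obtain s d a where "xc B (While t1 dbody) ?s1 (?fin s d a (fst (dscan W S' D' (tl A))) (snd (dscan W S' D' (tl A))))"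
      by blast
    then have "xc B (While t1 dbody) ?s0 (?fin s d a (fst (dscan W S' D' (tl A))) (snd (dscan W S' D' (tl A))))"
      by (rule xc_WhileT[OF _ 1, rotated]) simp
    then show ?thesis unfolding eq by blast
  next
    case True
    have step: "xc B (While t1 dbody) ?s0 (?fin s d a m l)" if "xc B dbody ?s0 (?fin s d a m l)" for s d a m l
      by (rule xc_WhileT[OF _ that xc_WhileF]) simp_all
    let ?dd = "dscan (t # W) S D A"
    have "\<exists>s d a. xc B dbody ?s0 (?fin s d a (fst ?dd) (snd ?dd))"
    proof -
      consider (void) "t = TBoxA \<or> t = TBoxB \<longrightarrow> b" "t \<noteq> TAtom" | (box0) "t = TBoxA \<or> t = TBoxB" "\<not> b" | (atom) "t = TAtom"
        by blast
      then show ?thesis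
      proof cases
        case void
        have dd: "?dd = (None, False)" using True void by (auto simp: e hdF_def)
        have "xc B (clear t1) ?s1 (?fin (map Bt S') (map Bt D') (map Bt (tl A)) None False)"
          by (rule xc_eq[OF xc_clear]) (use assms in \<open>auto simp: fun_eq_iff md_def\<close>)
        then have "xc B dbody ?s0 (?fin (map Bt S') (map Bt D') (map Bt (tl A)) None False)"
          by (intro body) (use True void in auto)
        then show ?thesis unfolding dd fst_conv snd_conv by blast
      next
        case box0
        have dd: "?dd = (Some t, hdF (tl A))" using True box0 by (auto simp: e hdF_def)
        let ?r = "?fin (map Bt S') (map Bt D') (map Bt (tl A)) (Some t) (hdF (tl A))"
        have 1: "xc B (Push vmd (Tk t)) ?s1 (?s1(vmd := [Tk t]))" using assms by (auto simp: xcs fun_eq_iff)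
        have 2: "xc B (Case t5 (\<lambda>a. if a = Some (Bt True) then setf vfl else Skip))
          (?s1(vmd := [Tk t])) (?s1(vmd := [Tk t], vfl := fl (f \<or> hdF (tl A))))"
          using assms by (auto simp: xcs setf_def tos_Bt fun_eq_iff)
        have 3: "xc B (clear t1) (?s1(vmd := [Tk t], vfl := fl (f \<or> hdF (tl A)))) ?r"
          by (rule xc_eq[OF xc_clear]) (use assms in \<open>auto simp: fun_eq_iff md_def\<close>)
        have "xc B dbody ?s0 ?r"
          by (rule body) (use True box0 xc_SeqI[OF 1 xc_SeqI[OF 2 3]] in auto)
        then show ?thesis unfolding dd fst_conv snd_conv by blast
      next
        case atom
        have dd: "?dd = (None, ascan b W W S' D')" using True atom by (auto simp: e hdF_def)
        have 1: "xc B (copy t1 vP t4) ?s1 (?s1(vP := map Tk W))"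
          by (rule xc_eq[OF xc_copy]) (use assms Cons.prems in \<open>auto simp: fun_eq_iff\<close>)
        let ?\<tau> = "\<sigma>(t5 := map Bt (tl A))"
        have t: "?s1(vP := map Tk W) = ?\<tau>(vP := map Tk W, t1 := map Tk W, t2 := map Bt S', t3 := map Bt D', vfl := fl f)"
          by (auto simp: fun_eq_iff)
        obtain p s' d' where 2: "xc B (While t1 (abody b)) (?s1(vP := map Tk W))
          (?\<tau>(vP := p, t1 := [], t2 := s', t3 := d', vfl := fl (f \<or> ascan b W W S' D')))"
          unfolding t using xc_aloop[of ?\<tau> B S' W D' b W f] assms e by auto
        let ?r = "?fin s' d' (map Bt (tl A)) None (ascan b W W S' D')"
        have 3: "xc B (clear vP) (?\<tau>(vP := p, t1 := [], t2 := s', t3 := d', vfl := fl (f \<or> ascan b W W S' D'))) ?r"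
          by (rule xc_eq[OF xc_clear]) (use assms in \<open>auto simp: fun_eq_iff md_def\<close>)
        have "xc B dbody ?s0 ?r"
          by (rule body) (use True atom xc_SeqI[OF 1 xc_SeqI[OF 2 3]] in auto)
        then show ?thesis unfolding dd fst_conv snd_conv by blast
      qed
    qed
    then show ?thesis using step by blast
  qed
qed

definition challenge :: "sym com" where
  "challenge = copy vW t1 t4 ;; copy vS t2 t4 ;; copy vD t3 t4 ;; copy vA t5 t4 ;; While t1 dbody ;;
     clear t2 ;; clear t3 ;; clear t5"

lemma xc_challenge:
  assumes "\<sigma> vW = map Tk W" "\<sigma> vS = map Bt S" "\<sigma> vD = map Bt D" "\<sigma> vA = map Bt A" "\<sigma> vfl = fl f"
    "\<sigma> t1 = []" "\<sigma> t2 = []" "\<sigma> t3 = []" "\<sigma> t4 = []" "\<sigma> t5 = []" "\<sigma> vgo = []" "\<sigma> vP = []" "\<sigma> vmd = []"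
    and B: "length W \<le> B" "length S = length W" "length D = length W" "length A = length W" "0 < B"
  shows "xc B challenge \<sigma> (\<sigma>(vmd := md (fst (dscan W S D A)), vfl := fl (f \<or> snd (dscan W S D A))))"
proof -
  let ?s1 = "\<sigma>(t1 := map Tk W)" and ?s2 = "\<sigma>(t1 := map Tk W, t2 := map Bt S)"
  let ?s3 = "?s2(t3 := map Bt D)"
  let ?s4 = "\<sigma>(t1 := map Tk W, t2 := map Bt S, t3 := map Bt D, t5 := map Bt A, vfl := fl f)"
  have 1: "xc B (copy vW t1 t4) \<sigma> ?s1" by (rule xc_eq[OF xc_copy]) (use assms in \<open>auto simp: fun_eq_iff\<close>)
  have 2: "xc B (copy vS t2 t4) ?s1 ?s2" by (rule xc_eq[OF xc_copy]) (use assms in \<open>auto simp: fun_eq_iff\<close>)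
  have 3: "xc B (copy vD t3 t4) ?s2 ?s3" by (rule xc_eq[OF xc_copy]) (use assms in \<open>auto simp: fun_eq_iff\<close>)
  have 4: "xc B (copy vA t5 t4) ?s3 ?s4" by (rule xc_eq[OF xc_copy]) (use assms in \<open>auto simp: fun_eq_iff\<close>)
  obtain s d a where 5: "xc B (While t1 dbody) ?s4
     (\<sigma>(t1 := [], t2 := s, t3 := d, t5 := a, vmd := md (fst (dscan W S D A)), vfl := fl (f \<or> snd (dscan W S D A))))"
    using xc_dloop[of \<sigma> W B S D A f] assms by auto
  show ?thesis
    unfolding challenge_def
    by (rule xc_SeqI[OF 1 xc_SeqI[OF 2 xc_SeqI[OF 3 xc_SeqI[OF 4 xc_SeqI[OF 5
        xc_SeqI[OF xc_clear xc_SeqI[OF xc_clear xc_eq[OF xc_clear]]]]]]]])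
      (use assms in \<open>auto simp: fun_eq_iff\<close>)
qed

subsection \<open>A play\<close>

text \<open>Bit \<open>True\<close> selects the half that starts with the middle type,
  \<open>False\<close> the half that ends before it. The detour over \<open>t1\<close> preserves the
  order of the bits.\<close>

definition hbody :: "sym com" where
  "hbody = Pop vJ ;; fetch vM ;; Case vY (\<lambda>c. Pop vY ;;
     (if c = Some (Bt True) then clear vA ;; move vM t1 ;; move t1 vA
      else clear vB ;; move vM t1 ;; move t1 vB))"

definition hst :: "(nat \<Rightarrow> sym list) \<Rightarrow> sym list \<Rightarrow> bool list \<Rightarrow> bool list \<Rightarrow> bool list \<Rightarrow> nat \<Rightarrow> sym list" where
  "hst \<sigma> js A B Y = \<sigma>(vJ := js, vA := map Bt A, vB := map Bt B, vY := map Bt Y)"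

lemma xc_hbody:
  assumes "\<sigma> vW = map Tk W" "\<sigma> t1 = []" "\<sigma> t2 = []" "\<sigma> vM = []" "length W < length Y" "length W \<le> n"
  shows "xc n hbody (hst \<sigma> (j # js) A B Y)
    (if Y ! length W then hst \<sigma> js (rev (take (length W) Y)) B (drop (Suc (length W)) Y)
     else hst \<sigma> js A (rev (take (length W) Y)) (drop (Suc (length W)) Y))"
proof -
  let ?N = "length W"
  let ?M = "rev (take ?N Y)"
  let ?s1 = "hst \<sigma> js A B Y"
  let ?s2 = "hst (\<sigma>(vM := map Bt ?M)) js A B (drop ?N Y)"
  let ?s3 = "hst (\<sigma>(vM := map Bt ?M)) js A B (drop (Suc ?N) Y)"
  let ?f = "\<lambda>c. if c = Some (Bt True) then clear vA ;; move vM t1 ;; move t1 vA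
      else clear vB ;; move vM t1 ;; move t1 vB"
  let ?r = "if Y ! ?N then hst \<sigma> js ?M B (drop (Suc ?N) Y) else hst \<sigma> js A ?M (drop (Suc ?N) Y)"
  have 1: "xc n (Pop vJ) (hst \<sigma> (j # js) A B Y) ?s1" by (auto simp: xcs hst_def fun_eq_iff)
  have 2: "xc n (fetch vM) ?s1 ?s2"
    by (rule xc_eq[OF xc_fetch]) (use assms in \<open>auto simp: hst_def fun_eq_iff rev_map take_map drop_map\<close>)
  have dr: "drop ?N Y = Y ! ?N # drop (Suc ?N) Y" using assms(5) by (simp add: Cons_nth_drop_Suc)
  have 3: "xc n (?f (Some (Bt (Y ! ?N)))) ?s3 ?r"
  proof (cases "Y ! ?N")
    case True
    have "xc n (clear vA ;; move vM t1 ;; move t1 vA) ?s3 ?r"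
      by (rule xc_SeqI[OF xc_clear xc_SeqI[OF xc_move xc_eq[OF xc_move]]])
        (use assms True in \<open>auto simp: hst_def fun_eq_iff\<close>)
    then show ?thesis using True by simp
  next
    case False
    have "xc n (clear vB ;; move vM t1 ;; move t1 vB) ?s3 ?r"
      by (rule xc_SeqI[OF xc_clear xc_SeqI[OF xc_move xc_eq[OF xc_move]]])
        (use assms False in \<open>auto simp: hst_def fun_eq_iff\<close>)
    then show ?thesis using False by simp
  qed
  have Y: "?s2 vY = Bt (Y ! ?N) # map Bt (drop (Suc ?N) Y)" by (simp add: hst_def dr)
  have p: "xc n (Pop vY) ?s2 ?s3" using dr by (auto simp: xcs hst_def fun_eq_iff)
  have "xc n (Case vY (\<lambda>c. Pop vY ;; ?f c)) ?s2 ?r"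
    unfolding xc_Case Y tos.simps by (rule xc_SeqI[OF p 3])
  then show ?thesis unfolding hbody_def by (rule xc_SeqI[OF 1 xc_SeqI[OF 2]])
qed

lemma xc_hloop:
  assumes "\<sigma> vW = map Tk W" "\<sigma> t1 = []" "\<sigma> t2 = []" "\<sigma> vM = []" "length W \<le> n"
    and "length js * Suc (length W) \<le> length Y"
  shows "xc n (While vJ hbody) (hst \<sigma> js A B Y)
    (case hl (length W) (length js) A B Y of (A', B', Y') \<Rightarrow> hst \<sigma> [] A' B' Y')"
  using assms(6)
proof (induction js arbitrary: A B Y)
  case Nil
  show ?case by (auto simp: hst_def intro!: xc_WhileF)
next
  case (Cons j js)
  note b = xc_hbody[OF assms(1-4) _ assms(5), of Y j js A B]
  have l: "length W < length Y" "length js * Suc (length W) \<le> length (drop (Suc (length W)) Y)"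
    using Cons.prems by auto
  have ne: "hst \<sigma> (j # js) A B Y vJ \<noteq> []" by (simp add: hst_def)
  show ?case
  proof (cases "Y ! length W")
    case True
    then show ?thesis using xc_WhileT[OF ne b[OF l(1)]] Cons.IH[OF l(2)] by simp
  next
    case False
    then show ?thesis using xc_WhileT[OF ne b[OF l(1)]] Cons.IH[OF l(2)] by simp
  qed
qed

text \<open>The counter gets one entry more than there are tokens, for \<open>N + 1\<close>
  halvings.\<close>

definition halve :: "sym com" where
  "halve = copy vW vJ t1 ;; Push vJ (Bt True) ;; While vJ hbody"

lemma xc_halve:
  assumes "\<sigma> vW = map Tk W" "\<sigma> t1 = []" "\<sigma> t2 = []" "\<sigma> vM = []" "\<sigma> vJ = []" "length W < n"
    "\<sigma> vA = map Bt A" "\<sigma> vB = []" "\<sigma> vY = map Bt Y"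
    and "Suc (length W) * Suc (length W) \<le> length Y"
    and h: "hl (length W) (Suc (length W)) A [] Y = (A', B', Y')"
  shows "xc n halve \<sigma> (\<sigma>(vA := map Bt A', vB := map Bt B', vY := map Bt Y'))"
proof -
  let ?js = "Bt True # map Tk W"
  have 1: "xc n (copy vW vJ t1) \<sigma> (\<sigma>(vJ := map Tk W))"
    by (rule xc_eq[OF xc_copy]) (use assms in \<open>auto simp: fun_eq_iff\<close>)
  have 2: "xc n (Push vJ (Bt True)) (\<sigma>(vJ := map Tk W)) (hst \<sigma> ?js A [] Y)"
    using assms by (auto simp: xcs hst_def fun_eq_iff)
  have "xc n (While vJ hbody) (hst \<sigma> ?js A [] Y)
    (case hl (length W) (length ?js) A [] Y of (A', B', Y') \<Rightarrow> hst \<sigma> [] A' B' Y')"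
    by (rule xc_hloop[OF assms(1-4)]) (use assms(6,10) in simp_all)
  then have 3: "xc n (While vJ hbody) (hst \<sigma> ?js A [] Y) (hst \<sigma> [] A' B' Y')"
    using h by (simp del: hl.simps)
  have "hst \<sigma> [] A' B' Y' = \<sigma>(vA := map Bt A', vB := map Bt B', vY := map Bt Y')"
    using assms by (auto simp: hst_def fun_eq_iff)
  then show ?thesis unfolding halve_def using xc_SeqI[OF 1 xc_SeqI[OF 2 3]] by simp
qed

text \<open>A void challenge empties the level counter and thereby ends the play. A defender who has
  lost is recorded in \<open>vfl\<close> only, and the play goes on.\<close>

definition level :: "sym com" where
  "level = pass ;; clear vV ;; clear vdg ;; fetch vD ;; fetch vA ;; challenge ;; clear vD ;;
     Case vmd (\<lambda>m. case m of Some (Tk X) \<Rightarrow>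
        Pop vmd ;; halve ;; sub X vS vA ;; (if X = TBoxA then sub TBoxB vB vA else Skip) ;;
        clear vS ;; move vA t1 ;; move t1 vS ;; clear vB
      | _ \<Rightarrow> clear vK)"

definition clean :: "tok list \<Rightarrow> (nat \<Rightarrow> sym list) \<Rightarrow> bool" where
  "clean W \<sigma> \<longleftrightarrow> \<sigma> vW = map Tk W \<and>
     (\<forall>i \<in> {vA, vB, vM, vD, t1, t2, t3, t4, t5, vJ, vmd, vV, vdg, vbad, vgo, vP}. \<sigma> i = [])"

definition lst :: "(nat \<Rightarrow> sym list) \<Rightarrow> sym list \<Rightarrow> bool list \<Rightarrow> bool list \<Rightarrow> bool \<Rightarrow> nat \<Rightarrow> sym list" where
  "lst \<sigma> ks S Y f = \<sigma>(vK := ks, vS := map Bt S, vY := map Bt Y, vfl := fl f)"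

text \<open>Bits of a transcript per level: the marks, the answer, and \<open>N + 1\<close> halvings
  of \<open>N + 1\<close> bits each.\<close>

definition need :: "nat \<Rightarrow> nat" where
  "need N = N + N + Suc N * Suc N"

lemma hl_len: "hl N j A B Y = (A', B', Y') \<Longrightarrow> j * Suc N \<le> length Y \<Longrightarrow> length A = N \<Longrightarrow> length B \<le> N \<Longrightarrow>
   length A' = N \<and> length B' \<le> N \<and> length Y' = length Y - j * Suc N"
proof (induction j arbitrary: A B Y)
  case (Suc j)
  have l: "j * Suc N \<le> length (drop (Suc N) Y)" "length (rev (take N Y)) = N" using Suc.prems(2) by auto
  show ?case
  proof (cases "Y ! N")
    case True
    then show ?thesis using Suc.IH[of "rev (take N Y)" B "drop (Suc N) Y"] Suc.prems l by auto
  next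
    case False
    then show ?thesis using Suc.IH[of A "rev (take N Y)" "drop (Suc N) Y"] Suc.prems l by auto
  qed
qed simp

lemma xc_level:
  assumes cl: "clean W \<sigma>" and W: "W = toks \<phi>" and S: "length S = length W" and B: "length W < n"
    and Y: "need (length W) \<le> length Y"
    and D: "D = rev (take (length W) Y)" and A: "A = rev (take (length W) (drop (length W) Y))"
    and Y2: "Y2 = drop (length W) (drop (length W) Y)"
    and g: "g \<longleftrightarrow> f \<or> incons W S \<or> snd (dscan W S D A)"
  shows "fst (dscan W S D A) = None \<Longrightarrow>
      xc n level (lst \<sigma> ks S Y f) ((lst \<sigma> [] S Y2 g)(vA := map Bt A))"
    "fst (dscan W S D A) = Some X \<Longrightarrow> hl (length W) (Suc (length W)) A [] Y2 = (A', B', Y') \<Longrightarrow>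
      xc n level (lst \<sigma> ks S Y f)
       (lst \<sigma> ks A' Y' (g \<or> \<not> bsub X W S A' \<or> \<not> (X = TBoxA \<longrightarrow> bsub TBoxB W B' A')))"
proof -
  let ?N = "length W"
  let ?f1 = "f \<or> incons W S"
  have c: "\<sigma> vW = map Tk W" "\<sigma> vA = []" "\<sigma> vB = []" "\<sigma> vM = []" "\<sigma> vD = []" "\<sigma> t1 = []" "\<sigma> t2 = []" "\<sigma> t3 = []"
    "\<sigma> t4 = []" "\<sigma> t5 = []" "\<sigma> vJ = []" "\<sigma> vmd = []" "\<sigma> vV = []" "\<sigma> vdg = []" "\<sigma> vbad = []" "\<sigma> vgo = []" "\<sigma> vP = []"
    using cl by (simp_all add: clean_def)
  have N: "?N + ?N + Suc ?N * Suc ?N \<le> length Y" using Y by (simp only: need_def)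
  have N1: "?N \<le> length Y" "?N \<le> length Y - ?N" "Suc ?N * Suc ?N \<le> length Y - ?N - ?N" using N by linarith+
  have lD: "length D = ?N" and lA: "length A = ?N" and lY2: "Suc ?N * Suc ?N \<le> length Y2"
    using N1 by (simp_all only: D A Y2 length_rev length_take length_drop min_absorb2)
  have p: "prun (rev W) (rev S) ([], None, False, f) = ([hd S], None, False, ?f1)"
    using prun_toks[of S \<phi> "[]" False] S W by (auto simp: incons_def)
  let ?s0 = "lst \<sigma> ks S Y f"
  let ?s1 = "lst (\<sigma>(vV := [Bt (hd S)])) ks S Y ?f1"
  have 1: "xc n pass ?s0 ?s1"
    by (rule xc_eq[OF xc_pass[of _ W S False f n "[hd S]" None False ?f1]])
      (use c S B p in \<open>auto simp: lst_def fun_eq_iff\<close>)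
  let ?s2 = "lst \<sigma> ks S Y ?f1"
  have 2: "xc n (clear vV) ?s1 ?s2" by (rule xc_eq[OF xc_clear]) (use c in \<open>auto simp: lst_def fun_eq_iff\<close>)
  have 3: "xc n (clear vdg) ?s2 ?s2" by (rule xc_eq[OF xc_clear]) (use c in \<open>auto simp: lst_def fun_eq_iff\<close>)
  let ?s4 = "lst (\<sigma>(vD := map Bt D)) ks S (drop ?N Y) ?f1"
  have 4: "xc n (fetch vD) ?s2 ?s4"
    by (rule xc_eq[OF xc_fetch]) (use c B N1 in \<open>auto simp: lst_def fun_eq_iff D rev_map take_map drop_map\<close>)
  let ?s5 = "lst (\<sigma>(vD := map Bt D, vA := map Bt A)) ks S Y2 ?f1"
  have 5: "xc n (fetch vA) ?s4 ?s5"
    by (rule xc_eq[OF xc_fetch])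
      (use c B N1 in \<open>auto simp: lst_def fun_eq_iff A Y2 rev_map take_map drop_map simp del: drop_drop\<close>)
  let ?m = "fst (dscan W S D A)"
  let ?s6 = "lst (\<sigma>(vD := map Bt D, vA := map Bt A, vmd := md ?m)) ks S Y2 g"
  have 6: "xc n challenge ?s5 ?s6"
    by (rule xc_eq[OF xc_challenge[of _ W S D A ?f1]]) (use c B lD lA S g in \<open>auto simp: lst_def fun_eq_iff\<close>)
  let ?s7 = "lst (\<sigma>(vA := map Bt A, vmd := md ?m)) ks S Y2 g"
  have 7: "xc n (clear vD) ?s6 ?s7" by (rule xc_eq[OF xc_clear]) (use c in \<open>auto simp: lst_def fun_eq_iff\<close>)
  let ?rest = "Case vmd (\<lambda>m. case m of Some (Tk X) \<Rightarrow>
        Pop vmd ;; halve ;; sub X vS vA ;; (if X = TBoxA then sub TBoxB vB vA else Skip) ;;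
        clear vS ;; move vA t1 ;; move t1 vS ;; clear vB
      | _ \<Rightarrow> clear vK)"
  have all: "xc n level ?s0 r" if "xc n ?rest ?s7 r" for r
    unfolding level_def by (rule xc_SeqI[OF 1 xc_SeqI[OF 2 xc_SeqI[OF 3 xc_SeqI[OF 4 xc_SeqI[OF 5 xc_SeqI[OF 6 xc_SeqI[OF 7 that]]]]]]])
  have m: "?s7 vmd = md ?m" by (simp add: lst_def)
  show "xc n level ?s0 ((lst \<sigma> [] S Y2 g)(vA := map Bt A))" if "?m = None"
  proof (rule all)
    have "xc n (clear vK) ?s7 ((lst \<sigma> [] S Y2 g)(vA := map Bt A))"
      by (rule xc_eq[OF xc_clear]) (use c that in \<open>auto simp: lst_def fun_eq_iff md_def\<close>)
    then show "xc n ?rest ?s7 ((lst \<sigma> [] S Y2 g)(vA := map Bt A))"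
      unfolding xc_Case m using that by (simp add: md_def)
  qed
  show "xc n level ?s0 (lst \<sigma> ks A' Y' (g \<or> \<not> bsub X W S A' \<or> \<not> (X = TBoxA \<longrightarrow> bsub TBoxB W B' A')))"
    if mX: "?m = Some X" and h: "hl ?N (Suc ?N) A [] Y2 = (A', B', Y')"
  proof (rule all)
    have hl: "length A' = ?N" "length B' \<le> ?N" using hl_len[OF h lY2 lA] by simp_all
    let ?g1 = "g \<or> \<not> bsub X W S A'"
    let ?g2 = "g \<or> \<not> bsub X W S A' \<or> \<not> (X = TBoxA \<longrightarrow> bsub TBoxB W B' A')"
    let ?u1 = "lst (\<sigma>(vA := map Bt A)) ks S Y2 g"
    have 1: "xc n (Pop vmd) ?s7 ?u1" using c mX by (auto simp: xcs lst_def md_def fun_eq_iff)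
    let ?u2 = "lst (\<sigma>(vA := map Bt A', vB := map Bt B')) ks S Y' g"
    have 2: "xc n halve ?u1 ?u2"
      by (rule xc_eq[OF xc_halve[OF _ _ _ _ _ B _ _ _ lY2 h]]) (use c in \<open>auto simp: lst_def fun_eq_iff\<close>)
    let ?u3 = "lst (\<sigma>(vA := map Bt A', vB := map Bt B')) ks S Y' ?g1"
    have 3: "xc n (sub X vS vA) ?u2 ?u3"
      by (rule xc_eq[OF xc_sub[of _ W _ S _ A' g]]) (use c B S hl in \<open>auto simp: lst_def fun_eq_iff\<close>)
    let ?u4 = "lst (\<sigma>(vA := map Bt A', vB := map Bt B')) ks S Y' ?g2"
    have 4: "xc n (if X = TBoxA then sub TBoxB vB vA else Skip) ?u3 ?u4"
    proof (cases "X = TBoxA")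
      case True
      have "xc n (sub TBoxB vB vA) ?u3 ?u4"
        by (rule xc_eq[OF xc_sub[of _ W _ B' _ A' ?g1]]) (use c B S hl True in \<open>auto simp: lst_def fun_eq_iff\<close>)
      then show ?thesis using True by simp
    qed (simp add: xcs)
    let ?u5 = "lst (\<sigma>(vA := map Bt A', vB := map Bt B')) ks [] Y' ?g2"
    have 5: "xc n (clear vS) ?u4 ?u5" by (rule xc_eq[OF xc_clear]) (auto simp: lst_def fun_eq_iff)
    let ?u6 = "lst (\<sigma>(t1 := map Bt (rev A'), vB := map Bt B')) ks [] Y' ?g2"
    have 6: "xc n (move vA t1) ?u5 ?u6"
      by (rule xc_eq[OF xc_move]) (use c B hl in \<open>auto simp: lst_def fun_eq_iff rev_map\<close>)
    let ?u7 = "lst (\<sigma>(vB := map Bt B')) ks A' Y' ?g2"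
    have 7: "xc n (move t1 vS) ?u6 ?u7"
      by (rule xc_eq[OF xc_move]) (use c B hl in \<open>auto simp: lst_def fun_eq_iff rev_map\<close>)
    have 8: "xc n (clear vB) ?u7 (lst \<sigma> ks A' Y' ?g2)"
      by (rule xc_eq[OF xc_clear]) (use c in \<open>auto simp: lst_def fun_eq_iff\<close>)
    have tv: "?s7 vmd = [Tk X]" unfolding m using mX by (simp add: md_def)
    show "xc n ?rest ?s7 (lst \<sigma> ks A' Y' ?g2)"
      unfolding xc_Case tv tos.simps option.case sym.case
      by (rule xc_SeqI[OF 1 xc_SeqI[OF 2 xc_SeqI[OF 3 xc_SeqI[OF 4 xc_SeqI[OF 5 xc_SeqI[OF 6 xc_SeqI[OF 7 8]]]]]]])
  qed
qed

text \<open>What remains on \<open>vS\<close>, \<open>vY\<close> and \<open>vA\<close> depends on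
  where the play ends, hence the existential quantifiers; \<open>leafp\<close> clears these
  stacks.\<close>

lemma xc_levels:
  assumes "clean W \<sigma>" "W = toks \<phi>" "length S = length W" "length W < n" "length ks * need (length W) \<le> length Y"
  shows "\<exists>s y a. xc n (While vK (Pop vK ;; level)) (lst \<sigma> ks S Y f)
     ((lst \<sigma> [] s y (f \<or> \<not> lev W (length ks) S Y))(vA := a))"
  using assms(3,5)
proof (induction ks arbitrary: S Y f)
  case Nil
  have "(lst \<sigma> [] S Y (f \<or> \<not> lev W (length ([] :: sym list)) S Y))(vA := []) = lst \<sigma> [] S Y f"
    using assms(1) by (auto simp: lst_def clean_def fun_eq_iff)
  moreover have "xc n (While vK (Pop vK ;; level)) (lst \<sigma> [] S Y f) (lst \<sigma> [] S Y f)"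
    by (rule xc_WhileF) (simp add: lst_def)
  ultimately show ?case by metis
next
  case (Cons k ks)
  let ?N = "length W"
  define D where "D = rev (take ?N Y)"
  define A where "A = rev (take ?N (drop ?N Y))"
  define Y2 where "Y2 = drop ?N (drop ?N Y)"
  define g where "g \<longleftrightarrow> f \<or> incons W S \<or> snd (dscan W S D A)"
  have Y: "need ?N \<le> length Y" using Cons.prems by simp
  note L = xc_level[OF assms(1,2) Cons.prems(1) assms(4) Y D_def A_def Y2_def g_def]
  have p: "xc n (Pop vK) (lst \<sigma> (k # ks) S Y f) (lst \<sigma> ks S Y f)" by (auto simp: xcs lst_def fun_eq_iff)
  have ne: "lst \<sigma> (k # ks) S Y f vK \<noteq> []" by (simp add: lst_def)
  have lv: "lev W (length (k # ks)) S Y \<longleftrightarrow> \<not> incons W S \<and> \<not> snd (dscan W S D A) \<and>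
     (case fst (dscan W S D A) of None \<Rightarrow> True
      | Some X \<Rightarrow> (case hl ?N (Suc ?N) A [] Y2 of (A', B', Y') \<Rightarrow>
          bsub X W S A' \<and> (X = TBoxA \<longrightarrow> bsub TBoxB W B' A') \<and> lev W (length ks) A' Y'))"
    unfolding list.size(4) add_Suc_right add_0_right lev.simps(2) Let_def D_def A_def Y2_def ..
  show ?case
  proof (cases "fst (dscan W S D A)")
    case None
    have e: "g = (f \<or> \<not> lev W (length (k # ks)) S Y)" unfolding lv using None by (auto simp: g_def)
    have "xc n (While vK (Pop vK ;; level)) (lst \<sigma> (k # ks) S Y f) ((lst \<sigma> [] S Y2 g)(vA := map Bt A))"
      by (rule xc_WhileT[OF ne xc_SeqI[OF p L(1)[OF None]] xc_WhileF]) (simp add: lst_def)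
    then show ?thesis unfolding e by blast
  next
    case (Some X)
    obtain A' B' Y' where h: "hl ?N (Suc ?N) A [] Y2 = (A', B', Y')" by (metis prod_cases3)
    let ?g = "g \<or> \<not> bsub X W S A' \<or> \<not> (X = TBoxA \<longrightarrow> bsub TBoxB W B' A')"
    have lY: "?N \<le> length Y" "?N \<le> length Y - ?N" "Suc ?N * Suc ?N \<le> length Y - ?N - ?N"
      using Y unfolding need_def by linarith+
    have lA: "length A = ?N" and lY2: "Suc ?N * Suc ?N \<le> length Y2"
      using lY by (simp_all only: A_def Y2_def length_rev length_take length_drop min_absorb2)
    have hl: "length A' = ?N" "length B' \<le> ?N" "length Y' = length Y2 - Suc ?N * Suc ?N"
      using hl_len[OF h lY2 lA] by simp_all
    have "length (k # ks) * need ?N = need ?N + length ks * need ?N" by simp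
    then have lks: "length ks * need ?N \<le> length Y'"
      using Cons.prems(2) unfolding hl(3) Y2_def length_drop by (simp only: need_def)
    have e: "(?g \<or> \<not> lev W (length ks) A' Y') = (f \<or> \<not> lev W (length (k # ks)) S Y)"
      unfolding lv Some h by (auto simp: g_def)
    obtain s y a where "xc n (While vK (Pop vK ;; level)) (lst \<sigma> ks A' Y' ?g)
       ((lst \<sigma> [] s y (?g \<or> \<not> lev W (length ks) A' Y'))(vA := a))"
      using Cons.IH[OF hl(1) lks, of ?g] by blast
    then have "xc n (While vK (Pop vK ;; level)) (lst \<sigma> (k # ks) S Y f)
       ((lst \<sigma> [] s y (?g \<or> \<not> lev W (length ks) A' Y'))(vA := a))"
      by (rule xc_WhileT[OF ne xc_SeqI[OF p L(2)[OF Some h]]])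
    then show ?thesis unfolding e by blast
  qed
qed

definition cell :: "bool \<times> bool \<Rightarrow> sym" where
  "cell x = Cl (fst x) (snd x)"

text \<open>The assignment has its innermost value on top. Unloading it reverses the order, so that
  the transcript starts with the outermost bit, and keeps the cells on \<open>t1\<close> for
  restoring \<open>vX\<close>.\<close>

definition unload :: "sym com" where
  "unload = While vX (Case vX (\<lambda>x. Pop vX ;; Push t1 (the x) ;;
     Push vY (case x of Some (Cl q b) \<Rightarrow> Bt b | _ \<Rightarrow> Bt False)))"

lemma xc_unload:
  "length xs + length cs \<le> n \<Longrightarrow> length xs + length ys \<le> n \<Longrightarrow>
   xc n unload (\<sigma>(vX := map cell xs, t1 := cs, vY := ys))
     (\<sigma>(vX := [], t1 := map cell (rev xs) @ cs, vY := map Bt (rev (map snd xs)) @ ys))"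
proof (induction xs arbitrary: cs ys)
  case Nil
  show ?case unfolding unload_def by (rule xc_eq[OF xc_WhileF]) auto
next
  case (Cons x xs)
  let ?s0 = "\<sigma>(vX := map cell (x # xs), t1 := cs, vY := ys)"
  let ?s1 = "\<sigma>(vX := map cell xs, t1 := cell x # cs, vY := Bt (snd x) # ys)"
  have IH: "xc n unload ?s1 (\<sigma>(vX := [], t1 := map cell (rev xs) @ cell x # cs,
      vY := map Bt (rev (map snd xs)) @ Bt (snd x) # ys))"
    by (rule Cons.IH) (use Cons.prems in auto)
  have b: "xc n (Case vX (\<lambda>x. Pop vX ;; Push t1 (the x) ;;
     Push vY (case x of Some (Cl q b) \<Rightarrow> Bt b | _ \<Rightarrow> Bt False))) ?s0 ?s1"
    using Cons.prems by (auto simp: xcs cell_def fun_eq_iff)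
  show ?case unfolding unload_def
    by (rule xc_WhileT[OF _ b xc_eq[OF IH[unfolded unload_def]]]) auto
qed

definition leafp :: "sym com" where
  "leafp = unload ;; move t1 vX ;; fetch vS ;;
     Case vS (\<lambda>s. if s = Some (Bt True) then setf vfl else Skip) ;;
     copy vW vK t1 ;; While vK (Pop vK ;; level) ;; clear vY ;; clear vS ;; clear vA"

lemma xc_leafp:
  assumes cl: "clean W \<sigma>" and W: "W = toks \<phi>" and X: "\<sigma> vX = map cell xs"
    and len: "length xs = length W + length W * need (length W)"
    and e: "\<sigma> vY = []" "\<sigma> vS = []" "\<sigma> vK = []" "\<sigma> vfl = []"
    and B: "length W < n" "length xs \<le> n"
  shows "xc n leafp \<sigma> (\<sigma>(vfl := fl (\<not> leaf W (rev (map snd xs)))))"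
proof -
  let ?N = "length W" and ?Y = "rev (map snd xs)"
  let ?S = "rev (take ?N ?Y)" and ?Y1 = "drop ?N ?Y"
  have c: "\<sigma> vW = map Tk W" "\<sigma> vA = []" "\<sigma> t1 = []" "\<sigma> t2 = []"
    using cl by (simp_all add: clean_def)
  have 1: "xc n unload \<sigma> (\<sigma>(vX := [], t1 := map cell (rev xs), vY := map Bt ?Y))"
  proof -
    have "\<sigma>(vX := map cell xs, t1 := [], vY := []) = \<sigma>" using c e X by (auto simp: fun_eq_iff)
    then show ?thesis using xc_unload[of xs "[]" n "[]" \<sigma>] B by simp
  qed
  let ?s2 = "\<sigma>(vY := map Bt ?Y)"
  have 2: "xc n (move t1 vX) (\<sigma>(vX := [], t1 := map cell (rev xs), vY := map Bt ?Y)) ?s2"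
    by (rule xc_eq[OF xc_move]) (use c X B in \<open>auto simp: fun_eq_iff rev_map\<close>)
  let ?s3 = "lst \<sigma> [] ?S ?Y1 False"
  have 3: "xc n (fetch vS) ?s2 ?s3"
    by (rule xc_eq[OF xc_fetch]) (use c e B len in \<open>auto simp: lst_def fun_eq_iff rev_map take_map drop_map\<close>)
  let ?s4 = "lst \<sigma> [] ?S ?Y1 (hdF ?S)"
  have 4: "xc n (Case vS (\<lambda>s. if s = Some (Bt True) then setf vfl else Skip)) ?s3 ?s4"
  proof -
    have v: "tos (?s3 vS) = Some (Bt True) \<longleftrightarrow> hdF ?S" by (simp add: lst_def tos_Bt del: rev_map)
    show ?thesis
    proof (cases "hdF ?S")
      case True
      then show ?thesis unfolding xc_Case using v B by (auto simp: setf_def xcs lst_def fun_eq_iff)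
    next
      case False
      then show ?thesis unfolding xc_Case using v by (simp add: xcs)
    qed
  qed
  let ?s5 = "lst \<sigma> (map Tk W) ?S ?Y1 (hdF ?S)"
  have 5: "xc n (copy vW vK t1) ?s4 ?s5"
    by (rule xc_eq[OF xc_copy]) (use c e B in \<open>auto simp: lst_def fun_eq_iff\<close>)
  have "\<exists>s y a. xc n (While vK (Pop vK ;; level)) ?s5
     ((lst \<sigma> [] s y (hdF ?S \<or> \<not> lev W (length (map Tk W)) ?S ?Y1))(vA := a))"
    by (rule xc_levels[OF cl W]) (use B len in auto)
  then obtain s y a where 6: "xc n (While vK (Pop vK ;; level)) ?s5
     ((lst \<sigma> [] s y (hdF ?S \<or> \<not> lev W ?N ?S ?Y1))(vA := a))" by auto
  have lf: "\<not> leaf W ?Y \<longleftrightarrow> hdF ?S \<or> \<not> lev W ?N ?S ?Y1" by (auto simp: leaf_def)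
  have 7: "xc n (clear vY ;; clear vS ;; clear vA) ((lst \<sigma> [] s y (hdF ?S \<or> \<not> lev W ?N ?S ?Y1))(vA := a))
    (\<sigma>(vfl := fl (\<not> leaf W ?Y)))"
    by (rule xc_SeqI[OF xc_clear xc_SeqI[OF xc_clear xc_eq[OF xc_clear]]])
      (use c e lf in \<open>auto simp: lst_def fun_eq_iff\<close>)
  show ?thesis
    unfolding leafp_def
    by (rule xc_SeqI[OF 1 xc_SeqI[OF 2 xc_SeqI[OF 3 xc_SeqI[OF 4 xc_SeqI[OF 5 xc_SeqI[OF 6 7]]]]]])
qed

subsection \<open>Depth-first search\<close>

text \<open>With \<open>vph\<close> true the search descends and tries \<open>False\<close> for each
  quantifier; with \<open>vph\<close> false it returns. An empty \<open>vfl\<close> means that the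
  defender has won, so \<open>(f = None) \<noteq> q\<close> says that the first value has not
  decided quantifier \<open>q\<close>. Returning with empty \<open>vX\<close> ends the
  search.\<close>

definition gbody :: "sym com" where
  "gbody = Case vph (\<lambda>p. if p = Some (Bt True) then
       Case vR (\<lambda>r. case r of Some (Lb q) \<Rightarrow> Pop vR ;; Push vX (Cl q False)
         | _ \<Rightarrow> leafp ;; Pop vph ;; Push vph (Bt False))
     else Case vX (\<lambda>x. case x of Some (Cl q b) \<Rightarrow> Pop vX ;; Case vfl (\<lambda>f.
           if \<not> b \<and> (f = None) \<noteq> q then Push vX (Cl q True) ;; clear vfl ;; Pop vph ;; Push vph (Bt True)
           else Push vR (Lb q))
         | _ \<Rightarrow> Pop vph))"

definition gst :: "(nat \<Rightarrow> sym list) \<Rightarrow> bool \<Rightarrow> (bool \<times> bool) list \<Rightarrow> bool list \<Rightarrow> bool \<Rightarrow> nat \<Rightarrow> sym list" where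
  "gst \<sigma> ph xs qs f = \<sigma>(vph := [Bt ph], vX := map cell xs, vR := map Lb qs, vfl := fl f)"

lemma fl_None: "tos (fl f) = None \<longleftrightarrow> \<not> f"
  by (simp add: fl_def)

text \<open>Stated with a continuation: the call on \<open>qs\<close> reaches \<open>\<tau>\<close>
  if the corresponding return state does. In this form recursive calls compose within the one loop
  that performs the whole search, which need not be cut into pieces.\<close>

lemma xc_dfs:
  assumes cl: "clean W \<sigma>" and W: "W = toks \<phi>"
    and e: "\<sigma> vY = []" "\<sigma> vS = []" "\<sigma> vK = []"
    and B: "length W < n" "length W + length W * need (length W) \<le> n"
    and len: "length xs + length qs = length W + length W * need (length W)"
    and fin: "xc n (While vph gbody) (gst \<sigma> False xs qs (\<not> qeval qs (\<lambda>y. leaf W (rev (map snd xs) @ y)))) \<tau>"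
  shows "xc n (While vph gbody) (gst \<sigma> True xs qs False) \<tau>"
  using len fin
proof (induction qs arbitrary: xs)
  case Nil
  let ?v = "leaf W (rev (map snd xs))"
  have cl': "clean W (gst \<sigma> True xs [] False)" using cl by (simp add: clean_def gst_def)
  have 1: "xc n leafp (gst \<sigma> True xs [] False) (gst \<sigma> True xs [] (\<not> ?v))"
    by (rule xc_eq[OF xc_leafp[OF cl' W]]) (use e B Nil.prems in \<open>auto simp: gst_def fun_eq_iff\<close>)
  have 2: "xc n (Pop vph ;; Push vph (Bt False)) (gst \<sigma> True xs [] (\<not> ?v)) (gst \<sigma> False xs [] (\<not> ?v))"
    using B by (auto simp: xcs gst_def fun_eq_iff)
  have v: "gst \<sigma> True xs [] False vph = [Bt True]" "gst \<sigma> True xs [] False vR = []" by (simp_all add: gst_def)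
  have "xc n gbody (gst \<sigma> True xs [] False) (gst \<sigma> False xs [] (\<not> ?v))"
    unfolding gbody_def xc_Case v tos.simps using xc_SeqI[OF 1 2] by (simp add: xc_Case v)
  moreover have "xc n (While vph gbody) (gst \<sigma> False xs [] (\<not> ?v)) \<tau>" using Nil.prems(2) by simp
  moreover have "gst \<sigma> True xs [] False vph \<noteq> []" by (simp add: gst_def)
  ultimately show ?case by (blast intro: xc_WhileT)
next
  case (Cons q qs)
  let ?t = "\<lambda>b. qeval qs (\<lambda>y. leaf W (rev (map snd ((q, b) # xs)) @ y))"
  have lq: "length xs < n" "length qs < n" "0 < n" using Cons.prems(1) B by auto
  have l: "length ((q, b) # xs) + length qs = length W + length W * need (length W)" for b
    using Cons.prems(1) by simp
  have down: "xc n gbody (gst \<sigma> True xs (q # qs) False) (gst \<sigma> True ((q, False) # xs) qs False)"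
    using lq by (auto simp: gbody_def xcs gst_def cell_def fun_eq_iff)
  have up: "xc n gbody (gst \<sigma> False ((q, b) # xs) qs f) (gst \<sigma> False xs (q # qs) f)" if "b \<or> (\<not> f) = q" for b f
    using lq that by (auto simp: gbody_def xcs gst_def cell_def fl_None fun_eq_iff)
  have flip: "xc n gbody (gst \<sigma> False ((q, False) # xs) qs f) (gst \<sigma> True ((q, True) # xs) qs False)" if "(\<not> f) \<noteq> q" for f
  proof -
    let ?s0 = "gst \<sigma> False ((q, False) # xs) qs f"
    let ?s1 = "gst \<sigma> False ((q, True) # xs) qs f"
    let ?s2 = "gst \<sigma> False ((q, True) # xs) qs False"
    have 1: "xc n (Pop vX) ?s0 (gst \<sigma> False xs qs f)" by (auto simp: xcs gst_def fun_eq_iff)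
    have 2: "xc n (Push vX (Cl q True)) (gst \<sigma> False xs qs f) ?s1" using lq by (auto simp: xcs gst_def cell_def fun_eq_iff)
    have 3: "xc n (clear vfl) ?s1 ?s2" by (rule xc_eq[OF xc_clear]) (auto simp: gst_def fun_eq_iff)
    have 4: "xc n (Pop vph ;; Push vph (Bt True)) ?s2 (gst \<sigma> True ((q, True) # xs) qs False)"
      using lq by (auto simp: xcs gst_def fun_eq_iff)
    have v: "?s0 vph = [Bt False]" "?s0 vX = Cl q False # map cell xs" "tos (gst \<sigma> False xs qs f vfl) = None \<longleftrightarrow> \<not> f"
      by (simp_all add: gst_def cell_def fl_def)
    have 5: "xc n (Case vfl (\<lambda>f. if \<not> False \<and> (f = None) \<noteq> q then Push vX (Cl q True) ;; clear vfl ;; Pop vph ;; Push vph (Bt True)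
           else Push vR (Lb q))) (gst \<sigma> False xs qs f) (gst \<sigma> True ((q, True) # xs) qs False)"
      unfolding xc_Case v(3) using that xc_SeqI[OF 2 xc_SeqI[OF 3 4]] by simp
    show ?thesis unfolding gbody_def xc_Case v(1) tos.simps using xc_SeqI[OF 1 5] by (simp add: xc_Case v(2))
  qed
  have W1: "xc n (While vph gbody) (gst \<sigma> p xs' qs' f) \<tau>"
    if "xc n gbody (gst \<sigma> p xs' qs' f) (gst \<sigma> p' xs'' qs'' f')" "xc n (While vph gbody) (gst \<sigma> p' xs'' qs'' f') \<tau>"
    for p xs' qs' f p' xs'' qs'' f'
    by (rule xc_WhileT[OF _ that]) (simp add: gst_def)
  let ?v = "qeval (q # qs) (\<lambda>y. leaf W (rev (map snd xs) @ y))"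
  have v: "?v = (if q then ?t False \<or> ?t True else ?t False \<and> ?t True)" by simp
  show ?case
  \<comment> \<open>A true first value decides an existential quantifier, a false one a universal
    quantifier.\<close>
  proof (cases "?t False = q")
    case True
    then have "?v = ?t False" unfolding v by auto
    then have "xc n (While vph gbody) (gst \<sigma> False xs (q # qs) (\<not> ?t False)) \<tau>" using Cons.prems(2) by simp
    then have "xc n (While vph gbody) (gst \<sigma> False ((q, False) # xs) qs (\<not> ?t False)) \<tau>"
      by (rule W1[OF up, rotated]) (use True in simp)
    then have "xc n (While vph gbody) (gst \<sigma> True ((q, False) # xs) qs False) \<tau>" by (rule Cons.IH[OF l])
    then show ?thesis by (rule W1[OF down])
  next
    case False
    then have "?v = ?t True" unfolding v by auto
    then have "xc n (While vph gbody) (gst \<sigma> False xs (q # qs) (\<not> ?t True)) \<tau>" using Cons.prems(2) by simp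
    then have "xc n (While vph gbody) (gst \<sigma> False ((q, True) # xs) qs (\<not> ?t True)) \<tau>"
      by (rule W1[OF up, rotated]) simp
    then have "xc n (While vph gbody) (gst \<sigma> True ((q, True) # xs) qs False) \<tau>" by (rule Cons.IH[OF l])
    then have "xc n (While vph gbody) (gst \<sigma> False ((q, False) # xs) qs (\<not> ?t False)) \<tau>"
      by (rule W1[OF flip, rotated]) (use False in auto)
    then have "xc n (While vph gbody) (gst \<sigma> True ((q, False) # xs) qs False) \<tau>" by (rule Cons.IH[OF l])
    then show ?thesis by (rule W1[OF down])
  qed
qed

subsection \<open>The whole program\<close>

definition tv :: "sym option \<Rightarrow> bool" where
  "tv x \<longleftrightarrow> x = Some (Bt True)"

definition lexer :: "sym com" where
  "lexer = While 0 (Case 0 (\<lambda>a. Pop 0 ;; Case 0 (\<lambda>b. if b = None then setf vbad else Pop 0 ;;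
     Case 0 (\<lambda>c. if c = None then setf vbad else Pop 0 ;; Push t1 (Tk (btok (tv a) (tv b) (tv c)))))))"

lemma xc_lexer: "length w + length ts \<le> n \<Longrightarrow> 0 < n \<Longrightarrow>
   xc n lexer (\<sigma>(0 := map Bt w, t1 := ts, vbad := fl b))
     (\<sigma>(0 := [], t1 := map Tk (rev (fst (tkz w))) @ ts, vbad := fl (b \<or> snd (tkz w))))"
proof (induction w arbitrary: ts rule: tkz.induct)
  case 1
  show ?case unfolding lexer_def by (rule xc_eq[OF xc_WhileF]) auto
next
  case (2 x)
  let ?s0 = "\<sigma>(0 := map Bt [x], t1 := ts, vbad := fl b)"
  let ?s1 = "\<sigma>(0 := [], t1 := ts, vbad := fl True)"
  have "xc n (Case 0 (\<lambda>a. Pop 0 ;; Case 0 (\<lambda>b. if b = None then setf vbad else Pop 0 ;;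
     Case 0 (\<lambda>c. if c = None then setf vbad else Pop 0 ;; Push t1 (Tk (btok (tv a) (tv b) (tv c))))))) ?s0 ?s1"
    using 2 by (auto simp: xcs setf_def fun_eq_iff)
  then have "xc n lexer ?s0 ?s1" unfolding lexer_def by (rule xc_WhileT[OF _ _ xc_WhileF, rotated]) simp_all
  then show ?case by (rule xc_eq) (auto simp: fun_eq_iff)
next
  case (3 x y)
  let ?s0 = "\<sigma>(0 := map Bt [x, y], t1 := ts, vbad := fl b)"
  let ?s1 = "\<sigma>(0 := [], t1 := ts, vbad := fl True)"
  have "xc n (Case 0 (\<lambda>a. Pop 0 ;; Case 0 (\<lambda>b. if b = None then setf vbad else Pop 0 ;;
     Case 0 (\<lambda>c. if c = None then setf vbad else Pop 0 ;; Push t1 (Tk (btok (tv a) (tv b) (tv c))))))) ?s0 ?s1"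
    using 3 by (auto simp: xcs setf_def fun_eq_iff)
  then have "xc n lexer ?s0 ?s1" unfolding lexer_def by (rule xc_WhileT[OF _ _ xc_WhileF, rotated]) simp_all
  then show ?case by (rule xc_eq) (auto simp: fun_eq_iff)
next
  case (4 x y z w)
  let ?s0 = "\<sigma>(0 := map Bt (x # y # z # w), t1 := ts, vbad := fl b)"
  let ?s1 = "\<sigma>(0 := map Bt w, t1 := Tk (btok x y z) # ts, vbad := fl b)"
  let ?s2 = "\<sigma>(0 := [], t1 := map Tk (rev (fst (tkz w))) @ Tk (btok x y z) # ts, vbad := fl (b \<or> snd (tkz w)))"
  have 1: "xc n (Case 0 (\<lambda>a. Pop 0 ;; Case 0 (\<lambda>b. if b = None then setf vbad else Pop 0 ;;
     Case 0 (\<lambda>c. if c = None then setf vbad else Pop 0 ;; Push t1 (Tk (btok (tv a) (tv b) (tv c))))))) ?s0 ?s1"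
    using 4 by (auto simp: xcs tv_def fun_eq_iff)
  have "xc n lexer ?s1 ?s2" by (rule "4.IH") (use "4.prems" in auto)
  then have "xc n lexer ?s0 ?s2" unfolding lexer_def by (rule xc_WhileT[OF _ 1, rotated]) simp
  then show ?case by (rule xc_eq) (auto simp: fun_eq_iff)
qed

text \<open>A well-formed input leaves exactly one value and no pending digit. The flag
  \<open>vfl\<close> may have been set by the parsing pass and is reset for the search.\<close>

definition verdict :: "sym com" where
  "verdict = Case vdg (\<lambda>x. if x = None then Skip else setf vbad) ;; clear vdg ;;
     Case vV (\<lambda>x. if x = None then setf vbad else Pop vV ;; Case vV (\<lambda>y. if y = None then Skip else setf vbad)) ;;
     clear vV ;; clear vfl"

lemma xc_verdict:
  assumes "0 < n" "\<sigma> vV = map Bt V" "\<sigma> vdg = (case dg of None \<Rightarrow> [] | Some d \<Rightarrow> [Bt d])" "\<sigma> vbad = fl b"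
  shows "xc n verdict \<sigma> (\<sigma>(vV := [], vdg := [], vfl := [], vbad := fl (b \<or> dg \<noteq> None \<or> length V \<noteq> 1)))"
proof -
  let ?s1 = "\<sigma>(vbad := fl (b \<or> dg \<noteq> None))"
  have 1: "xc n (Case vdg (\<lambda>x. if x = None then Skip else setf vbad)) \<sigma> ?s1"
    using assms by (cases dg) (auto simp: xcs setf_def fun_eq_iff)
  let ?b = "b \<or> dg \<noteq> None \<or> length V \<noteq> 1"
  let ?s2 = "\<sigma>(vdg := [], vbad := fl (b \<or> dg \<noteq> None))" and ?s3 = "\<sigma>(vdg := [], vV := map Bt (tl V), vbad := fl ?b)"
  have 2: "xc n (clear vdg) ?s1 ?s2" by (rule xc_eq[OF xc_clear]) (auto simp: fun_eq_iff)
  have 3: "xc n (Case vV (\<lambda>x. if x = None then setf vbad else Pop vV ;; Case vV (\<lambda>y. if y = None then Skip else setf vbad))) ?s2 ?s3"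
    using assms by (cases V; cases "tl V") (auto simp: xcs setf_def fun_eq_iff)
  have 4: "xc n (clear vV ;; clear vfl) ?s3 (\<sigma>(vV := [], vdg := [], vfl := [], vbad := fl ?b))"
    by (rule xc_SeqI[OF xc_clear xc_eq[OF xc_clear]]) (auto simp: fun_eq_iff)
  show ?thesis unfolding verdict_def by (rule xc_SeqI[OF 1 xc_SeqI[OF 2 xc_SeqI[OF 3 4]]])
qed

definition block :: "bool \<Rightarrow> sym com" where
  "block q = copy vW t1 t2 ;; While t1 (Pop t1 ;; Push vR (Lb q))"

lemma xc_block:
  assumes "\<sigma> vW = map Tk W" "\<sigma> t1 = []" "\<sigma> t2 = []" "\<sigma> vR = map Lb qs" "length W + length qs \<le> n"
  shows "xc n (block q) \<sigma> (\<sigma>(vR := map Lb (replicate (length W) q @ qs)))"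
proof -
  have l: "xc n (While t1 (Pop t1 ;; Push vR (Lb q))) (\<sigma>(t1 := map Tk ws, vR := map Lb rs))
     (\<sigma>(t1 := [], vR := map Lb (replicate (length ws) q @ rs)))" if "length ws + length rs \<le> n" for ws rs
    using that
  proof (induction ws arbitrary: rs)
    case Nil
    show ?case by (rule xc_eq[OF xc_WhileF]) auto
  next
    case (Cons w ws)
    let ?s0 = "\<sigma>(t1 := map Tk (w # ws), vR := map Lb rs)" and ?s1 = "\<sigma>(t1 := map Tk ws, vR := map Lb (q # rs))"
    have b: "xc n (Pop t1 ;; Push vR (Lb q)) ?s0 ?s1" using Cons.prems by (auto simp: xcs fun_eq_iff)
    have "xc n (While t1 (Pop t1 ;; Push vR (Lb q))) ?s1 (\<sigma>(t1 := [], vR := map Lb (replicate (length ws) q @ q # rs)))"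
      by (rule Cons.IH) (use Cons.prems in simp)
    then have "xc n (While t1 (Pop t1 ;; Push vR (Lb q))) ?s0 (\<sigma>(t1 := [], vR := map Lb (replicate (length ws) q @ q # rs)))"
      by (rule xc_WhileT[OF _ b, rotated]) simp
    moreover have "replicate (length ws) q @ q # rs = replicate (length (w # ws)) q @ rs"
      by (simp add: replicate_app_Cons_same)
    ultimately show ?case by metis
  qed
  have 1: "xc n (copy vW t1 t2) \<sigma> (\<sigma>(t1 := map Tk W, vR := map Lb qs))"
    by (rule xc_eq[OF xc_copy]) (use assms in \<open>auto simp: fun_eq_iff\<close>)
  show ?thesis unfolding block_def
    by (rule xc_SeqI[OF 1 xc_eq[OF l]]) (use assms in \<open>auto simp: fun_eq_iff\<close>)
qed

text \<open>\<open>vR\<close> has the outermost quantifier on top, so the prefix is pushed from its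
  end: the universal bit goes before the block that it follows in \<open>hpat\<close>.\<close>

definition hblocks :: "sym com" where
  "hblocks = While vJ (Pop vJ ;; Push vR (Lb False) ;; block True)"

lemma hpat_Suc: "hpat N (Suc j) @ qs = hpat N j @ replicate N True @ False # qs"
  unfolding hpat_def by (simp flip: replicate_append_same)

lemma length_hpat: "length (hpat N j) = j * Suc N"
  by (induction j) (auto simp: hpat_def)

lemma xc_hblocks:
  assumes "\<sigma> vW = map Tk W" "\<sigma> t1 = []" "\<sigma> t2 = []" "length js * Suc (length W) + length qs \<le> n"
  shows "xc n hblocks (\<sigma>(vJ := js, vR := map Lb qs)) (\<sigma>(vJ := [], vR := map Lb (hpat (length W) (length js) @ qs)))"
  using assms(4)
proof (induction js arbitrary: qs)
  case Nil
  show ?case unfolding hblocks_def by (rule xc_eq[OF xc_WhileF]) (auto simp: hpat_def)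
next
  case (Cons j js)
  let ?s0 = "\<sigma>(vJ := j # js, vR := map Lb qs)" and ?s1 = "\<sigma>(vJ := js, vR := map Lb (False # qs))"
  let ?qs = "replicate (length W) True @ False # qs"
  have b: "xc n (Pop vJ ;; Push vR (Lb False) ;; block True) ?s0 (\<sigma>(vJ := js, vR := map Lb ?qs))"
  proof -
    have 1: "xc n (Pop vJ ;; Push vR (Lb False)) ?s0 ?s1" using Cons.prems by (auto simp: xcs fun_eq_iff)
    have 2: "xc n (block True) ?s1 (\<sigma>(vJ := js, vR := map Lb ?qs))"
      by (rule xc_eq[OF xc_block[of _ W "False # qs"]]) (use assms Cons.prems in \<open>auto simp: fun_eq_iff\<close>)
    show ?thesis using xc_SeqI[OF 1 2] by (simp only: xc_assoc)
  qed
  have "xc n hblocks (\<sigma>(vJ := js, vR := map Lb ?qs)) (\<sigma>(vJ := [], vR := map Lb (hpat (length W) (length js) @ ?qs)))"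
    by (rule Cons.IH) (use Cons.prems in simp)
  then have "xc n hblocks ?s0 (\<sigma>(vJ := [], vR := map Lb (hpat (length W) (length js) @ ?qs)))"
    unfolding hblocks_def by (rule xc_WhileT[OF _ b, rotated]) simp
  then show ?case unfolding list.size(4) add_Suc_right add_0_right hpat_Suc .
qed

definition lblocks :: "sym com" where
  "lblocks = While vK (Pop vK ;; copy vW vJ t1 ;; Push vJ (Bt True) ;; hblocks ;; block True ;; block False)"

lemma lpat_Suc: "lpat N (Suc k) @ qs =
    lpat N k @ replicate N False @ replicate N True @ hpat N (Suc N) @ qs"
  unfolding lpat_def by (simp flip: replicate_append_same)

lemma length_lpat: "length (lpat N k) = k * need N"
  by (induction k) (auto simp: lpat_def length_hpat need_def)

lemma xc_lblocks:
  assumes "\<sigma> vW = map Tk W" "\<sigma> t1 = []" "\<sigma> t2 = []" "\<sigma> vJ = []" "length W < n"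
    "length ks * need (length W) + length qs \<le> n"
  shows "xc n lblocks (\<sigma>(vK := ks, vR := map Lb qs)) (\<sigma>(vK := [], vR := map Lb (lpat (length W) (length ks) @ qs)))"
  using assms(6)
proof (induction ks arbitrary: qs)
  case Nil
  show ?case unfolding lblocks_def by (rule xc_eq[OF xc_WhileF]) (auto simp: lpat_def)
next
  case (Cons k ks)
  let ?N = "length W"
  let ?js = "Bt True # map Tk W"
  let ?q1 = "hpat ?N (Suc ?N) @ qs"
  let ?q2 = "replicate ?N True @ ?q1"
  let ?q3 = "replicate ?N False @ ?q2"
  let ?s0 = "\<sigma>(vK := k # ks, vR := map Lb qs)" and ?s1 = "\<sigma>(vK := ks, vR := map Lb qs)"
  have "need ?N + length ks * need ?N + length qs \<le> n" using Cons.prems by simp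
  then have l: "?N + ?N + Suc ?N * Suc ?N + length qs \<le> n" unfolding need_def by linarith
  have l1: "Suc ?N * Suc ?N + length qs \<le> n" and l2: "?N + length ?q1 \<le> n" and l3: "?N + length ?q2 \<le> n"
    using l unfolding length_append length_hpat length_replicate by linarith+
  have 1: "xc n (Pop vK) ?s0 ?s1" by (auto simp: xcs fun_eq_iff)
  have 2: "xc n (copy vW vJ t1) ?s1 (?s1(vJ := map Tk W))"
    by (rule xc_eq[OF xc_copy]) (use assms in \<open>auto simp: fun_eq_iff\<close>)
  let ?\<tau> = "\<sigma>(vK := ks)"
  have 3: "xc n (Push vJ (Bt True)) (?s1(vJ := map Tk W)) (?\<tau>(vJ := ?js, vR := map Lb qs))"
    using assms(5) by (auto simp: xcs fun_eq_iff)
  have 4: "xc n hblocks (?\<tau>(vJ := ?js, vR := map Lb qs)) (?\<tau>(vJ := [], vR := map Lb (hpat ?N (length ?js) @ qs)))"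
    by (rule xc_hblocks) (use assms l1 in auto)
  have e: "length ?js = Suc ?N" by simp
  have 5: "xc n (block True) (?\<tau>(vJ := [], vR := map Lb ?q1)) (?\<tau>(vJ := [], vR := map Lb ?q2))"
    by (rule xc_eq[OF xc_block[of _ W ?q1]]) (use assms l2 in \<open>auto simp: fun_eq_iff\<close>)
  have 6: "xc n (block False) (?\<tau>(vJ := [], vR := map Lb ?q2)) (\<sigma>(vK := ks, vR := map Lb ?q3))"
    by (rule xc_eq[OF xc_block[of _ W ?q2]]) (use assms l3 in \<open>auto simp: fun_eq_iff\<close>)
  note b = xc_SeqI[OF 1 xc_SeqI[OF 2 xc_SeqI[OF 3 xc_SeqI[OF 4[unfolded e] xc_SeqI[OF 5 6]]]]]
  have lq: "length ?q3 = need ?N + length qs" by (simp add: length_hpat need_def)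
  have "xc n lblocks (\<sigma>(vK := ks, vR := map Lb ?q3)) (\<sigma>(vK := [], vR := map Lb (lpat ?N (length ks) @ ?q3)))"
    by (rule Cons.IH) (use Cons.prems lq in simp)
  then have "xc n lblocks ?s0 (\<sigma>(vK := [], vR := map Lb (lpat ?N (length ks) @ ?q3)))"
    unfolding lblocks_def by (rule xc_WhileT[OF _ b, rotated]) simp
  then show ?case unfolding list.size(4) add_Suc_right add_0_right lpat_Suc .
qed

definition build :: "sym com" where
  "build = copy vW vK t1 ;; lblocks ;; block True"

lemma xc_build:
  assumes "\<sigma> vW = map Tk W" "\<sigma> t1 = []" "\<sigma> t2 = []" "\<sigma> vJ = []" "\<sigma> vK = []" "\<sigma> vR = []"
    "length W < n" "length W + length W * need (length W) \<le> n"
  shows "xc n build \<sigma> (\<sigma>(vR := map Lb (pat (length W))))"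
proof -
  let ?N = "length W"
  have 1: "xc n (copy vW vK t1) \<sigma> (\<sigma>(vK := map Tk W, vR := map Lb []))"
    by (rule xc_eq[OF xc_copy]) (use assms in \<open>auto simp: fun_eq_iff\<close>)
  have 2: "xc n lblocks (\<sigma>(vK := map Tk W, vR := map Lb [])) (\<sigma>(vK := [], vR := map Lb (lpat ?N (length (map Tk W)) @ [])))"
    by (rule xc_lblocks) (use assms in auto)
  have 3: "xc n (block True) (\<sigma>(vK := [], vR := map Lb (lpat ?N (length (map Tk W)) @ []))) (\<sigma>(vR := map Lb (pat ?N)))"
    by (rule xc_eq[OF xc_block[of _ W "lpat ?N ?N"]])
      (use assms in \<open>auto simp: fun_eq_iff pat_def length_lpat\<close>)
  show ?thesis unfolding build_def by (rule xc_SeqI[OF 1 xc_SeqI[OF 2 3]])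
qed

definition search :: "sym com" where
  "search = build ;; Push vph (Bt True) ;; While vph gbody ;; Case vfl (\<lambda>f. if f = None then Skip else Push 1 (Bt True))"

definition main :: "sym com" where
  "main = lexer ;; move t1 vW ;; pass ;; verdict ;; Case vbad (\<lambda>x. if x = None then search else Skip)"

lemma xc_search:
  assumes cl: "clean W \<sigma>" and W: "W = toks \<phi>"
    and e: "\<sigma> 1 = []" "\<sigma> vX = []" "\<sigma> vR = []" "\<sigma> vY = []" "\<sigma> vS = []" "\<sigma> vK = []" "\<sigma> vfl = []" "\<sigma> vph = []"
    and B: "length W < n" "length W + length W * need (length W) \<le> n"
  shows "\<exists>\<tau>. xc n search \<sigma> \<tau> \<and> (\<tau> 1 \<noteq> [] \<longleftrightarrow> \<not> qeval (pat (length W)) (leaf W))"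
proof -
  let ?N = "length W" and ?v = "qeval (pat (length W)) (leaf W)"
  let ?qs = "pat ?N"
  have c: "\<sigma> vW = map Tk W" "\<sigma> t1 = []" "\<sigma> t2 = []" "\<sigma> vJ = []" using cl by (simp_all add: clean_def)
  have 1: "xc n build \<sigma> (\<sigma>(vR := map Lb ?qs))" by (rule xc_build) (use c e B in auto)
  have 2: "xc n (Push vph (Bt True)) (\<sigma>(vR := map Lb ?qs)) (gst \<sigma> True [] ?qs False)"
    using e B by (auto simp: xcs gst_def fun_eq_iff)
  let ?\<tau> = "(gst \<sigma> False [] ?qs (\<not> ?v))(vph := [])"
  have stop: "xc n gbody (gst \<sigma> False [] ?qs (\<not> ?v)) ?\<tau>"
    by (auto simp: gbody_def xcs gst_def fun_eq_iff)
  have f: "xc n (While vph gbody) (gst \<sigma> False [] ?qs (\<not> ?v)) ?\<tau>"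
    by (rule xc_WhileT[OF _ stop xc_WhileF]) (simp_all add: gst_def)
  have 3: "xc n (While vph gbody) (gst \<sigma> True [] ?qs False) ?\<tau>"
    by (rule xc_dfs[OF cl W e(4-6) B]) (use f in \<open>simp_all add: pat_def length_lpat\<close>)
  let ?r = "if ?v then ?\<tau> else ?\<tau>(1 := [Bt True])"
  have 4: "xc n (Case vfl (\<lambda>f. if f = None then Skip else Push 1 (Bt True))) ?\<tau> ?r"
    using e B by (cases ?v) (auto simp: xcs gst_def fun_eq_iff)
  have "?r 1 \<noteq> [] \<longleftrightarrow> \<not> ?v" using e by (auto simp: gst_def)
  then show ?thesis unfolding search_def using xc_SeqI[OF 1 xc_SeqI[OF 2 xc_SeqI[OF 3 4]]] by blast
qed

lemma length_tkz: "length (fst (tkz w)) \<le> length w"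
  by (induction w rule: tkz.induct) auto

lemma xc_main:
  assumes B: "length w < n" "length w + length w * need (length w) \<le> n"
  defines "W \<equiv> fst (tkz w)"
  shows "\<exists>\<tau>. xc n main (\<lambda>i. if i = 0 then map Bt w else []) \<tau> \<and>
    (\<tau> 1 \<noteq> [] \<longleftrightarrow> \<not> snd (tkz w) \<and> parse_ok W \<and> \<not> qeval (pat (length W)) (leaf W))"
proof -
  define s0 :: "nat \<Rightarrow> sym list" where "s0 = (\<lambda>i. if i = 0 then map Bt w else [])"
  have lW: "length W \<le> length w" unfolding W_def by (rule length_tkz)
  have n: "0 < n" "length W < n" using B lW by auto
  have "need (length W) \<le> need (length w)" unfolding need_def by (intro add_le_mono mult_le_mono) (use lW in auto)
  then have B2: "length W + length W * need (length W) \<le> n"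
    using lW B(2) by (meson add_le_mono le_trans mult_le_mono)
  let ?b = "snd (tkz w)"
  let ?s1 = "s0(0 := [], t1 := map Tk (rev W) @ [], vbad := fl (False \<or> ?b))"
  let ?s2 = "s0(0 := [], vW := map Tk W, vbad := fl ?b)"
  have i: "s0 = s0(0 := map Bt w, t1 := [], vbad := fl False)" by (auto simp: s0_def fun_eq_iff)
  have 1: "xc n lexer s0 ?s1"
    by (subst i) (unfold W_def, rule xc_lexer, use B in auto)
  have 2: "xc n (move t1 vW) ?s1 ?s2"
    by (rule xc_eq[OF xc_move]) (use n in \<open>auto simp: s0_def fun_eq_iff rev_map\<close>)
  obtain V dg bad inc where p: "prun (rev W) (rev []) ([], None, ?b, False) = (V, dg, bad, inc)" by (metis prod_cases4)
  let ?s3 = "?s2(vV := map Bt V, vdg := (case dg of None \<Rightarrow> [] | Some d \<Rightarrow> [Bt d]), vbad := fl bad, vfl := fl inc)"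
  have 3: "xc n pass ?s2 ?s3"
    by (rule xc_pass[of _ W "[]", OF _ _ _ _ _ _ _ _ _ _ _ _ p]) (use n in \<open>auto simp: s0_def\<close>)
  let ?bad = "bad \<or> dg \<noteq> None \<or> length V \<noteq> 1"
  let ?s4 = "s0(0 := [], vW := map Tk W, vbad := fl ?bad)"
  have 4: "xc n verdict ?s3 ?s4"
    by (rule xc_eq[OF xc_verdict[of _ _ V dg bad]]) (use n in \<open>auto simp: s0_def fun_eq_iff\<close>)
  \<comment> \<open>The scan never clears its error flag, so an error found by the lexer survives
    the parsing pass.\<close>
  have bad: "\<not> ?bad \<longleftrightarrow> \<not> ?b \<and> parse_ok W"
  proof (cases ?b)
    case True
    have "fst (snd (snd (prun U S st)))" if "fst (snd (snd st))" for U S st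
      using that
    proof (induction U arbitrary: S st)
      case (Cons t U)
      have "fst (snd (snd (pstep t (hdF S) st)))" using Cons.prems by (cases st; cases t) auto
      then show ?case using Cons.IH by simp
    qed simp
    from this[of "([], None, ?b, False)" "rev W" "rev []"] p True have bad by simp
    then show ?thesis using True by simp
  next
    case False
    then show ?thesis using p by (auto simp: parse_ok_def)
  qed
  have "\<exists>\<tau>. xc n (Case vbad (\<lambda>x. if x = None then search else Skip)) ?s4 \<tau> \<and>
     (\<tau> 1 \<noteq> [] \<longleftrightarrow> \<not> ?bad \<and> \<not> qeval (pat (length W)) (leaf W))"
  proof (cases ?bad)
    case True
    then have "xc n (Case vbad (\<lambda>x. if x = None then search else Skip)) ?s4 ?s4" by (simp add: xcs)
    moreover have "?s4 1 = []" by (simp add: s0_def)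
    ultimately show ?thesis using True by blast
  next
    case False
    then obtain \<phi> where \<phi>: "W = toks \<phi>" using bad parse_ok_iff by blast
    have "\<exists>\<tau>. xc n search ?s4 \<tau> \<and> (\<tau> 1 \<noteq> [] \<longleftrightarrow> \<not> qeval (pat (length W)) (leaf W))"
      by (rule xc_search[OF _ \<phi>]) (use False n B2 in \<open>auto simp: s0_def clean_def\<close>)
    moreover have "tos (?s4 vbad) = None" using False by simp
    ultimately show ?thesis unfolding xc_Case using False by (simp only: if_True simp_thms)
  qed
  then obtain \<tau> where t: "xc n (Case vbad (\<lambda>x. if x = None then search else Skip)) ?s4 \<tau>"
     "\<tau> 1 \<noteq> [] \<longleftrightarrow> \<not> ?bad \<and> \<not> qeval (pat (length W)) (leaf W)" by blast
  have "xc n main s0 \<tau>" unfolding main_def by (rule xc_SeqI[OF 1 xc_SeqI[OF 2 xc_SeqI[OF 3 xc_SeqI[OF 4 t(1)]]]])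
  then show ?thesis using t(2) bad unfolding s0_def by blast
qed

lemma wfc_pact: "wfc 26 (pact t s)"
  by (cases t) (auto simp: ckdg_def opV_def setf_def split: option.split sym.split)

text \<open>The program works on stacks 0 to 25; stack 26 is the output, which stays empty.\<close>

lemma wfc_main: "wfc 26 main"
  by (simp add: main_def search_def build_def block_def lblocks_def hblocks_def lexer_def verdict_def
      gbody_def leafp_def unload_def level_def halve_def hbody_def challenge_def dbody_def abody_def cmp_def
      cmpb_def sub_def sbody_def pass_def pbody_def fetch_def copy_def dup_def clear_def move_def setf_def wfc_pact
      split: option.split sym.split)

text \<open>The highest stacks hold the quantifier prefix, of length at most
  \<open>n + n * need n\<close>, a cubic polynomial; \<open>(n + 4) ^ 3\<close> bounds it and
  exceeds \<open>n\<close> as well.\<close>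

theorem DP_ab_in_PSPACE:
  assumes "infinite (UNIV :: 'w set)"
  shows "DP_ab TYPE('w) \<in> PSPACE"
proof (rule PSPACE_I[where c = main and k = 26 and emb = Bt and p = "[:4, 1:] ^ 3"])
  show "inj Bt" by (auto simp: inj_def)
  show "wfc 26 main" by (rule wfc_main)
  fix w :: "bool list"
  let ?n = "poly ([:4, 1:] ^ 3) (length w)"
  have n: "?n = (length w + 4) ^ 3" by (simp add: poly_power add.commute)
  have "length w + length w * need (length w) \<le> ?n" "length w < ?n"
    unfolding n need_def by (simp_all add: power3_eq_cube algebra_simps)
  then obtain \<tau> where "xc ?n main (\<lambda>i. if i = 0 then map Bt w else []) \<tau>"
    "\<tau> 1 \<noteq> [] \<longleftrightarrow> w \<in> DP_ab TYPE('w)"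
    using xc_main[of w ?n] spec_correct[OF assms, of w] by metis
  then show "\<exists>t \<sigma>. (\<sigma> 1 \<noteq> [] \<longleftrightarrow> w \<in> DP_ab TYPE('w)) \<and> length w \<le> ?n \<and>
      exec (enat ?n) main (\<lambda>i. if i = 0 then map Bt w else []) t \<sigma>"
    using \<open>length w < ?n\<close> unfolding xc_def by (meson less_imp_le)
qed simp

theorem theorem1:
  assumes "infinite (UNIV :: 'w set)"
  shows "PSPACE_complete (DP_ab TYPE('w))"
  unfolding PSPACE_complete_def using DP_ab_in_PSPACE[OF assms] PSPACE_hard[OF assms] by blast

end
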